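(* Let $m\ge5$ and $l\ge2$ be integers and let $G=C_{lm}(S)$ with $S=\{s\in\{1,\dots,\lfloor lm/2\rfloor\}: s=l\text{ or } l\nmid s\}$ (equivalently, the join of $l$ copies of $C_m$). Then $\mathrm{reg}(R/I(G))=\lfloor (m+1)/3\rfloor$, and for every integer $r$ with $2\le r<\lfloor (m+1)/3\rfloor$ and every $i$, $$\beta_{i,i+r}(G)=\frac{lm}{m-2r}\binom{m-2r}{r}\binom{(l-1)m+r}{i-r}.$$
   Context: The circulant graph $C_n(S)$ ($S\subseteq\{1,\dots,\lfloor n/2\rfloor\}$) has vertex set $\{0,\dots,n-1\}$ with $\{a,b\}$ an edge iff $\min(|a-b|,n-|a-b|)\in S$. For a graph $G$ on vertex set $V$, $R=\mathbb{K}[x_v:v\in V]$ over a fixed field $\mathbb{K}$, $I(G)=\langle x_ux_v:\{u,v\}\in E(G)\rangle$, $\beta_{i,d}(G)=\beta_{i,d}(R/I(G))$ is the graded Betti number, and $\mathrm{reg}(R/I(G))=\max\{d-i:\beta_{i,d}(G)\ne0\}$. Binomial coefficients $\binom{a}{b}$ are $0$ if $b<0$ or $b>a$. *)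

theory Defs
  imports Complex_Main "HOL-Library.Function_Algebras"
begin

text \<open>Graphs: vertex set V (finite set of naturals), symmetric edge relation E.
  The polynomial ring R = K[x_v : v in V] is modelled through its monomial basis:
  a monomial is an exponent vector mu :: nat => nat supported on V.
  For the edge ideal I(G) (a monomial ideal) the quotient R/I(G) has as K-basis the
  standard monomials, i.e. those not divisible by any x_u x_v with uv an edge.\<close>

definition circulant_edge :: "nat \<Rightarrow> nat set \<Rightarrow> nat \<Rightarrow> nat \<Rightarrow> bool" where
  "circulant_edge n S a b \<longleftrightarrow> a < n \<and> b < n \<and> a \<noteq> b \<and>
     (let k = (if a \<le> b then b - a else a - b) in min k (n - k) \<in> S)"

definition standard_mono :: "(nat \<Rightarrow> nat \<Rightarrow> bool) \<Rightarrow> (nat \<Rightarrow> nat) \<Rightarrow> bool" where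
  "standard_mono E mu \<longleftrightarrow> \<not> (\<exists>u v. u \<noteq> v \<and> E u v \<and> 0 < mu u \<and> 0 < mu v)"

text \<open>Basis of the degree-d part of the i-th module of the Koszul complex
  K(x_v : v in V) tensor R/I(G): elements e_F tensor x^mu with |F| = i,
  x^mu a standard monomial of degree d - i.\<close>
definition koszul_basis ::
  "nat set \<Rightarrow> (nat \<Rightarrow> nat \<Rightarrow> bool) \<Rightarrow> nat \<Rightarrow> nat \<Rightarrow> (nat set \<times> (nat \<Rightarrow> nat)) set" where
  "koszul_basis V E i d = {(F, mu). F \<subseteq> V \<and> card F = i \<and> (\<forall>v. v \<notin> V \<longrightarrow> mu v = 0)
      \<and> i + sum mu V = d \<and> standard_mono E mu}"

text \<open>Coefficient of e_G tensor x^nu in the Koszul differential of e_F tensor x^mu: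
  d(e_F x^mu) = sum over j in F of (-1)^(number of k in F below j) x_j x^mu e_(F - j),
  where x_j x^mu is zero in R/I(G) if it is not standard.\<close>
definition koszul_coef ::
  "(nat \<Rightarrow> nat \<Rightarrow> bool) \<Rightarrow> (nat set \<times> (nat \<Rightarrow> nat)) \<Rightarrow> (nat set \<times> (nat \<Rightarrow> nat)) \<Rightarrow> 'k::field" where
  "koszul_coef E b c = (case b of (F, mu) \<Rightarrow> case c of (G, nu) \<Rightarrow>
      (\<Sum>j\<in>F. if G = F - {j} \<and> nu = mu(j := Suc (mu j)) \<and> standard_mono E nu
               then (-1) ^ card {k\<in>F. k < j} else 0))"

definition koszul_chains ::
  "'k::field itself \<Rightarrow> nat set \<Rightarrow> (nat \<Rightarrow> nat \<Rightarrow> bool) \<Rightarrow> nat \<Rightarrow> nat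
     \<Rightarrow> ((nat set \<times> (nat \<Rightarrow> nat)) \<Rightarrow> 'k) set" where
  "koszul_chains K V E i d = {c. \<forall>b. b \<notin> koszul_basis V E i d \<longrightarrow> c b = 0}"

definition koszul_diff ::
  "nat set \<Rightarrow> (nat \<Rightarrow> nat \<Rightarrow> bool) \<Rightarrow> nat \<Rightarrow> nat
     \<Rightarrow> ((nat set \<times> (nat \<Rightarrow> nat)) \<Rightarrow> 'k::field) \<Rightarrow> ((nat set \<times> (nat \<Rightarrow> nat)) \<Rightarrow> 'k)" where
  "koszul_diff V E i d c = (\<lambda>g. if g \<in> koszul_basis V E (i - 1) d
      then (\<Sum>b\<in>koszul_basis V E i d. c b * koszul_coef E b g) else 0)"

definition koszul_cycles ::
  "'k::field itself \<Rightarrow> nat set \<Rightarrow> (nat \<Rightarrow> nat \<Rightarrow> bool) \<Rightarrow> nat \<Rightarrow> nat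
     \<Rightarrow> ((nat set \<times> (nat \<Rightarrow> nat)) \<Rightarrow> 'k) set" where
  "koszul_cycles K V E i d = {c \<in> koszul_chains K V E i d. i = 0 \<or> koszul_diff V E i d c = (\<lambda>g. 0)}"

definition koszul_boundaries ::
  "'k::field itself \<Rightarrow> nat set \<Rightarrow> (nat \<Rightarrow> nat \<Rightarrow> bool) \<Rightarrow> nat \<Rightarrow> nat
     \<Rightarrow> ((nat set \<times> (nat \<Rightarrow> nat)) \<Rightarrow> 'k) set" where
  "koszul_boundaries K V E i d = koszul_diff V E (Suc i) d ` koszul_chains K V E (Suc i) d"

definition kdim :: "'k::field itself \<Rightarrow> ('b \<Rightarrow> 'k) set \<Rightarrow> nat" where
  "kdim K W = vector_space.dim (\<lambda>(a::'k) f x. a * f x) W"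

text \<open>Graded Betti number beta_(i,d)(R/I(G)) = dim_K Tor_i^R(R/I(G), K)_d, computed as the
  degree-d homology of the Koszul complex K(x_v : v in V) tensor R/I(G).\<close>
definition betti ::
  "'k::field itself \<Rightarrow> nat set \<Rightarrow> (nat \<Rightarrow> nat \<Rightarrow> bool) \<Rightarrow> nat \<Rightarrow> nat \<Rightarrow> nat" where
  "betti K V E i d = kdim K (koszul_cycles K V E i d) - kdim K (koszul_boundaries K V E i d)"

definition reg :: "'k::field itself \<Rightarrow> nat set \<Rightarrow> (nat \<Rightarrow> nat \<Rightarrow> bool) \<Rightarrow> int" where
  "reg K V E = Max {int d - int i | i d. betti K V E i d \<noteq> 0}"

end

theory Submission
  imports Defs
begin

text \<open>The Koszul complex splits by multidegree. A multidegree that is not squarefree contributes a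
  cone, hence nothing; the multidegree of a vertex set W contributes the simplicial cochain complex
  of the independence complex of W (Hochster's formula). In degrees r at least 2 the independence
  complex of a join is a disjoint union, so everything reduces to subsets U of a single cycle.
  A proper U is a union of paths, and removing a leaf together with the closed neighbourhood of its
  neighbour lowers the degree by one: the cohomology has dimension at most 1 and sits in one degree.
  For the full cycle, the deletion and the link of a vertex are paths, which leaves only the degree
  (m + 1) div 3. The number of U of size k is found by counting pairs (U, v) with v outside U,
  since cutting the cycle at v gives a path, and Vandermonde's identity sums over the other copies.\<close>

subsection \<open>Dimension of a quotient\<close>

text \<open>Cohomology is never formed as a quotient space. It is represented by cocycles that are
  independent and generating modulo coboundaries; such families can be extended by zero, relabelled
  and glued. A Betti number, by definition a difference of two dimensions, is then the size of such
  a family. Signs are the obstacle that shapes the middle of the proof. The Koszul sign of a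
  multidegree \<open>W\<close> is used on subsets of \<open>W\<close>, shifted by a vertex when a
  link is taken, and pulled back along a rotation that does not preserve the order of the vertices.
  No formula survives all three, so only the two properties in \<open>sign_fun\<close> are kept. The
  degree \<open>r\<close> counts the vertices of a face, so it is the reduced cohomological degree
  plus one. The bound 2 on \<open>r\<close> comes from the empty face, which the copies share; the
  degree \<open>(m + 1) div 3\<close> is excepted because there the full cycle contributes as well.
  The factor \<open>m / (m - 2 * r) * (m - 2 * r choose r)\<close> is the number of ways to place
  \<open>r\<close> disjoint arcs of three vertices on an m-cycle: each leaf removal uses up one
  arc.\<close>

lemma (in vector_space) dim_eq_plus_card_quotient_basis:
  fixes z :: "'i \<Rightarrow> 'b"
  assumes B: "subspace B" "finite S" "B \<subseteq> span S"
    and Z: "subspace Z" "B \<subseteq> Z"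
    and I: "finite I" "\<And>i. i \<in> I \<Longrightarrow> z i \<in> Z"
    and ind: "\<And>c. (\<Sum>i\<in>I. scale (c i) (z i)) \<in> B \<Longrightarrow> \<forall>i\<in>I. c i = 0"
    and gen: "\<And>y. y \<in> Z \<Longrightarrow> \<exists>c. y - (\<Sum>i\<in>I. scale (c i) (z i)) \<in> B"
  shows "dim Z = dim B + card I"
proof -
  obtain X where X: "X \<subseteq> B" "independent X" "B \<subseteq> span X" "card X = dim B"
    using basis_exists by blast
  have fX: "finite X"
    using independent_span_bound[OF B(2) X(2)] X(1) B(3) by blast
  have spX: "span X = B"
    using X(1,3) B(1) span_subspace by blast
  \<comment> \<open>The third conjunct is carried along because it turns membership of a new
    \<open>z i\<close> in the span into a relation that \<open>ind\<close> forbids; the cardinality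
    yields injectivity of \<open>z\<close> on the way.\<close>
  have ext: "independent (X \<union> z ` J) \<and> card (X \<union> z ` J) = card X + card J
      \<and> (\<forall>y \<in> span (X \<union> z ` J). \<exists>c. y - (\<Sum>i\<in>J. scale (c i) (z i)) \<in> B)" if "J \<subseteq> I" for J
    using finite_subset[OF that I(1)] that
  proof (induction J rule: finite_induct)
    case empty
    show ?case using X(2) spX by auto
  next
    case (insert i J)
    then have IH: "independent (X \<union> z ` J)" "card (X \<union> z ` J) = card X + card J"
      "\<forall>y \<in> span (X \<union> z ` J). \<exists>c. y - (\<Sum>i\<in>J. scale (c i) (z i)) \<in> B" by auto
    have ni: "z i \<notin> span (X \<union> z ` J)"
    proof
      assume "z i \<in> span (X \<union> z ` J)"
      then obtain c where c: "z i - (\<Sum>i\<in>J. scale (c i) (z i)) \<in> B" using IH(3) by blast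
      \<comment> \<open>The relation between \<open>z i\<close> and the earlier vectors, read as
        coefficients on all of \<open>I\<close>; its entry 1 at \<open>i\<close> contradicts
        \<open>ind\<close>.\<close>
      define c' where "c' k = (if k = i then 1 else if k \<in> J then - c k else 0)" for k
      have 1: "(\<Sum>k\<in>J. scale (c' k) (z k)) = - (\<Sum>k\<in>J. scale (c k) (z k))"
        unfolding sum_negf[symmetric] using insert.hyps by (intro sum.cong) (auto simp: c'_def)
      have "(\<Sum>k\<in>I. scale (c' k) (z k)) = (\<Sum>k\<in>insert i J. scale (c' k) (z k))"
        using insert.prems I(1) by (intro sum.mono_neutral_right) (auto simp: c'_def)
      also have "\<dots> = scale (c' i) (z i) + (\<Sum>k\<in>J. scale (c' k) (z k))"
        by (rule sum.insert[OF insert.hyps])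
      also have "\<dots> = z i - (\<Sum>k\<in>J. scale (c k) (z k))"
        unfolding 1 by (simp add: c'_def)
      finally have "(\<Sum>k\<in>I. scale (c' k) (z k)) \<in> B" using c by simp
      from ind[OF this] insert.prems have "c' i = 0" by blast
      then show False by (simp add: c'_def)
    qed
    then have nin: "z i \<notin> X \<union> z ` J" using span_base[of "z i" "X \<union> z ` J"] by blast
    have eq: "X \<union> z ` insert i J = insert (z i) (X \<union> z ` J)" by auto
    have 1: "independent (X \<union> z ` insert i J)"
      unfolding eq using independent_insertI[OF ni IH(1)] .
    have 2: "card (X \<union> z ` insert i J) = card X + card (insert i J)"
      unfolding eq using nin IH(2) insert.hyps fX by simp
    have 3: "\<exists>c. y - (\<Sum>i\<in>insert i J. scale (c i) (z i)) \<in> B" 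
      if y: "y \<in> span (X \<union> z ` insert i J)" for y
    proof -
      obtain k where "y - scale k (z i) \<in> span (X \<union> z ` J)"
        using y unfolding eq span_insert by auto
      then obtain c where c: "y - scale k (z i) - (\<Sum>i\<in>J. scale (c i) (z i)) \<in> B"
        using IH(3) by blast
      have "(\<Sum>j\<in>J. scale ((c(i := k)) j) (z j)) = (\<Sum>j\<in>J. scale (c j) (z j))"
        using insert.hyps by (intro sum.cong) auto
      then have "y - (\<Sum>j\<in>insert i J. scale ((c(i := k)) j) (z j)) \<in> B"
        using c insert.hyps by (simp add: algebra_simps)
      then show ?thesis by blast
    qed
    show ?case using 1 2 3 by blast
  qed
  have "X \<union> z ` I \<subseteq> Z" using X(1) Z(2) I(2) by auto
  moreover have "Z \<subseteq> span (X \<union> z ` I)"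
  proof
    fix y assume "y \<in> Z"
    then obtain c where c: "y - (\<Sum>i\<in>I. scale (c i) (z i)) \<in> B" using gen by blast
    then have "y - (\<Sum>i\<in>I. scale (c i) (z i)) \<in> span (X \<union> z ` I)"
      using spX span_mono[of X "X \<union> z ` I"] by blast
    moreover have "(\<Sum>i\<in>I. scale (c i) (z i)) \<in> span (X \<union> z ` I)"
      by (intro span_sum span_scale span_base) auto
    ultimately have "(y - (\<Sum>i\<in>I. scale (c i) (z i))) + (\<Sum>i\<in>I. scale (c i) (z i)) \<in> span (X \<union> z ` I)"
      by (rule span_add)
    then show "y \<in> span (X \<union> z ` I)" by simp
  qed
  ultimately have "dim Z = card (X \<union> z ` I)"
    using ext[of I] by (intro dim_unique) auto
  then show ?thesis using ext[of I] X(4) by simp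
qed

lemma (in vector_space) dim_strict_mono:
  assumes "subspace B" "B \<subset> Z" "finite S" "Z \<subseteq> span S"
  shows "dim B < dim Z"
proof -
  obtain X where X: "X \<subseteq> B" "independent X" "B \<subseteq> span X" "card X = dim B"
    using basis_exists by blast
  obtain Y where Y: "X \<subseteq> Y" "Y \<subseteq> Z" "independent Y" "Z \<subseteq> span Y"
    using maximal_independent_subset_extend[of X Z] X(1,2) assms(2) by blast
  have fY: "finite Y"
    using independent_span_bound[OF assms(3) Y(3)] Y(2) assms(4) by blast
  have "span X = B"
    using X(1,3) assms(1) span_subspace by blast
  then have "X \<noteq> Y" using Y(4) assms(2) by blast
  then have "card X < card Y" using Y(1) fY by (intro psubset_card_mono) auto
  moreover have "dim Z = card Y" using Y by (intro dim_unique) auto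
  ultimately show ?thesis using X(4) by simp
qed

subsection \<open>Cohomology of simplicial complexes with abstract signs\<close>

text \<open>Cochains are total functions on vertex sets; a complex enters only through the faces on
  which \<open>cocycle\<close> and \<open>coboundary\<close> demand an equation. The empty face
  counts, so this is the augmented complex. \<open>s A j\<close> is the sign of adding
  \<open>j\<close> to \<open>A\<close>.\<close>

definition cob :: "('a set \<Rightarrow> 'a \<Rightarrow> 'k::field) \<Rightarrow> ('a set \<Rightarrow> 'k) \<Rightarrow> 'a set \<Rightarrow> 'k" where
  "cob s y T = (\<Sum>j\<in>T. s (T - {j}) j * y (T - {j}))"

text \<open>The anticommutation makes \<open>cob\<close> square to zero; the first condition makes
  every sign its own inverse, which the contracting homotopy of a cone uses.\<close>

definition sign_fun :: "'a set \<Rightarrow> ('a set \<Rightarrow> 'a \<Rightarrow> 'k::field) \<Rightarrow> bool" where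
  "sign_fun W s \<longleftrightarrow>
     (\<forall>A j. A \<subseteq> W \<longrightarrow> j \<in> W - A \<longrightarrow> s A j * s A j = 1) \<and>
     (\<forall>A j k. A \<subseteq> W \<longrightarrow> j \<in> W - A \<longrightarrow> k \<in> W - A \<longrightarrow> j \<noteq> k \<longrightarrow>
        s A j * s (insert j A) k = - (s A k * s (insert k A) j))"

definition complex_on :: "'a set \<Rightarrow> 'a set set \<Rightarrow> bool" where
  "complex_on W D \<longleftrightarrow> finite W \<and> D \<subseteq> Pow W \<and> (\<forall>A\<in>D. \<forall>B. B \<subseteq> A \<longrightarrow> B \<in> D)"

definition cocycle :: "'a set set \<Rightarrow> ('a set \<Rightarrow> 'a \<Rightarrow> 'k::field) \<Rightarrow> nat \<Rightarrow> ('a set \<Rightarrow> 'k) \<Rightarrow> bool" where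
  "cocycle D s r y \<longleftrightarrow> (\<forall>T\<in>D. card T = Suc r \<longrightarrow> cob s y T = 0)"

definition coboundary :: "'a set set \<Rightarrow> ('a set \<Rightarrow> 'a \<Rightarrow> 'k::field) \<Rightarrow> nat \<Rightarrow> ('a set \<Rightarrow> 'k) \<Rightarrow> bool" where
  "coboundary D s r y \<longleftrightarrow> (\<exists>w. \<forall>T\<in>D. card T = r \<longrightarrow> y T = cob s w T)"

definition acyclic_at :: "'a set set \<Rightarrow> ('a set \<Rightarrow> 'a \<Rightarrow> 'k::field) \<Rightarrow> nat \<Rightarrow> bool" where
  "acyclic_at D s r \<longleftrightarrow> (\<forall>y. cocycle D s r y \<longrightarrow> coboundary D s r y)"

text \<open>The classes of the \<open>z i\<close> form a basis of the cohomology in degree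
  \<open>r\<close>. The index type is free so that bases of several complexes can be combined over a
  dependent sum of index sets.\<close>

definition cohom_basis :: "'a set set \<Rightarrow> ('a set \<Rightarrow> 'a \<Rightarrow> 'k::field) \<Rightarrow> nat \<Rightarrow> 'i set
    \<Rightarrow> ('i \<Rightarrow> 'a set \<Rightarrow> 'k) \<Rightarrow> bool" where
  "cohom_basis D s r I z \<longleftrightarrow> (\<forall>i\<in>I. cocycle D s r (z i)) \<and>
     (\<forall>c. coboundary D s r (\<lambda>A. \<Sum>i\<in>I. c i * z i A) \<longrightarrow> (\<forall>i\<in>I. c i = 0)) \<and>
     (\<forall>y. cocycle D s r y \<longrightarrow> (\<exists>c. coboundary D s r (\<lambda>A. y A - (\<Sum>i\<in>I. c i * z i A))))"

definition cohom_dim :: "'a set set \<Rightarrow> ('a set \<Rightarrow> 'a \<Rightarrow> 'k::field) \<Rightarrow> nat \<Rightarrow> nat \<Rightarrow> bool" where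
  "cohom_dim D s r n \<longleftrightarrow> (\<exists>z. cohom_basis D s r {..<n} z)"

lemma cohom_dim_0: "cohom_dim D s r 0 \<longleftrightarrow> acyclic_at D s r"
  by (auto simp: cohom_dim_def cohom_basis_def acyclic_at_def)

lemma cohom_basis_independent:
  assumes "cohom_basis D s r I z" "coboundary D s r (\<lambda>A. \<Sum>i\<in>I. c i * z i A)" "i \<in> I"
  shows "c i = 0"
  using assms by (auto simp: cohom_basis_def)

lemma cohom_dim_1_not_acyclic:
  assumes "cohom_dim D s r 1"
  shows "\<not> acyclic_at D s r"
proof
  assume a: "acyclic_at D s r"
  obtain z where z: "cohom_basis D s r {..<1::nat} z" using assms by (auto simp only: cohom_dim_def)
  then have "cocycle D s r (z 0)" by (auto simp: cohom_basis_def)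
  then have "coboundary D s r (z 0)" using a by (simp add: acyclic_at_def)
  then have "coboundary D s r (\<lambda>A. \<Sum>i<1::nat. (\<lambda>_. 1) i * z i A)" by (simp add: lessThan_Suc)
  from cohom_basis_independent[OF z this, of 0] show False by simp
qed

lemma complex_onD:
  assumes "complex_on W D" "A \<in> D"
  shows "finite A" "A \<subseteq> W" "B \<subseteq> A \<Longrightarrow> B \<in> D"
  using assms by (auto simp: complex_on_def dest: finite_subset)

lemma sign_fun_sq: "sign_fun W s \<Longrightarrow> A \<subseteq> W \<Longrightarrow> j \<in> W - A \<Longrightarrow> s A j * s A j = 1"
  by (auto simp: sign_fun_def)

lemma sign_fun_anticomm:
  assumes "sign_fun W s" "A \<subseteq> W" "j \<in> W - A" "k \<in> W - A" "j \<noteq> k"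
  shows "s A j * s (insert j A) k = - (s A k * s (insert k A) j)"
  by (rule assms(1)[unfolded sign_fun_def, THEN conjunct2, rule_format, OF assms(2-5)])

lemma sign_fun_subset:
  assumes "sign_fun W s" "U \<subseteq> W"
  shows "sign_fun U s"
  unfolding sign_fun_def
proof (intro conjI allI impI)
  fix A j assume "A \<subseteq> U" "j \<in> U - A"
  then show "s A j * s A j = 1" using assms(2) by (intro sign_fun_sq[OF assms(1)]) auto
next
  fix A j k assume "A \<subseteq> U" "j \<in> U - A" "k \<in> U - A" "j \<noteq> k"
  then show "s A j * s (insert j A) k = - (s A k * s (insert k A) j)"
    using assms(2) by (intro sign_fun_anticomm[OF assms(1)]) auto
qed

text \<open>The terms for (i, j) and (j, i) cancel. They are cancelled in pairs, since in
  characteristic 2 nothing follows from S = -S.\<close>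

lemma sum_antisymmetric:
  fixes f :: "'a \<Rightarrow> 'a \<Rightarrow> 'b::ab_group_add"
  assumes "finite A" "\<And>i j. i \<in> A \<Longrightarrow> j \<in> A \<Longrightarrow> i \<noteq> j \<Longrightarrow> f i j = - f j i"
  shows "(\<Sum>i\<in>A. \<Sum>j\<in>A - {i}. f i j) = 0"
  using assms
proof (induction A rule: finite_induct)
  case (insert x A)
  have a: "(\<Sum>j\<in>insert x A - {i}. f i j) = f i x + (\<Sum>j\<in>A - {i}. f i j)" if "i \<in> A" for i
  proof -
    have "insert x A - {i} = insert x (A - {i})" using that insert.hyps by auto
    then show ?thesis using insert.hyps by simp
  qed
  have b: "insert x A - {x} = A" using insert.hyps by auto
  have "(\<Sum>i\<in>insert x A. \<Sum>j\<in>insert x A - {i}. f i j)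
      = (\<Sum>j\<in>A. f x j) + (\<Sum>i\<in>A. \<Sum>j\<in>insert x A - {i}. f i j)"
    unfolding sum.insert[OF insert.hyps] b ..
  also have "\<dots> = (\<Sum>j\<in>A. f x j) + (\<Sum>i\<in>A. f i x + (\<Sum>j\<in>A - {i}. f i j))"
    using a by (metis (mono_tags, lifting) sum.cong)
  also have "\<dots> = (\<Sum>j\<in>A. f x j + f j x)"
  proof -
    have "(\<Sum>i\<in>A. \<Sum>j\<in>A - {i}. f i j) = 0"
      by (rule insert.IH, rule insert.prems) auto
    then show ?thesis by (simp add: sum.distrib)
  qed
  also have "\<dots> = 0"
  proof (intro sum.neutral ballI)
    fix j assume "j \<in> A"
    then have "f x j = - f j x" using insert.hyps by (intro insert.prems) auto
    then show "f x j + f j x = 0" by simp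
  qed
  finally show ?case .
qed simp

lemma cob_cob:
  assumes s: "sign_fun W s" and T: "finite T" "T \<subseteq> W"
  shows "cob s (cob s w) T = 0"
proof -
  have "cob s (cob s w) T
      = (\<Sum>i\<in>T. \<Sum>j\<in>T - {i}. s (T - {i}) i * (s (T - {i} - {j}) j * w (T - {i} - {j})))"
    by (simp add: cob_def sum_distrib_left)
  also have "\<dots> = 0"
  proof (rule sum_antisymmetric[OF T(1)])
    fix i j assume ij: "i \<in> T" "j \<in> T" "i \<noteq> j"
    let ?A = "T - {i} - {j}"
    have e: "T - {j} - {i} = ?A" by auto
    have i1: "insert j ?A = T - {i}" and i2: "insert i ?A = T - {j}" using ij by auto
    have "s ?A j * s (T - {i}) i = - (s ?A i * s (T - {j}) j)"
      using sign_fun_anticomm[OF s, of ?A j i] ij T(2) unfolding i1 i2 by auto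
    then have "s ?A j * s (T - {i}) i * w ?A = - (s ?A i * s (T - {j}) j) * w ?A" by simp
    then show "s (T - {i}) i * (s (T - {i} - {j}) j * w (T - {i} - {j})) =
       - (s (T - {j}) j * (s (T - {j} - {i}) i * w (T - {j} - {i})))"
      unfolding e by (simp add: mult_ac)
  qed
  finally show ?thesis .
qed

lemma cob_add: "cob s (\<lambda>A. y A + w A) T = cob s y T + cob s w T"
  and cob_diff: "cob s (\<lambda>A. y A - w A) T = cob s y T - cob s w T"
  by (simp_all add: cob_def algebra_simps sum.distrib sum_subtractf)

lemma cob_cong:
  assumes "\<And>j. j \<in> T \<Longrightarrow> y (T - {j}) = w (T - {j})"
  shows "cob s y T = cob s w T"
  using assms by (simp add: cob_def)

lemma cocycle_cong:
  assumes "complex_on W D" "\<And>A. A \<in> D \<Longrightarrow> card A = r \<Longrightarrow> y A = w A"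
  shows "cocycle D s r y \<longleftrightarrow> cocycle D s r w"
proof -
  have "cob s y T = cob s w T" if "T \<in> D" "card T = Suc r" for T
    using that complex_onD[OF assms(1) that(1)] by (intro cob_cong assms(2)) auto
  then show ?thesis by (auto simp: cocycle_def)
qed

lemma coboundary_cong:
  assumes "\<And>A. A \<in> D \<Longrightarrow> card A = r \<Longrightarrow> y A = w A"
  shows "coboundary D s r y \<longleftrightarrow> coboundary D s r w"
  using assms by (auto simp: coboundary_def)

lemma cocycle_diff_cob:
  assumes "complex_on W D" "sign_fun W s" "cocycle D s r y"
  shows "cocycle D s r (\<lambda>A. y A - cob s w A)"
  using assms complex_onD[OF assms(1)] by (auto simp: cocycle_def cob_diff cob_cob)

text \<open>Contracting homotopy: up to sign, the primitive of a cocycle at \<open>A\<close> is its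
  value at the face with the apex \<open>a\<close> added, and 0 if the apex is already
  there.\<close>

lemma acyclic_at_cone:
  assumes D: "complex_on W D" and s: "sign_fun W s" and a: "a \<in> W" "\<And>A. A \<in> D \<Longrightarrow> insert a A \<in> D"
  shows "acyclic_at D s r"
  unfolding acyclic_at_def
proof (intro allI impI)
  fix y assume y: "cocycle D s r y"
  let ?h = "\<lambda>A. if a \<in> A then 0 else s A a * y (insert a A)"
  have "y T = cob s ?h T" if T: "T \<in> D" "card T = r" for T
  proof (cases "a \<in> T")
    case True
    have fT: "finite T" "T \<subseteq> W" using complex_onD[OF D T(1)] by auto
    have "cob s ?h T = (\<Sum>j\<in>{a}. s (T - {j}) j * ?h (T - {j}))"
      unfolding cob_def using True fT by (intro sum.mono_neutral_right) auto
    also have "\<dots> = s (T - {a}) a * s (T - {a}) a * y T"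
      using True by (simp add: insert_absorb)
    also have "\<dots> = y T" using sign_fun_sq[OF s, of "T - {a}" a] True fT a by auto
    finally show ?thesis by simp
  next
    case False
    have fT: "finite T" "T \<subseteq> W" using complex_onD[OF D T(1)] by auto
    \<comment> \<open>Off the apex, the cocycle condition at \<open>insert a T\<close> expresses
      \<open>y T\<close> through faces that contain \<open>a\<close>.\<close>
    have "cob s y (insert a T) = 0"
      using y a(2)[OF T(1)] T(2) False fT by (auto simp: cocycle_def)
    moreover have "cob s y (insert a T) = s T a * y T
        + (\<Sum>j\<in>T. s (insert a (T - {j})) j * y (insert a (T - {j})))"
    proof -
      have e: "insert a T - {j} = insert a (T - {j})" if "j \<in> T" for j using that False by auto
      have "insert a T - {a} = T" using False by auto
      then show ?thesis unfolding cob_def using False fT by (simp add: e)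
    qed
    ultimately have 1: "s T a * y T = - (\<Sum>j\<in>T. s (insert a (T - {j})) j * y (insert a (T - {j})))"
      by (simp add: eq_neg_iff_add_eq_0)
    have sq: "s T a * s T a = 1" using sign_fun_sq[OF s, of T a] False fT a by auto
    have "y T = s T a * (s T a * y T)" using sq by (simp add: mult.assoc[symmetric])
    also have "\<dots> = (\<Sum>j\<in>T. - (s T a * s (insert a (T - {j})) j * y (insert a (T - {j}))))"
      unfolding 1 by (simp add: sum_distrib_left sum_negf mult.assoc)
    also have "\<dots> = (\<Sum>j\<in>T. s (T - {j}) j * ?h (T - {j}))"
    proof (rule sum.cong[OF refl])
      fix j assume j: "j \<in> T"
      let ?A = "T - {j}"
      have ij: "insert j ?A = T" using j by auto
      have ja: "j \<in> W - ?A" "a \<in> W - ?A" "j \<noteq> a" "?A \<subseteq> W" using j False fT a by auto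
      have h: "s ?A j * s T a = - (s ?A a * s (insert a ?A) j)"
        using sign_fun_anticomm[OF s ja(4,1,2,3)] unfolding ij .
      have q1: "s ?A j * s ?A j = 1" using sign_fun_sq[OF s] ja by blast
      have q2: "s (insert a ?A) j * s (insert a ?A) j = 1" 
        using sign_fun_sq[OF s, of "insert a ?A" j] ja by blast
      have "s T a * s (insert a ?A) j = (s ?A j * s ?A j) * s T a * s (insert a ?A) j"
        unfolding q1 by simp
      also have "\<dots> = s ?A j * (s ?A j * s T a) * s (insert a ?A) j" by (simp add: mult_ac)
      also have "\<dots> = - (s ?A j * s ?A a * (s (insert a ?A) j * s (insert a ?A) j))"
        unfolding h by (simp add: mult_ac)
      finally have "s T a * s (insert a ?A) j = - (s ?A j * s ?A a)" unfolding q2 by simp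
      then show "- (s T a * s (insert a ?A) j * y (insert a ?A)) = s ?A j * ?h ?A"
        using False by simp
    qed
    finally show ?thesis by (simp add: cob_def)
  qed
  then show "coboundary D s r y" unfolding coboundary_def by blast
qed

text \<open>A vertex kills the class of the empty face: the cocycle condition at \<open>{a}\<close>
  forces the value at \<open>{}\<close> to be 0.\<close>

lemma acyclic_at_0:
  assumes "sign_fun W s" "a \<in> W" "{a} \<in> D" "complex_on W D"
  shows "acyclic_at D s 0"
  unfolding acyclic_at_def
proof (intro allI impI)
  fix y assume y: "cocycle D s 0 y"
  then have "s {} a * y {} = 0" using assms(3) by (auto simp: cocycle_def cob_def)
  then have "y {} = 0" using sign_fun_sq[OF assms(1), of "{}" a] assms(2) by auto
  then show "coboundary D s 0 y"
    using complex_onD(1)[OF assms(4)] by (auto simp: coboundary_def cob_def)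
qed

section \<open>The exact sequence of the deletion and the link of a vertex\<close>

definition link :: "'a set set \<Rightarrow> 'a \<Rightarrow> 'a set set" where
  "link D b = {A. b \<notin> A \<and> insert b A \<in> D}"

definition del :: "'a set set \<Rightarrow> 'a \<Rightarrow> 'a set set" where
  "del D b = {A\<in>D. b \<notin> A}"

text \<open>The summands other than \<open>b\<close> form a coboundary in the link once its signs
  are taken as \<open>s (insert b A)\<close>; with this shift no further sign enters the comparison
  with the link.\<close>

lemma cob_split:
  assumes "finite T" "b \<in> T"
  shows "cob s y T = s (T - {b}) b * y (T - {b})
     + cob (\<lambda>A. s (insert b A)) (\<lambda>A. y (insert b A)) (T - {b})"
proof -
  have "insert b (T - {b} - {j}) = T - {j}" if "j \<in> T - {b}" for j using that assms by auto
  then show ?thesis unfolding cob_def using assms by (simp add: sum.remove)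
qed

lemma cocycle_delI: "cocycle D s r y \<Longrightarrow> cocycle (del D b) s r y"
  by (auto simp: cocycle_def del_def)

text \<open>A cocycle is cohomologous to one that vanishes off the star of b.\<close>

lemma cocycle_reduce_link:
  assumes D: "complex_on W D" and s: "sign_fun W s"
    and del: "acyclic_at (del D b) s (Suc r)" and y: "cocycle D s (Suc r) y"
  shows "\<exists>w. cocycle (link D b) (\<lambda>A. s (insert b A)) r (\<lambda>A. y (insert b A) - cob s w (insert b A))
    \<and> (\<forall>A\<in>D. b \<notin> A \<longrightarrow> card A = Suc r \<longrightarrow> y A = cob s w A)"
proof -
  have "coboundary (del D b) s (Suc r) y"
    using del cocycle_delI[OF y] by (simp add: acyclic_at_def)
  then obtain w where w: "\<And>A. A \<in> D \<Longrightarrow> b \<notin> A \<Longrightarrow> card A = Suc r \<Longrightarrow> y A = cob s w A"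
    by (auto simp: coboundary_def del_def)
  let ?y = "\<lambda>A. y A - cob s w A"
  have c: "cocycle D s (Suc r) ?y" by (rule cocycle_diff_cob[OF D s y])
  have "cocycle (link D b) (\<lambda>A. s (insert b A)) r (\<lambda>A. ?y (insert b A))"
    unfolding cocycle_def
  proof (intro ballI impI)
    fix T assume T: "T \<in> link D b" "card T = Suc r"
    have iT: "insert b T \<in> D" and bT: "b \<notin> T" using T by (auto simp: link_def)
    have TD: "T \<in> D" "finite T" using complex_onD[OF D iT] by auto
    have "cob s ?y (insert b T) = 0" using c iT bT TD T(2) by (auto simp: cocycle_def)
    moreover have "?y T = 0" using w[OF TD(1) bT T(2)] by simp
    moreover have "insert b T - {b} = T" using bT by auto
    ultimately show "cob (\<lambda>A. s (insert b A)) (\<lambda>A. ?y (insert b A)) T = 0"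
      using cob_split[of "insert b T" b s ?y] TD by simp
  qed
  then show ?thesis using w by blast
qed

text \<open>Extension of a cochain of the link by zero off the star of \<open>b\<close>. It raises
  the degree by one and identifies the cohomology of the link with that of the complex relative to
  the deletion of \<open>b\<close>.\<close>

definition cone_ext :: "'a \<Rightarrow> ('a set \<Rightarrow> 'k::zero) \<Rightarrow> 'a set \<Rightarrow> 'k" where
  "cone_ext b y A = (if b \<in> A then y (A - {b}) else 0)"

lemma cob_cone_ext:
  assumes "finite T" "b \<in> T"
  shows "cob s (cone_ext b y) T = cob (\<lambda>A. s (insert b A)) y (T - {b})"
proof -
  have "cob (\<lambda>A. s (insert b A)) (\<lambda>A. cone_ext b y (insert b A)) (T - {b})
      = cob (\<lambda>A. s (insert b A)) y (T - {b})"
    by (rule cob_cong) (auto simp: cone_ext_def)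
  then show ?thesis using cob_split[OF assms, of s "cone_ext b y"] by (simp add: cone_ext_def)
qed

lemma cob_cone_ext_0: "b \<notin> T \<Longrightarrow> cob s (cone_ext b y) T = 0"
  by (auto simp: cob_def cone_ext_def)

text \<open>The half of the exact sequence that gives surjectivity of the map from the link. It uses
  the deletion in degree \<open>Suc r\<close> only, so \<open>acyclic_at_link_del\<close> can call
  it by itself.\<close>

lemma cohom_basis_link_gen:
  assumes D: "complex_on W D" and s: "sign_fun W s"
    and del: "acyclic_at (del D b) s (Suc r)"
    and L: "cohom_basis (link D b) (\<lambda>A. s (insert b A)) r I z"
    and y: "cocycle D s (Suc r) y"
  shows "\<exists>c. coboundary D s (Suc r) (\<lambda>A. y A - (\<Sum>i\<in>I. c i * cone_ext b (z i) A))"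
proof -
  obtain w where 
    w: "cocycle (link D b) (\<lambda>A. s (insert b A)) r (\<lambda>A. y (insert b A) - cob s w (insert b A))"
      "\<And>A. A \<in> D \<Longrightarrow> b \<notin> A \<Longrightarrow> card A = Suc r \<Longrightarrow> y A = cob s w A"
    using cocycle_reduce_link[OF D s del y] by blast
  obtain c u where u: "\<And>A. A \<in> link D b \<Longrightarrow> card A = r \<Longrightarrow>
      y (insert b A) - cob s w (insert b A) - (\<Sum>i\<in>I. c i * z i A) = cob (\<lambda>A. s (insert b A)) u A"
    using L w(1) unfolding cohom_basis_def coboundary_def by blast
  have "y T - (\<Sum>i\<in>I. c i * cone_ext b (z i) T) = cob s (\<lambda>A. w A + cone_ext b u A) T"
    if T: "T \<in> D" "card T = Suc r" for T
  proof (cases "b \<in> T")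
    case True
    have fT: "finite T" using complex_onD[OF D T(1)] by auto
    have "T - {b} \<in> link D b" "card (T - {b}) = r"
      using True T by (auto simp: link_def insert_absorb)
    from u[OF this] True have "y T - cob s w T - (\<Sum>i\<in>I. c i * z i (T - {b}))
        = cob (\<lambda>A. s (insert b A)) u (T - {b})" by (simp add: insert_absorb)
    then show ?thesis using True
      unfolding cob_add cob_cone_ext[OF fT True] by (simp add: cone_ext_def algebra_simps)
  next
    case False
    then show ?thesis using w(2)[OF T(1) False T(2)]
      unfolding cob_add cob_cone_ext_0[OF False] by (simp add: cone_ext_def)
  qed
  then show ?thesis unfolding coboundary_def by blast
qed

text \<open>The two degrees of the deletion are the neighbouring terms of the exact sequence: degree
  \<open>Suc r\<close> gives generation, degree \<open>r\<close> gives independence.\<close>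

lemma cohom_basis_link:
  assumes D: "complex_on W D" and s: "sign_fun W s"
    and del: "acyclic_at (del D b) s (Suc r)" "acyclic_at (del D b) s r"
    and L: "cohom_basis (link D b) (\<lambda>A. s (insert b A)) r I z"
  shows "cohom_basis D s (Suc r) I (\<lambda>i. cone_ext b (z i))"
  unfolding cohom_basis_def
proof (intro conjI allI impI ballI)
  fix i assume i: "i \<in> I"
  have zi: "cocycle (link D b) (\<lambda>A. s (insert b A)) r (z i)" using L i by (auto simp: cohom_basis_def)
  show "cocycle D s (Suc r) (cone_ext b (z i))"
    unfolding cocycle_def
  proof (intro ballI impI)
    fix T assume T: "T \<in> D" "card T = Suc (Suc r)"
    have fT: "finite T" using complex_onD[OF D T(1)] by auto
    show "cob s (cone_ext b (z i)) T = 0"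
    proof (cases "b \<in> T")
      case True
      have "T - {b} \<in> link D b" "card (T - {b}) = Suc r"
        using True T by (auto simp: link_def insert_absorb)
      then show ?thesis using zi by (simp add: cob_cone_ext[OF fT True] cocycle_def)
    qed (simp add: cob_cone_ext_0)
  qed
next
  fix c i assume b: "coboundary D s (Suc r) (\<lambda>A. \<Sum>i\<in>I. c i * cone_ext b (z i) A)" and i: "i \<in> I"
  obtain w where w: "\<And>T. T \<in> D \<Longrightarrow> card T = Suc r \<Longrightarrow> (\<Sum>i\<in>I. c i * cone_ext b (z i) T) = cob s w T"
    using b by (auto simp: coboundary_def)
  \<comment> \<open>Every \<open>cone_ext\<close> vanishes on faces without \<open>b\<close>, so
    there \<open>w\<close> has coboundary 0.\<close>
  have "cocycle (del D b) s r w"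
    unfolding cocycle_def
  proof (intro ballI impI)
    fix T assume T: "T \<in> del D b" "card T = Suc r"
    then show "cob s w T = 0" using w[of T] by (simp add: del_def cone_ext_def)
  qed
  then obtain u where u: "\<And>A. A \<in> D \<Longrightarrow> b \<notin> A \<Longrightarrow> card A = r \<Longrightarrow> w A = cob s u A"
    using del(2) by (auto simp: acyclic_at_def coboundary_def del_def)
  \<comment> \<open>Correcting \<open>w\<close> by a coboundary leaves its own coboundary unchanged
    and makes it vanish on the faces without \<open>b\<close>; what is left is a primitive in the
    link.\<close>
  let ?w = "\<lambda>A. w A - cob s u A"
  have "(\<Sum>i\<in>I. c i * z i T) = cob (\<lambda>A. s (insert b A)) (\<lambda>A. ?w (insert b A)) T"
    if T: "T \<in> link D b" "card T = r" for T
  proof -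
    have iT: "insert b T \<in> D" and bT: "b \<notin> T" using T by (auto simp: link_def)
    have TD: "T \<in> D" "finite T" "insert b T \<subseteq> W" using complex_onD[OF D iT] by auto
    have e: "insert b T - {b} = T" using bT by auto
    have "(\<Sum>i\<in>I. c i * z i T) = (\<Sum>i\<in>I. c i * cone_ext b (z i) (insert b T))"
      using e by (simp add: cone_ext_def)
    also have "\<dots> = cob s w (insert b T)" using iT bT T(2) TD by (intro w) auto
    also have "\<dots> = cob s ?w (insert b T)"
      using cob_cob[OF s _ TD(3)] TD by (simp add: cob_diff)
    also have "\<dots> = cob (\<lambda>A. s (insert b A)) (\<lambda>A. ?w (insert b A)) T"
      using cob_split[of "insert b T" b s ?w] e TD u[OF TD(1) bT T(2)] by simp
    finally show ?thesis .
  qed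
  then have "coboundary (link D b) (\<lambda>A. s (insert b A)) r (\<lambda>A. \<Sum>i\<in>I. c i * z i A)"
    unfolding coboundary_def by blast
  then show "c i = 0" using L i by (auto simp: cohom_basis_def)
next
  fix y assume "cocycle D s (Suc r) y"
  then show "\<exists>c. coboundary D s (Suc r) (\<lambda>A. y A - (\<Sum>i\<in>I. c i * cone_ext b (z i) A))"
    by (rule cohom_basis_link_gen[OF D s del(1) L])
qed

lemma cohom_dim_link:
  assumes "complex_on W D" "sign_fun W s" "\<And>r. acyclic_at (del D b) s r"
    and "cohom_dim (link D b) (\<lambda>A. s (insert b A)) r n"
  shows "cohom_dim D s (Suc r) n"
proof -
  obtain z where "cohom_basis (link D b) (\<lambda>A. s (insert b A)) r {..<n} z"
    using assms(4) by (auto simp: cohom_dim_def)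
  from cohom_basis_link[OF assms(1-3) assms(3) this] show ?thesis
    unfolding cohom_dim_def by blast
qed

lemma acyclic_at_link_del:
  assumes "complex_on W D" "sign_fun W s" "acyclic_at (del D b) s (Suc r)"
    and "acyclic_at (link D b) (\<lambda>A. s (insert b A)) r"
  shows "acyclic_at D s (Suc r)"
proof -
  have "cohom_basis (link D b) (\<lambda>A. s (insert b A)) r {} (\<lambda>_::nat. undefined)"
    using assms(4) by (simp add: cohom_basis_def acyclic_at_def)
  from cohom_basis_link_gen[OF assms(1-3) this] show ?thesis
    by (simp add: acyclic_at_def)
qed

section \<open>Signs and cohomology under links and relabelling\<close>

lemma sign_fun_link:
  assumes "sign_fun W s" "b \<in> W" "U \<subseteq> W - {b}"
  shows "sign_fun U (\<lambda>A. s (insert b A))"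
  unfolding sign_fun_def
proof (intro conjI allI impI)
  fix A j assume "A \<subseteq> U" "j \<in> U - A"
  then show "s (insert b A) j * s (insert b A) j = 1"
    using assms by (intro sign_fun_sq[OF assms(1)]) auto
next
  fix A j k assume "A \<subseteq> U" "j \<in> U - A" "k \<in> U - A" "j \<noteq> k"
  then show "s (insert b A) j * s (insert b (insert j A)) k =
       - (s (insert b A) k * s (insert b (insert k A)) j)"
    using assms sign_fun_anticomm[OF assms(1), of "insert b A" j k]
    by (auto simp: insert_commute)
qed

text \<open>Both properties of a sign function survive any injective relabelling, although a sign
  given by counting smaller vertices loses that form when \<open>f\<close> is not monotone.\<close>

lemma sign_fun_image:
  assumes "sign_fun (f ` W) s" "inj_on f W"
  shows "sign_fun W (\<lambda>A j. s (f ` A) (f j))"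
  unfolding sign_fun_def
proof (intro conjI allI impI)
  fix A j assume "A \<subseteq> W" "j \<in> W - A"
  then show "s (f ` A) (f j) * s (f ` A) (f j) = 1"
    using assms by (intro sign_fun_sq[OF assms(1)]) (auto simp: inj_on_def)
next
  fix A j k assume *: "A \<subseteq> W" "j \<in> W - A" "k \<in> W - A" "j \<noteq> k"
  then show "s (f ` A) (f j) * s (f ` insert j A) (f k) =
       - (s (f ` A) (f k) * s (f ` insert k A) (f j))"
    using sign_fun_anticomm[OF assms(1), of "f ` A" "f j" "f k"] assms(2)
    by (auto simp: inj_on_def)
qed

lemma cob_image:
  assumes "inj_on f W" "T \<subseteq> W"
  shows "cob s y (f ` T) = cob (\<lambda>A j. s (f ` A) (f j)) (\<lambda>A. y (f ` A)) T"
proof -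
  have i: "inj_on f T" using assms inj_on_subset by blast
  have "f ` T - {f j} = f ` (T - {j})" if "j \<in> T" for j
    using that i by (auto simp: inj_on_def)
  then show ?thesis unfolding cob_def by (simp add: sum.reindex[OF i])
qed

lemma cohom_dim_image:
  assumes D: "complex_on W D" and f: "inj_on f W"
    and h: "cohom_dim D (\<lambda>A j. s (f ` A) (f j)) r n"
  shows "cohom_dim ((`) f ` D) s r n"
proof -
  let ?s = "\<lambda>A j. s (f ` A) (f j)"
  let ?g = "inv_into W f"
  have g: "?g ` f ` A = A" if "A \<subseteq> W" for A using f that by (rule inv_into_image_cancel)
  have card: "card (f ` A) = card A" if "A \<in> D" for A
    by (rule card_image[OF inj_on_subset[OF f complex_onD(2)[OF D that]]])
  have cc: "cocycle ((`) f ` D) s r y \<longleftrightarrow> cocycle D ?s r (\<lambda>A. y (f ` A))" for y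
    unfolding cocycle_def ball_simps
    by (intro ball_cong refl) (simp add: card cob_image[OF f complex_onD(2)[OF D]])
  have cb: "coboundary ((`) f ` D) s r y \<longleftrightarrow> coboundary D ?s r (\<lambda>A. y (f ` A))" for y
  proof
    assume "coboundary ((`) f ` D) s r y"
    then show "coboundary D ?s r (\<lambda>A. y (f ` A))"
      unfolding coboundary_def ball_simps
      by (elim exE, intro exI) (auto simp: card cob_image[OF f complex_onD(2)[OF D]])
  next
    assume "coboundary D ?s r (\<lambda>A. y (f ` A))"
    then obtain w where w: "\<And>T. T \<in> D \<Longrightarrow> card T = r \<Longrightarrow> y (f ` T) = cob ?s w T"
      by (auto simp: coboundary_def)
    have "y (f ` T) = cob s (\<lambda>A. w (?g ` A)) (f ` T)" if T: "T \<in> D" "card T = r" for T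
    proof -
      have TW: "T \<subseteq> W" using complex_onD[OF D T(1)] by auto
      have "cob s (\<lambda>A. w (?g ` A)) (f ` T) = cob ?s (\<lambda>A. w (?g ` f ` A)) T"
        by (rule cob_image[OF f TW])
      also have "\<dots> = cob ?s w T" using TW g by (intro cob_cong) (metis Diff_subset order_trans)
      finally show ?thesis using w[OF T] by simp
    qed
    then show "coboundary ((`) f ` D) s r y"
      using card unfolding coboundary_def by (intro exI[of _ "\<lambda>A. w (?g ` A)"]) auto
  qed
  obtain z where z: "cohom_basis D ?s r {..<n} z" using h by (auto simp: cohom_dim_def)
  have zc: "cocycle D ?s r (\<lambda>A. z i (?g ` f ` A)) \<longleftrightarrow> cocycle D ?s r (z i)" for i
    using g complex_onD[OF D] by (intro cocycle_cong[OF D]) auto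
  have zb1: "coboundary D ?s r (\<lambda>A. \<Sum>i<n. c i * z i (?g ` f ` A))
      \<longleftrightarrow> coboundary D ?s r (\<lambda>A. \<Sum>i<n. c i * z i A)" for c
    using g complex_onD[OF D] by (intro coboundary_cong) auto
  have zb2: "coboundary D ?s r (\<lambda>A. y A - (\<Sum>i<n. c i * z i (?g ` f ` A)))
      \<longleftrightarrow> coboundary D ?s r (\<lambda>A. y A - (\<Sum>i<n. c i * z i A))" for c y
    using g complex_onD[OF D] by (intro coboundary_cong) auto
  have "cohom_basis ((`) f ` D) s r {..<n} (\<lambda>i A. z i (?g ` A))"
    using z unfolding cohom_basis_def cc cb zc zb1 zb2 by simp
  then show ?thesis unfolding cohom_dim_def by blast
qed

text \<open>Different pieces share at most the empty face. For \<open>r \<ge> 2\<close> the faces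
  with \<open>r\<close> vertices and their facets are nonempty, so each lies in exactly one piece,
  and everything can be done piece by piece. For \<open>r = 1\<close> a primitive would live on the
  empty face, which the pieces share.\<close>

lemma cohom_basis_disjoint_union:
  fixes D :: "'c \<Rightarrow> 'a set set"
  assumes D: "\<And>c. c \<in> C \<Longrightarrow> complex_on W (D c)" and C: "finite C" "\<And>c. c \<in> C \<Longrightarrow> finite (I c)"
    and sub: "\<And>c. c \<in> C \<Longrightarrow> D c \<subseteq> E"
    and part: "\<And>A. A \<in> E \<Longrightarrow> A \<noteq> {} \<Longrightarrow> \<exists>c\<in>C. A \<in> D c"
    and disj: "\<And>A c c'. A \<in> D c \<Longrightarrow> A \<in> D c' \<Longrightarrow> A \<noteq> {} \<Longrightarrow> c \<in> C \<Longrightarrow> c' \<in> C \<Longrightarrow> c = c'"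
    and r: "2 \<le> r"
    and z: "\<And>c. c \<in> C \<Longrightarrow> cohom_basis (D c) s r (I c) (z c)"
  shows "cohom_basis E s r (Sigma C I) (\<lambda>(c, i) A. if A \<in> D c then z c i A else 0)"
proof -
  have ne: "A \<noteq> {}" if "card A \<ge> 1" for A :: "'a set" using that by auto
  have cc: "cocycle E s r y \<longleftrightarrow> (\<forall>c\<in>C. cocycle (D c) s r y)" for y
  proof
    assume "cocycle E s r y"
    then show "\<forall>c\<in>C. cocycle (D c) s r y" using sub unfolding cocycle_def by blast
  next
    assume y: "\<forall>c\<in>C. cocycle (D c) s r y"
    show "cocycle E s r y"
      unfolding cocycle_def
    proof (intro ballI impI)
      fix T assume T: "T \<in> E" "card T = Suc r"
      then obtain c where "c \<in> C" "T \<in> D c" using part[OF T(1)] ne[of T] by auto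
      then show "cob s y T = 0" using y T(2) by (auto simp: cocycle_def)
    qed
  qed
  have cb: "coboundary E s r y \<longleftrightarrow> (\<forall>c\<in>C. coboundary (D c) s r y)" for y
  proof
    assume "coboundary E s r y"
    then show "\<forall>c\<in>C. coboundary (D c) s r y" using sub unfolding coboundary_def by blast
  next
    assume "\<forall>c\<in>C. coboundary (D c) s r y"
    then have "\<forall>c. \<exists>w. c \<in> C \<longrightarrow> (\<forall>T\<in>D c. card T = r \<longrightarrow> y T = cob s w T)"
      unfolding coboundary_def by blast
    then obtain w where w: "\<And>c T. c \<in> C \<Longrightarrow> T \<in> D c \<Longrightarrow> card T = r \<Longrightarrow> y T = cob s (w c) T"
      by metis
    \<comment> \<open>The local primitives are glued by asking for the piece of \<open>A\<close>,
      which is unique for the nonempty sets that occur.\<close>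
    let ?w = "\<lambda>A. w (SOME c. c \<in> C \<and> A \<in> D c) A"
    have "y T = cob s ?w T" if T: "T \<in> E" "card T = r" for T
    proof -
      obtain c where c: "c \<in> C" "T \<in> D c" using part[OF T(1)] ne T(2) r by (metis One_nat_def Suc_1 Suc_leD)
      have "cob s ?w T = cob s (w c) T"
      proof (rule cob_cong)
        fix j assume j: "j \<in> T"
        have 1: "T - {j} \<in> D c" using complex_onD[OF D[OF c(1)] c(2)] by auto
        have 2: "T - {j} \<noteq> {}" using j T(2) r by (intro ne) (simp add: card_Diff_singleton)
        have "(SOME c. c \<in> C \<and> T - {j} \<in> D c) = c"
          using 1 2 c(1) disj by (intro some_equality) blast+
        then show "?w (T - {j}) = w c (T - {j})" by simp
      qed
      then show ?thesis using w[OF c T(2)] by simp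
    qed
    then show "coboundary E s r y" unfolding coboundary_def by (intro exI[of _ ?w]) blast
  qed
  let ?z = "\<lambda>(c, i) A. if A \<in> D c then z c i A else 0"
  have zz: "(\<Sum>p\<in>Sigma C I. a p * ?z p A) = (\<Sum>i\<in>I c. a (c, i) * z c i A)"
    if "c \<in> C" "A \<in> D c" "card A = r" for a c A
  proof -
    have n: "A \<noteq> {}" using that r by auto
    have "(\<Sum>p\<in>Sigma C I. a p * ?z p A) = (\<Sum>c'\<in>C. \<Sum>i\<in>I c'. a (c', i) * ?z (c', i) A)"
    proof (subst sum.Sigma)
      show "(\<Sum>p\<in>Sigma C I. a p * ?z p A) = (\<Sum>(c', i)\<in>Sigma C I. a (c', i) * ?z (c', i) A)"
        by (rule sum.cong[OF refl]) (simp only: split_paired_all prod.case)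
    qed (use C in auto)
    also have "\<dots> = (\<Sum>c'\<in>{c}. \<Sum>i\<in>I c'. a (c', i) * ?z (c', i) A)"
    proof (rule sum.mono_neutral_right)
      show "\<forall>c'\<in>C - {c}. (\<Sum>i\<in>I c'. a (c', i) * ?z (c', i) A) = 0"
      proof
        fix c' assume "c' \<in> C - {c}"
        then have "A \<notin> D c'" using disj[OF _ that(2) n _ that(1)] by blast
        then show "(\<Sum>i\<in>I c'. a (c', i) * ?z (c', i) A) = 0" by simp
      qed
    qed (use C that in auto)
    finally show ?thesis using that by simp
  qed
  show ?thesis
    unfolding cohom_basis_def
  proof (intro conjI allI impI ballI)
    fix p assume p: "p \<in> Sigma C I"
    then obtain c i where ci: "p = (c, i)" "c \<in> C" "i \<in> I c" by auto
    show "cocycle E s r (?z p)"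
      unfolding cc
    proof
      fix c' assume c': "c' \<in> C"
      show "cocycle (D c') s r (?z p)"
      proof (cases "c' = c")
        case True
        have "cocycle (D c) s r (?z p) \<longleftrightarrow> cocycle (D c) s r (z c i)"
          using ci by (intro cocycle_cong[OF D[OF ci(2)]]) auto
        then show ?thesis using z[OF ci(2)] ci True by (auto simp: cohom_basis_def)
      next
        case False
        have "cocycle (D c') s r (?z p) \<longleftrightarrow> cocycle (D c') s r (\<lambda>_. 0)"
          using ci c' False disj r by (intro cocycle_cong[OF D[OF c']]) fastforce
        then show ?thesis by (simp add: cocycle_def cob_def)
      qed
    qed
  next
    fix a p assume a: "coboundary E s r (\<lambda>A. \<Sum>p\<in>Sigma C I. a p * ?z p A)" and p: "p \<in> Sigma C I"
    then obtain c i where ci: "p = (c, i)" "c \<in> C" "i \<in> I c" by auto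
    have "coboundary (D c) s r (\<lambda>A. \<Sum>p\<in>Sigma C I. a p * ?z p A)" using a ci unfolding cb by blast
    moreover have "coboundary (D c) s r (\<lambda>A. \<Sum>p\<in>Sigma C I. a p * ?z p A)
        \<longleftrightarrow> coboundary (D c) s r (\<lambda>A. \<Sum>i\<in>I c. (\<lambda>i. a (c, i)) i * z c i A)"
      by (rule coboundary_cong) (rule zz[OF ci(2)])
    ultimately have "a (c, i) = 0"
      using cohom_basis_independent[OF z[OF ci(2)], of "\<lambda>i. a (c, i)" i] ci(3) by blast
    then show "a p = 0" using ci by auto
  next
    fix y assume y: "cocycle E s r y"
    have "\<forall>c. \<exists>a. c \<in> C \<longrightarrow> coboundary (D c) s r (\<lambda>A. y A - (\<Sum>i\<in>I c. a i * z c i A))"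
      using y z unfolding cc cohom_basis_def by blast
    then obtain a where a: "\<And>c. c \<in> C \<Longrightarrow> coboundary (D c) s r (\<lambda>A. y A - (\<Sum>i\<in>I c. a c i * z c i A))"
      by metis
    have "coboundary E s r (\<lambda>A. y A - (\<Sum>p\<in>Sigma C I. (\<lambda>(c, i). a c i) p * ?z p A))"
      unfolding cb
    proof
      fix c assume c: "c \<in> C"
      show "coboundary (D c) s r (\<lambda>A. y A - (\<Sum>p\<in>Sigma C I. (\<lambda>(c, i). a c i) p * ?z p A))"
      proof -
        have "coboundary (D c) s r (\<lambda>A. y A - (\<Sum>p\<in>Sigma C I. (\<lambda>(c, i). a c i) p * ?z p A))
            \<longleftrightarrow> coboundary (D c) s r (\<lambda>A. y A - (\<Sum>i\<in>I c. a c i * z c i A))"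
          by (rule coboundary_cong) (simp only: zz[OF c] prod.case)
        then show ?thesis using a[OF c] by blast
      qed
    qed
    then show "\<exists>a. coboundary E s r (\<lambda>A. y A - (\<Sum>p\<in>Sigma C I. a p * ?z p A))" by blast
  qed
qed

subsection \<open>Splitting the Koszul complex by multidegree\<close>

lemma coboundary_imp_cocycle:
  assumes "complex_on W D" "sign_fun W s" "coboundary D s r y"
  shows "cocycle D s r y"
proof -
  obtain w where w: "\<And>T. T \<in> D \<Longrightarrow> card T = r \<Longrightarrow> y T = cob s w T"
    using assms(3) by (auto simp: coboundary_def)
  have "cocycle D s r (cob s w)"
    using cob_cob[OF assms(2)] complex_onD[OF assms(1)] by (auto simp: cocycle_def)
  then show ?thesis using cocycle_cong[OF assms(1), of r y "cob s w"] w by simp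
qed

definition ind_complex :: "('a \<Rightarrow> 'a \<Rightarrow> bool) \<Rightarrow> 'a set \<Rightarrow> 'a set set" where
  "ind_complex E W = {A. A \<subseteq> W \<and> (\<forall>u\<in>A. \<forall>v\<in>A. u \<noteq> v \<longrightarrow> \<not> E u v)}"

lemma complex_on_ind_complex: "finite W \<Longrightarrow> complex_on W (ind_complex E W)"
  unfolding complex_on_def ind_complex_def by blast

definition supp :: "('a \<Rightarrow> nat) \<Rightarrow> 'a set" where
  "supp \<alpha> = {v. 0 < \<alpha> v}"

definition mdeg :: "nat set \<times> (nat \<Rightarrow> nat) \<Rightarrow> nat \<Rightarrow> nat" where
  "mdeg b = (\<lambda>v. snd b v + of_bool (v \<in> fst b))"

text \<open>Basis elements of multidegree \<alpha> are indexed by the complement A of the exterior part in the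
  support of \<alpha>: the Koszul differential then adds a vertex to A, like a simplicial coboundary.\<close>

definition koszul_elt :: "(nat \<Rightarrow> nat) \<Rightarrow> nat set \<Rightarrow> nat set \<times> (nat \<Rightarrow> nat)" where
  "koszul_elt \<alpha> A = (supp \<alpha> - A, \<lambda>v. \<alpha> v - of_bool (v \<in> supp \<alpha> - A))"

text \<open>The monomial part of \<open>koszul_elt \<alpha> A\<close> is supported on
  \<open>A \<union> {v. 2 \<le> \<alpha> v}\<close>; membership says that this monomial is nonzero
  modulo the edge ideal.\<close>

definition koszul_block :: "('a \<Rightarrow> 'a \<Rightarrow> bool) \<Rightarrow> ('a \<Rightarrow> nat) \<Rightarrow> 'a set set" where
  "koszul_block E \<alpha> = {A. A \<subseteq> supp \<alpha> \<and> A \<union> {v. 2 \<le> \<alpha> v} \<in> ind_complex E (supp \<alpha>)}"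

text \<open>\<open>W - A\<close> is the exterior part of the basis element, so this is the sign of
  the Koszul differential itself; the usual simplicial sign would count elements of \<open>A\<close>
  instead.\<close>

definition koszul_sign :: "nat set \<Rightarrow> nat set \<Rightarrow> nat \<Rightarrow> 'k::field" where
  "koszul_sign W A j = (-1) ^ card {k \<in> W - A. k < j}"

lemma sign_fun_koszul_sign:
  assumes "finite W"
  shows "sign_fun W (koszul_sign W :: nat set \<Rightarrow> nat \<Rightarrow> 'k::field)"
  unfolding sign_fun_def
proof (intro conjI allI impI)
  fix A j
  show "koszul_sign W A j * koszul_sign W A j = (1::'k)"
    by (simp add: koszul_sign_def flip: power_add)
next
  have lt: "koszul_sign W A j * koszul_sign W (insert j A) k
      = - (koszul_sign W A k * (koszul_sign W (insert k A) j :: 'k))"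
    if "j \<in> W - A" "j < k" for A j k
  proof -
    have "{x \<in> W - A. x < k} = insert j {x \<in> W - insert j A. x < k}" using that by auto
    then have "card {x \<in> W - A. x < k} = Suc (card {x \<in> W - insert j A. x < k})"
      using assms by simp
    moreover have "{x \<in> W - insert k A. x < j} = {x \<in> W - A. x < j}" using that by auto
    ultimately show ?thesis by (simp add: koszul_sign_def)
  qed
  fix A j k assume *: "A \<subseteq> W" "j \<in> W - A" "k \<in> W - A" "j \<noteq> k"
  consider "j < k" | "k < j" using * by linarith
  then show "koszul_sign W A j * koszul_sign W (insert j A) k
      = - (koszul_sign W A k * (koszul_sign W (insert k A) j :: 'k))"
  proof cases
    case 1 then show ?thesis using lt[of j A k] * by blast
  next
    case 2 then show ?thesis using lt[of k A j] * by simp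
  qed
qed

lemma complex_on_koszul_block: "finite (supp \<alpha>) \<Longrightarrow> complex_on (supp \<alpha>) (koszul_block E \<alpha>)"
  unfolding complex_on_def koszul_block_def ind_complex_def by blast

lemma koszul_blockD: "A \<in> koszul_block E \<alpha> \<Longrightarrow> A \<subseteq> supp \<alpha>"
  by (simp add: koszul_block_def)

lemma mdeg_koszul_elt: "A \<subseteq> supp \<alpha> \<Longrightarrow> mdeg (koszul_elt \<alpha> A) = \<alpha>"
  by (auto simp: mdeg_def koszul_elt_def fun_eq_iff supp_def)

lemma koszul_elt_inject:
  assumes "A \<subseteq> supp \<alpha>" "B \<subseteq> supp \<beta>" "koszul_elt \<alpha> A = koszul_elt \<beta> B"
  shows "\<alpha> = \<beta>" "A = B"
proof -
  show 1: "\<alpha> = \<beta>" using assms mdeg_koszul_elt by metis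
  have "supp \<alpha> - A = supp \<beta> - B" using assms(3) by (simp add: koszul_elt_def)
  then show "A = B" using assms(1,2) unfolding 1 by blast
qed

lemma fst_subset_supp_mdeg: "fst b \<subseteq> supp (mdeg b)"
  by (auto simp: supp_def mdeg_def)

lemma koszul_elt_mdeg: "koszul_elt (mdeg b) (supp (mdeg b) - fst b) = b"
proof -
  have "supp (mdeg b) - (supp (mdeg b) - fst b) = fst b" using fst_subset_supp_mdeg[of b] by auto
  then show ?thesis by (auto simp: koszul_elt_def mdeg_def fun_eq_iff prod_eq_iff)
qed

text \<open>The exterior and the monomial part add up to \<open>\<alpha>\<close>, and the support of
  the monomial decides whether it is standard. This is the dictionary between Koszul basis elements
  and faces.\<close>

lemma koszul_elt_in_basis:
  assumes V: "finite V" and A: "A \<subseteq> supp \<alpha>"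
  shows "koszul_elt \<alpha> A \<in> koszul_basis V E i d \<longleftrightarrow>
     supp \<alpha> \<subseteq> V \<and> sum \<alpha> V = d \<and> card (supp \<alpha> - A) = i \<and> A \<in> koszul_block E \<alpha>"
proof -
  let ?F = "supp \<alpha> - A" and ?mu = "\<lambda>v. \<alpha> v - of_bool (v \<in> supp \<alpha> - A)"
  have s: "{v. 0 < ?mu v} = A \<union> {v. 2 \<le> \<alpha> v}"
    using A by (auto simp: supp_def)
  have std: "standard_mono E ?mu \<longleftrightarrow> A \<in> koszul_block E \<alpha>"
  proof -
    have "standard_mono E ?mu \<longleftrightarrow> (\<forall>u\<in>{v. 0 < ?mu v}. \<forall>v\<in>{v. 0 < ?mu v}. u \<noteq> v \<longrightarrow> \<not> E u v)"
      unfolding standard_mono_def by blast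
    also have "\<dots> \<longleftrightarrow> A \<in> koszul_block E \<alpha>"
      unfolding s koszul_block_def ind_complex_def using A by (auto simp: supp_def)
    finally show ?thesis .
  qed
  have sub: "?F \<subseteq> V \<and> (\<forall>v. v \<notin> V \<longrightarrow> ?mu v = 0) \<longleftrightarrow> supp \<alpha> \<subseteq> V"
  proof
    assume h: "?F \<subseteq> V \<and> (\<forall>v. v \<notin> V \<longrightarrow> ?mu v = 0)"
    show "supp \<alpha> \<subseteq> V"
    proof
      fix v assume v: "v \<in> supp \<alpha>"
      show "v \<in> V"
      proof (rule ccontr)
        assume "v \<notin> V"
        then have "v \<notin> ?F" "?mu v = 0" using h by auto
        then show False using v by (simp add: supp_def)
      qed
    qed
  qed (auto simp: supp_def)
  have sm: "card ?F + sum ?mu V = sum \<alpha> V" if "supp \<alpha> \<subseteq> V"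
  proof -
    have F: "?F \<subseteq> V" using that by auto
    have "(\<Sum>v\<in>V. of_bool (v \<in> ?F)) = (\<Sum>v\<in>?F. 1::nat)"
      using V F by (intro sum.mono_neutral_cong_right) auto
    then have "card ?F = (\<Sum>v\<in>V. of_bool (v \<in> ?F))" by simp
    then have "card ?F + sum ?mu V = (\<Sum>v\<in>V. of_bool (v \<in> ?F) + ?mu v)" by (simp add: sum.distrib)
    also have "\<dots> = sum \<alpha> V" by (intro sum.cong refl) (auto simp: supp_def)
    finally show ?thesis .
  qed
  show ?thesis
    unfolding koszul_elt_def koszul_basis_def using std sub sm by auto
qed

lemma in_koszul_basisE:
  assumes "finite V" "b \<in> koszul_basis V E i d"
  obtains \<alpha> A where "b = koszul_elt \<alpha> A" "\<alpha> = mdeg b" "A = supp (mdeg b) - fst b" "A \<in> koszul_block E \<alpha>"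
    "supp \<alpha> \<subseteq> V" "sum \<alpha> V = d" "card (supp \<alpha> - A) = i"
proof -
  have "koszul_elt (mdeg b) (supp (mdeg b) - fst b) \<in> koszul_basis V E i d"
    using assms(2) by (simp add: koszul_elt_mdeg)
  then show thesis
    using koszul_elt_in_basis[OF assms(1), of "supp (mdeg b) - fst b" "mdeg b" E i d]
    by (intro that[OF koszul_elt_mdeg[symmetric] refl refl]) auto
qed

lemma finite_koszul_basis:
  assumes "finite V"
  shows "finite (koszul_basis V E i d)"
proof -
  have "koszul_basis V E i d \<subseteq> Pow V \<times> {f. \<forall>v. (v \<in> V \<longrightarrow> f v \<in> {..d}) \<and> (v \<notin> V \<longrightarrow> f v = 0)}"
  proof
    fix b assume b: "b \<in> koszul_basis V E i d"
    obtain F mu where Fm: "b = (F, mu)" by force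
    have "mu v \<le> d" if "v \<in> V" for v
      using member_le_sum[of v V mu] that assms b Fm by (auto simp: koszul_basis_def)
    then show "b \<in> Pow V \<times> {f. \<forall>v. (v \<in> V \<longrightarrow> f v \<in> {..d}) \<and> (v \<notin> V \<longrightarrow> f v = 0)}"
      using b Fm by (auto simp: koszul_basis_def)
  qed
  moreover have "finite (Pow V \<times> {f. \<forall>v. (v \<in> V \<longrightarrow> f v \<in> {..d}) \<and> (v \<notin> V \<longrightarrow> f v = (0::nat))})"
    using assms by (intro finite_cartesian_product finite_set_of_finite_funs) auto
  ultimately show ?thesis by (rule finite_subset)
qed

lemma koszul_coef_koszul_elt:
  assumes V: "finite V" and g: "koszul_elt \<alpha> T \<in> koszul_basis V E i d" "T \<subseteq> supp \<alpha>" and j: "j \<in> T"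
  shows "koszul_coef E (koszul_elt \<alpha> (T - {j})) (koszul_elt \<alpha> T) = koszul_sign (supp \<alpha>) (T - {j}) j"
proof -
  let ?F = "supp \<alpha> - (T - {j})" and ?G = "supp \<alpha> - T"
  let ?mu = "\<lambda>v. \<alpha> v - of_bool (v \<in> ?F)" and ?nu = "\<lambda>v. \<alpha> v - of_bool (v \<in> ?G)"
  have jF: "j \<in> ?F" using j g(2) by auto
  have fV: "finite ?F"
    using g V koszul_elt_in_basis[OF V g(2), of E i d] by (auto intro: finite_subset)
  have std: "standard_mono E ?nu" using g(1) by (auto simp: koszul_elt_def koszul_basis_def)
  have iff: "?G = ?F - {k} \<and> ?nu = ?mu(k := Suc (?mu k)) \<and> standard_mono E ?nu \<longleftrightarrow> k = j" if "k \<in> ?F" for k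
  proof
    assume "?G = ?F - {k} \<and> ?nu = ?mu(k := Suc (?mu k)) \<and> standard_mono E ?nu"
    then show "k = j" using jF j by auto
  next
    assume k: "k = j"
    have "?nu = ?mu(k := Suc (?mu k))" using j g(2) k by (auto simp: fun_eq_iff supp_def)
    moreover have "?G = ?F - {k}" using k j by auto
    ultimately show "?G = ?F - {k} \<and> ?nu = ?mu(k := Suc (?mu k)) \<and> standard_mono E ?nu"
      using std by blast
  qed
  have "koszul_coef E (koszul_elt \<alpha> (T - {j})) (koszul_elt \<alpha> T)
      = (\<Sum>k\<in>?F. if ?G = ?F - {k} \<and> ?nu = ?mu(k := Suc (?mu k)) \<and> standard_mono E ?nu
               then (-1) ^ card {x\<in>?F. x < k} else 0)"
    by (simp only: koszul_coef_def koszul_elt_def prod.case)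
  also have "\<dots> = (\<Sum>k\<in>?F. if k = j then (-1) ^ card {x\<in>?F. x < k} else 0)"
    by (intro sum.cong if_cong refl iff)
  also have "\<dots> = (-1) ^ card {x\<in>?F. x < j}" using fV jF by simp
  finally show ?thesis by (simp add: koszul_sign_def)
qed

text \<open>Undoing a term of the differential puts \<open>j\<close> back into the exterior part and
  lowers its exponent by one, which keeps the multidegree; hence the differential respects the
  blocks.\<close>

lemma koszul_coef_nonzero:
  assumes b: "b \<in> koszul_basis V E i d" and V: "finite V" and T: "T \<subseteq> supp \<alpha>"
    and nz: "koszul_coef E b (koszul_elt \<alpha> T) \<noteq> (0::'a::field)"
  shows "\<exists>j\<in>T. b = koszul_elt \<alpha> (T - {j})"
proof -
  obtain F mu where Fm: "b = (F, mu)" by force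
  let ?G = "supp \<alpha> - T" and ?nu = "\<lambda>v. \<alpha> v - of_bool (v \<in> supp \<alpha> - T)"
  have "\<exists>j\<in>F. ?G = F - {j} \<and> ?nu = mu(j := Suc (mu j))"
  proof (rule ccontr)
    assume "\<not> ?thesis"
    then have "koszul_coef E b (koszul_elt \<alpha> T) = (0::'a)"
      unfolding koszul_coef_def koszul_elt_def prod.case Fm by (intro sum.neutral ballI) meson
    then show False using nz by contradiction
  qed
  then obtain j where j: "j \<in> F" "?G = F - {j}" "?nu = mu(j := Suc (mu j))" by blast
  have nj: "?nu j = Suc (mu j)" using fun_cong[OF j(3), of j] by (simp only: fun_upd_same)
  then have js: "j \<in> supp \<alpha>" by (cases "j \<in> supp \<alpha>") (auto simp: supp_def)
  have jT: "j \<in> T" using j(2) js by auto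
  have F: "F = supp \<alpha> - (T - {j})" using j js jT by auto
  have "mu v = \<alpha> v - of_bool (v \<in> F)" for v
  proof (cases "v = j")
    case True then show ?thesis using nj jT j(1) by simp
  next
    case False
    then have "mu v = ?nu v" using fun_cong[OF j(3), of v] by (simp only: fun_upd_other[OF False])
    then show ?thesis using False F by auto
  qed
  then have "b = koszul_elt \<alpha> (T - {j})" unfolding Fm koszul_elt_def F by auto
  then show ?thesis using jT by blast
qed

lemma koszul_diff_koszul_elt:
  fixes c :: "(nat set \<times> (nat \<Rightarrow> nat)) \<Rightarrow> 'k::field"
  assumes V: "finite V" and i: "0 < i" and g: "koszul_elt \<alpha> T \<in> koszul_basis V E (i - 1) d" and T: "T \<subseteq> supp \<alpha>"
  shows "koszul_diff V E i d c (koszul_elt \<alpha> T)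
    = cob (koszul_sign (supp \<alpha>)) (\<lambda>A. c (koszul_elt \<alpha> A)) T"
proof -
  let ?B = "koszul_basis V E i d" and ?h = "\<lambda>j. koszul_elt \<alpha> (T - {j})"
  have gb: "supp \<alpha> \<subseteq> V" "sum \<alpha> V = d" "card (supp \<alpha> - T) = i - 1" "T \<in> koszul_block E \<alpha>"
    using g koszul_elt_in_basis[OF V T] by auto
  have fs: "finite (supp \<alpha>)" using gb(1) V by (rule finite_subset)
  have hB: "?h j \<in> ?B" if j: "j \<in> T" for j
  proof -
    have "T - {j} \<in> koszul_block E \<alpha>"
      using complex_onD(3)[OF complex_on_koszul_block[OF fs] gb(4)] by blast
    moreover have "supp \<alpha> - (T - {j}) = insert j (supp \<alpha> - T)" using j T by auto
    then have "card (supp \<alpha> - (T - {j})) = i" using fs j gb(3) i by simp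
    moreover have "T - {j} \<subseteq> supp \<alpha>" using T by auto
    ultimately show ?thesis using gb koszul_elt_in_basis[OF V, of "T - {j}" \<alpha>] by simp
  qed
  have inj: "inj_on ?h T"
  proof (rule inj_onI)
    fix j k assume *: "j \<in> T" "k \<in> T" "?h j = ?h k"
    have "T - {j} = T - {k}" by (rule koszul_elt_inject(2)[OF _ _ *(3)]) (use T in auto)
    then show "j = k" using * by auto
  qed
  have "koszul_diff V E i d c (koszul_elt \<alpha> T) = (\<Sum>b\<in>?B. c b * koszul_coef E b (koszul_elt \<alpha> T))"
    using g by (simp add: koszul_diff_def)
  also have "\<dots> = (\<Sum>b\<in>?h ` T. c b * koszul_coef E b (koszul_elt \<alpha> T))"
  proof (rule sum.mono_neutral_right[OF finite_koszul_basis[OF V]])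
    show "\<forall>b\<in>?B - ?h ` T. c b * koszul_coef E b (koszul_elt \<alpha> T) = 0"
    proof
      fix b assume b: "b \<in> ?B - ?h ` T"
      then have "koszul_coef E b (koszul_elt \<alpha> T) = (0::'k)"
        using koszul_coef_nonzero[OF _ V T, of b E i d] by blast
      then show "c b * koszul_coef E b (koszul_elt \<alpha> T) = 0" by simp
    qed
  qed (use hB in auto)
  also have "\<dots> = (\<Sum>j\<in>T. c (?h j) * koszul_coef E (?h j) (koszul_elt \<alpha> T))"
    by (simp add: sum.reindex[OF inj])
  also have "\<dots> = (\<Sum>j\<in>T. koszul_sign (supp \<alpha>) (T - {j}) j * c (?h j))"
    by (intro sum.cong refl) (simp add: koszul_coef_koszul_elt[OF V g T])
  finally show ?thesis by (simp add: cob_def)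
qed

lemma koszul_block_card:
  assumes "finite (supp \<alpha>)" "A \<in> koszul_block E \<alpha>"
  shows "card (supp \<alpha> - A) = card (supp \<alpha>) - card A" "card A \<le> card (supp \<alpha>)"
  using assms koszul_blockD[OF assms(2)] by (auto simp: card_Diff_subset finite_subset card_mono)

text \<open>The bound on \<open>i\<close> keeps \<open>card (supp \<alpha>) - i\<close> from being
  truncated; a multidegree of smaller support has no basis element in homological degree
  \<open>i\<close>.\<close>

definition admissible :: "nat set \<Rightarrow> nat \<Rightarrow> nat \<Rightarrow> (nat \<Rightarrow> nat) \<Rightarrow> bool" where
  "admissible V i d \<alpha> \<longleftrightarrow> supp \<alpha> \<subseteq> V \<and> sum \<alpha> V = d \<and> i \<le> card (supp \<alpha>)"

lemma koszul_cycle_iff: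
  assumes V: "finite V" and c: "c \<in> koszul_chains K V E i d"
  shows "c \<in> koszul_cycles K V E i d \<longleftrightarrow> (\<forall>\<alpha>. admissible V i d \<alpha> \<longrightarrow>
     cocycle (koszul_block E \<alpha>) (koszul_sign (supp \<alpha>)) (card (supp \<alpha>) - i) (\<lambda>A. c (koszul_elt \<alpha> A)))"
    (is "?L \<longleftrightarrow> ?R")
proof
  assume L: ?L
  show ?R
    unfolding cocycle_def
  proof (intro allI impI ballI)
    fix \<alpha> T assume a: "admissible V i d \<alpha>" and T: "T \<in> koszul_block E \<alpha>" "card T = Suc (card (supp \<alpha>) - i)"
    have fs: "finite (supp \<alpha>)" using a V by (auto simp: admissible_def intro: finite_subset)
    \<comment> \<open>\<open>T\<close> has at most \<open>card (supp \<alpha>)\<close> elements,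
      which rules out \<open>i = 0\<close>, the case in which every chain counts as a cycle.\<close>
    have i: "0 < i" "card (supp \<alpha> - T) = i - 1"
      using koszul_block_card[OF fs T(1)] T(2) a by (auto simp: admissible_def)
    have Ts: "T \<subseteq> supp \<alpha>" using T(1) by (rule koszul_blockD)
    have g: "koszul_elt \<alpha> T \<in> koszul_basis V E (i - 1) d"
      using koszul_elt_in_basis[OF V Ts] a T i by (auto simp: admissible_def)
    have "koszul_diff V E i d c = (\<lambda>g. 0)" using L i(1) by (auto simp: koszul_cycles_def)
    then have "koszul_diff V E i d c (koszul_elt \<alpha> T) = 0" by simp
    then show "cob (koszul_sign (supp \<alpha>)) (\<lambda>A. c (koszul_elt \<alpha> A)) T = 0"
      by (simp add: koszul_diff_koszul_elt[OF V i(1) g Ts])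
  qed
next
  assume R: ?R
  have "koszul_diff V E i d c g = 0" if i: "0 < i" for g
  proof (cases "g \<in> koszul_basis V E (i - 1) d")
    case True
    obtain \<alpha> T where T: "g = koszul_elt \<alpha> T" "T \<in> koszul_block E \<alpha>"
        "supp \<alpha> \<subseteq> V" "sum \<alpha> V = d" "card (supp \<alpha> - T) = i - 1"
      using in_koszul_basisE[OF V True] by metis
    have fs: "finite (supp \<alpha>)" using T(3) V by (rule finite_subset)
    have Ts: "T \<subseteq> supp \<alpha>" using T(2) by (rule koszul_blockD)
    have eq: "koszul_diff V E i d c g = cob (koszul_sign (supp \<alpha>)) (\<lambda>A. c (koszul_elt \<alpha> A)) T"
      using koszul_diff_koszul_elt[OF V i _ Ts] True unfolding T(1) by blast
    show ?thesis
    proof (cases "T = {}")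
      \<comment> \<open>Here \<open>supp \<alpha>\<close> has only \<open>i - 1\<close> elements, so
        \<open>\<alpha>\<close> is not admissible and \<open>?R\<close> says nothing; the coboundary
        at the empty face is an empty sum.\<close>
      case True
      then show ?thesis unfolding eq by (simp add: cob_def)
    next
      case False
      have "card T > 0" using False Ts fs by (simp add: card_gt_0_iff finite_subset)
      then have "admissible V i d \<alpha>" "card T = Suc (card (supp \<alpha>) - i)"
        using koszul_block_card[OF fs T(2)] T i by (auto simp: admissible_def)
      then show ?thesis unfolding eq using R T(2) by (auto simp: cocycle_def)
    qed
  qed (simp add: koszul_diff_def)
  then show ?L using c by (cases "i = 0") (auto simp: koszul_cycles_def)
qed

lemma koszul_boundary_iff:
  fixes K :: "'k::field itself"
  assumes V: "finite V"
  shows "c \<in> koszul_boundaries K V E i d \<longleftrightarrow> c \<in> koszul_chains K V E i d \<and> (\<forall>\<alpha>. admissible V i d \<alpha> \<longrightarrow>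
     coboundary (koszul_block E \<alpha>) (koszul_sign (supp \<alpha>)) (card (supp \<alpha>) - i) (\<lambda>A. c (koszul_elt \<alpha> A)))"
    (is "?L \<longleftrightarrow> ?R")
proof
  assume ?L
  then obtain c' where c': "c = koszul_diff V E (Suc i) d c'" by (auto simp: koszul_boundaries_def)
  show ?R
  proof (intro conjI allI impI)
    show "c \<in> koszul_chains K V E i d" unfolding c' by (auto simp: koszul_chains_def koszul_diff_def)
    fix \<alpha> assume a: "admissible V i d \<alpha>"
    have fs: "finite (supp \<alpha>)" using a V by (auto simp: admissible_def intro: finite_subset)
    have "c (koszul_elt \<alpha> T) = cob (koszul_sign (supp \<alpha>)) (\<lambda>A. c' (koszul_elt \<alpha> A)) T"
      if T: "T \<in> koszul_block E \<alpha>" "card T = card (supp \<alpha>) - i" for T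
    proof -
      have Ts: "T \<subseteq> supp \<alpha>" using T(1) by (rule koszul_blockD)
      have "koszul_elt \<alpha> T \<in> koszul_basis V E (Suc i - 1) d"
        using koszul_elt_in_basis[OF V Ts] a T koszul_block_card[OF fs T(1)] by (auto simp: admissible_def)
      from koszul_diff_koszul_elt[OF V _ this Ts] show ?thesis unfolding c' by simp
    qed
    then show "coboundary (koszul_block E \<alpha>) (koszul_sign (supp \<alpha>)) (card (supp \<alpha>) - i) (\<lambda>A. c (koszul_elt \<alpha> A))"
      unfolding coboundary_def by blast
  qed
next
  assume R: ?R
  then have "\<forall>\<alpha>. \<exists>w. admissible V i d \<alpha> \<longrightarrow> (\<forall>T\<in>koszul_block E \<alpha>. card T = card (supp \<alpha>) - i \<longrightarrow>
      c (koszul_elt \<alpha> T) = cob (koszul_sign (supp \<alpha>)) w T)"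
    unfolding coboundary_def by blast
  then obtain w where w: "\<And>\<alpha> T. admissible V i d \<alpha> \<Longrightarrow> T\<in>koszul_block E \<alpha> \<Longrightarrow> card T = card (supp \<alpha>) - i \<Longrightarrow>
      c (koszul_elt \<alpha> T) = cob (koszul_sign (supp \<alpha>)) (w \<alpha>) T"
    by metis
  \<comment> \<open>Each basis element has one multidegree, so the primitives chosen for the various
    \<open>\<alpha>\<close> glue without conflict.\<close>
  define c' where "c' b = (if b \<in> koszul_basis V E (Suc i) d then w (mdeg b) (supp (mdeg b) - fst b) else 0)" for b
  have "c g = koszul_diff V E (Suc i) d c' g" for g
  proof (cases "g \<in> koszul_basis V E i d")
    case True
    obtain \<alpha> T where T: "g = koszul_elt \<alpha> T" "T \<in> koszul_block E \<alpha>"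
        "supp \<alpha> \<subseteq> V" "sum \<alpha> V = d" "card (supp \<alpha> - T) = i"
      using in_koszul_basisE[OF V True] by metis
    have fs: "finite (supp \<alpha>)" using T(3) V by (rule finite_subset)
    have Ts: "T \<subseteq> supp \<alpha>" using T(2) by (rule koszul_blockD)
    have a: "admissible V i d \<alpha>" "card T = card (supp \<alpha>) - i"
      using koszul_block_card[OF fs T(2)] T by (auto simp: admissible_def)
    have "koszul_diff V E (Suc i) d c' g = cob (koszul_sign (supp \<alpha>)) (\<lambda>A. c' (koszul_elt \<alpha> A)) T"
      using koszul_diff_koszul_elt[OF V _ _ Ts, of "Suc i" E d c'] True unfolding T(1) by simp
    also have "\<dots> = cob (koszul_sign (supp \<alpha>)) (w \<alpha>) T"
    proof (rule cob_cong)
      fix j assume j: "j \<in> T"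
      have Tj: "T - {j} \<subseteq> supp \<alpha>" using Ts by auto
      have "T - {j} \<in> koszul_block E \<alpha>"
        using complex_onD(3)[OF complex_on_koszul_block[OF fs] T(2)] by blast
      moreover have "supp \<alpha> - (T - {j}) = insert j (supp \<alpha> - T)" using j Ts by auto
      then have "card (supp \<alpha> - (T - {j})) = Suc i" using fs j T(5) by simp
      ultimately have "koszul_elt \<alpha> (T - {j}) \<in> koszul_basis V E (Suc i) d"
        using T koszul_elt_in_basis[OF V Tj] by simp
      moreover have "supp \<alpha> - (supp \<alpha> - (T - {j})) = T - {j}" using Tj by auto
      ultimately show "c' (koszul_elt \<alpha> (T - {j})) = w \<alpha> (T - {j})"
        by (simp add: c'_def mdeg_koszul_elt[OF Tj]) (simp add: koszul_elt_def)
    qed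
    also have "\<dots> = c g" using w[OF a(1) T(2) a(2)] T(1) by simp
    finally show ?thesis by simp
  next
    case False
    then have "c g = 0" using R unfolding koszul_chains_def by blast
    then show ?thesis using False by (simp add: koszul_diff_def)
  qed
  moreover have "c' \<in> koszul_chains K V E (Suc i) d" by (auto simp: koszul_chains_def c'_def)
  ultimately show ?L unfolding koszul_boundaries_def by blast
qed


section \<open>Cycles and boundaries as spaces of functions\<close>

interpretation fun_space: vector_space "\<lambda>(a::'k::field) (f::'b \<Rightarrow> 'k) x. a * f x"
  by unfold_locales (auto simp: algebra_simps fun_eq_iff)

lemma sum_fun_apply: "(\<Sum>i\<in>I. f i) x = (\<Sum>i\<in>I. f i x :: 'b::comm_monoid_add)"
  by (induction I rule: infinite_finite_induct) auto

lemma koszul_diff_add: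
  "koszul_diff V E i d (f + g) = koszul_diff V E i d f + (koszul_diff V E i d g :: _ \<Rightarrow> 'k::field)"
  by (auto simp: koszul_diff_def fun_eq_iff algebra_simps sum.distrib)

lemma koszul_diff_scale:
  "koszul_diff V E i d (\<lambda>x. a * f x) = (\<lambda>x. a * (koszul_diff V E i d f x :: 'k::field))"
  by (auto simp: koszul_diff_def fun_eq_iff sum_distrib_left mult_ac)

lemma koszul_diff_zero: "koszul_diff V E i d (0 :: _ \<Rightarrow> 'k::field) g = 0"
  by (simp add: koszul_diff_def)

lemma subspace_koszul_chains: "fun_space.subspace (koszul_chains K V E i d)"
  by (auto simp: fun_space.subspace_def koszul_chains_def)

lemma subspace_koszul_cycles: "fun_space.subspace (koszul_cycles K V E i d)"
  using subspace_koszul_chains[of K V E i d]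
  unfolding fun_space.subspace_def koszul_cycles_def
  by (auto simp: koszul_diff_add koszul_diff_scale koszul_diff_zero fun_eq_iff)

lemma subspace_koszul_boundaries: "fun_space.subspace (koszul_boundaries K V E i d)"
proof -
  have "module_hom (\<lambda>a f x. a * f x) (\<lambda>a f x. a * f x) (koszul_diff V E (Suc i) d :: _ \<Rightarrow> _ \<Rightarrow> 'a)"
    by unfold_locales (auto simp: koszul_diff_add koszul_diff_scale algebra_simps fun_eq_iff)
  then show ?thesis unfolding koszul_boundaries_def
    by (rule module_hom.subspace_image) (rule subspace_koszul_chains)
qed

lemma koszul_boundaries_subset_cycles:
  assumes V: "finite V"
  shows "koszul_boundaries K V E i d \<subseteq> koszul_cycles K V E i d"
proof
  fix c assume c: "c \<in> koszul_boundaries K V E i d"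
  then have ch: "c \<in> koszul_chains K V E i d" using koszul_boundary_iff[OF V] by blast
  show "c \<in> koszul_cycles K V E i d"
    unfolding koszul_cycle_iff[OF V ch]
  proof (intro allI impI)
    fix \<alpha> assume a: "admissible V i d \<alpha>"
    have fs: "finite (supp \<alpha>)" using a V by (auto simp: admissible_def intro: finite_subset)
    show "cocycle (koszul_block E \<alpha>) (koszul_sign (supp \<alpha>)) (card (supp \<alpha>) - i) (\<lambda>A. c (koszul_elt \<alpha> A))"
      using c a koszul_boundary_iff[OF V]
      by (intro coboundary_imp_cocycle[OF complex_on_koszul_block[OF fs] sign_fun_koszul_sign[OF fs]]) blast
  qed
qed

lemma koszul_chains_finite_span:
  fixes K :: "'k::field itself"
  assumes V: "finite V"
  obtains S where "finite S" "koszul_chains K V E i d \<subseteq> fun_space.span S"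
proof
  let ?B = "koszul_basis V E i d" and ?e = "\<lambda>b x. if x = b then 1 else 0 :: 'k"
  show "finite (?e ` ?B)" using finite_koszul_basis[OF V] by simp
  show "koszul_chains K V E i d \<subseteq> fun_space.span (?e ` ?B)"
  proof
    fix c assume c: "c \<in> koszul_chains K V E i d"
    have "c = (\<Sum>b\<in>?B. (\<lambda>x. c b * ?e b x))"
    proof
      fix x
      show "c x = (\<Sum>b\<in>?B. (\<lambda>x. c b * ?e b x)) x"
        using c finite_koszul_basis[OF V, of E i d]
        by (cases x) (auto simp: sum_fun_apply koszul_chains_def if_distrib cong: if_cong)
    qed
    moreover have "(\<Sum>b\<in>?B. (\<lambda>x. c b * ?e b x)) \<in> fun_space.span (?e ` ?B)"
      by (intro fun_space.span_sum fun_space.span_scale fun_space.span_base) auto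
    ultimately show "c \<in> fun_space.span (?e ` ?B)" by simp
  qed
qed

lemma koszul_cycles_subset_chains: "koszul_cycles K V E i d \<subseteq> koszul_chains K V E i d"
  by (auto simp: koszul_cycles_def)

lemma kdim_eq: "kdim K W = fun_space.dim W"
  by (simp add: kdim_def)

text \<open>No basis element has more exterior factors than its total degree. The regularity uses
  this to exclude negative differences.\<close>

lemma betti_degree_less:
  assumes "finite V" "d < i"
  shows "betti K V E i d = 0"
proof -
  have "koszul_basis V E i d = {}" using assms by (auto simp: koszul_basis_def)
  then have "koszul_chains K V E i d \<subseteq> fun_space.span {}" 
    by (auto simp: koszul_chains_def fun_eq_iff)
  then have "koszul_cycles K V E i d \<subseteq> fun_space.span {}"
    using koszul_cycles_subset_chains by blast
  then have "fun_space.dim (koszul_cycles K V E i d) = 0"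
    using fun_space.dim_le_card[of "koszul_cycles K V E i d" "{}"] by simp
  then show ?thesis by (simp add: betti_def kdim_eq)
qed

section \<open>Squarefree multidegrees and Hochster's formula\<close>

lemma supp_indicator: "supp (\<lambda>v. of_bool (v \<in> W)) = W"
  by (auto simp: supp_def)

lemma koszul_block_indicator: "koszul_block E (\<lambda>v. of_bool (v \<in> W)) = ind_complex E W"
proof -
  have "{v. 2 \<le> (of_bool (v \<in> W) :: nat)} = {}" by auto
  then show ?thesis by (auto simp: koszul_block_def supp_indicator ind_complex_def)
qed

lemma squarefree_eq_indicator:
  assumes "\<And>v. \<alpha> v \<le> 1"
  shows "\<alpha> = (\<lambda>v. of_bool (v \<in> supp \<alpha>))"
proof
  fix v show "\<alpha> v = of_bool (v \<in> supp \<alpha>)" using assms[of v] by (auto simp: supp_def)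
qed

text \<open>With exponent at least 2, \<open>v\<close> divides the monomial part for every
  \<open>A\<close>, so it can be added to any face: it is the apex of a cone.\<close>

lemma acyclic_not_squarefree:
  assumes "finite (supp \<alpha>)" "2 \<le> \<alpha> v"
  shows "acyclic_at (koszul_block E \<alpha>) (koszul_sign (supp \<alpha>)) r"
proof (rule acyclic_at_cone[OF complex_on_koszul_block[OF assms(1)] sign_fun_koszul_sign[OF assms(1)]])
  show v: "v \<in> supp \<alpha>" using assms(2) by (auto simp: supp_def)
  fix A assume A: "A \<in> koszul_block E \<alpha>"
  have "insert v A \<union> {v. 2 \<le> \<alpha> v} = A \<union> {v. 2 \<le> \<alpha> v}" using assms(2) by auto
  then show "insert v A \<in> koszul_block E \<alpha>"
    using A v by (simp add: koszul_block_def)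
qed

text \<open>\<open>W - fst b\<close> recovers the face from the basis element: this is
  \<open>z\<close> placed in the multidegree of \<open>W\<close> and zero in every other
  one.\<close>

definition koszul_extend :: "nat set \<Rightarrow> (nat \<Rightarrow> nat \<Rightarrow> bool) \<Rightarrow> nat \<Rightarrow> nat \<Rightarrow> nat set \<Rightarrow> (nat set \<Rightarrow> 'k::field)
     \<Rightarrow> nat set \<times> (nat \<Rightarrow> nat) \<Rightarrow> 'k" where
  "koszul_extend V E i d W z b =
     (if b \<in> koszul_basis V E i d \<and> mdeg b = (\<lambda>v. of_bool (v \<in> W)) then z (W - fst b) else 0)"

lemma koszul_extend_chain: "koszul_extend V E i d W z \<in> koszul_chains K V E i d"
  by (simp add: koszul_chains_def koszul_extend_def)

lemma koszul_extend_elt: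
  assumes V: "finite V" and a: "admissible V i d \<alpha>" and A: "A \<in> koszul_block E \<alpha>" "card A = card (supp \<alpha>) - i"
  shows "koszul_extend V E i d W z (koszul_elt \<alpha> A) = (if \<alpha> = (\<lambda>v. of_bool (v \<in> W)) then z A else 0)"
proof -
  have fs: "finite (supp \<alpha>)" using a V by (auto simp: admissible_def intro: finite_subset)
  have As: "A \<subseteq> supp \<alpha>" using A(1) by (rule koszul_blockD)
  have "card (supp \<alpha> - A) = i" using koszul_block_card[OF fs A(1)] A(2) a by (auto simp: admissible_def)
  then have "koszul_elt \<alpha> A \<in> koszul_basis V E i d"
    using koszul_elt_in_basis[OF V As] A(1) a by (auto simp: admissible_def)
  moreover have "W - (supp \<alpha> - A) = A" if "\<alpha> = (\<lambda>v. of_bool (v \<in> W))"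
    using that As by (auto simp: supp_indicator)
  moreover have "fst (koszul_elt \<alpha> A) = supp \<alpha> - A" by (simp add: koszul_elt_def)
  ultimately show ?thesis
    unfolding koszul_extend_def mdeg_koszul_elt[OF As] by metis
qed

lemma admissible_indicator:
  assumes "finite V" "i \<le> d" "admissible V i d \<alpha>" "\<And>v. \<alpha> v \<le> 1"
  shows "supp \<alpha> \<subseteq> V" "card (supp \<alpha>) = d"
proof -
  show 1: "supp \<alpha> \<subseteq> V" using assms(3) by (simp add: admissible_def)
  have "d = (\<Sum>v\<in>V. \<alpha> v)" using assms(3) by (simp add: admissible_def)
  also have "\<dots> = (\<Sum>v\<in>V. of_bool (v \<in> supp \<alpha>))"
    by (subst squarefree_eq_indicator[OF assms(4)]) (rule refl)
  also have "\<dots> = (\<Sum>v\<in>supp \<alpha>. 1)"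
    using assms(1) 1 by (intro sum.mono_neutral_cong_right) auto
  finally show "card (supp \<alpha>) = d" by simp
qed

lemma indicator_admissible:
  assumes "finite V" "i \<le> d" "W \<subseteq> V" "card W = d"
  shows "admissible V i d (\<lambda>v. of_bool (v \<in> W))"
proof -
  have "(\<Sum>v\<in>V. of_bool (v \<in> W)) = (\<Sum>v\<in>W. 1::nat)"
    using assms(1,3) by (intro sum.mono_neutral_cong_right) auto
  then show ?thesis using assms by (simp add: admissible_def supp_indicator)
qed

lemma koszul_extend_cycle:
  assumes V: "finite V" and i: "i \<le> d" and W: "W \<subseteq> V" "card W = d"
    and z: "cocycle (ind_complex E W) (koszul_sign W) (d - i) z"
  shows "koszul_extend V E i d W z \<in> koszul_cycles K V E i d"
  unfolding koszul_cycle_iff[OF V koszul_extend_chain]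
proof (intro allI impI)
  fix \<alpha> assume a: "admissible V i d \<alpha>"
  have fs: "finite (supp \<alpha>)" using a V by (auto simp: admissible_def intro: finite_subset)
  have "cocycle (koszul_block E \<alpha>) (koszul_sign (supp \<alpha>)) (card (supp \<alpha>) - i)
      (\<lambda>A. if \<alpha> = (\<lambda>v. of_bool (v \<in> W)) then z A else 0)"
  proof (cases "\<alpha> = (\<lambda>v. of_bool (v \<in> W))")
    case True
    then show ?thesis using z W(2) by (simp add: supp_indicator koszul_block_indicator)
  next
    case False
    then show ?thesis by (simp add: cocycle_def cob_def)
  qed
  then show "cocycle (koszul_block E \<alpha>) (koszul_sign (supp \<alpha>)) (card (supp \<alpha>) - i)
      (\<lambda>A. koszul_extend V E i d W z (koszul_elt \<alpha> A))"
    by (subst cocycle_cong[OF complex_on_koszul_block[OF fs] koszul_extend_elt[OF V a]]) auto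
qed

lemma koszul_boundary_restrict:
  assumes V: "finite V" and i: "i \<le> d" and W: "W \<subseteq> V" "card W = d" and c: "c \<in> koszul_boundaries K V E i d"
  shows "coboundary (ind_complex E W) (koszul_sign W) (d - i) (\<lambda>A. c (koszul_elt (\<lambda>v. of_bool (v \<in> W)) A))"
  using c koszul_boundary_iff[OF V, of c K E i d] indicator_admissible[OF V i W] W(2)
  by (auto simp: supp_indicator koszul_block_indicator dest!: spec[of _ "\<lambda>v. of_bool (v \<in> W)"])

lemma koszul_cycle_restrict:
  assumes V: "finite V" and i: "i \<le> d" and W: "W \<subseteq> V" "card W = d" and c: "c \<in> koszul_cycles K V E i d"
  shows "cocycle (ind_complex E W) (koszul_sign W) (d - i) (\<lambda>A. c (koszul_elt (\<lambda>v. of_bool (v \<in> W)) A))"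
proof -
  have "c \<in> koszul_chains K V E i d" using c koszul_cycles_subset_chains by blast
  then have "cocycle (koszul_block E (\<lambda>v. of_bool (v \<in> W))) (koszul_sign (supp (\<lambda>v. of_bool (v \<in> W))))
      (card (supp (\<lambda>v. of_bool (v \<in> W))) - i) (\<lambda>A. c (koszul_elt (\<lambda>v. of_bool (v \<in> W)) A))"
    using c indicator_admissible[OF V i W] koszul_cycle_iff[OF V] by blast
  then show ?thesis using W(2) by (simp add: supp_indicator koszul_block_indicator)
qed

lemma koszul_extend_elt_indicator:
  assumes V: "finite V" and i: "i \<le> d" and W: "W \<subseteq> V" "card W = d"
    and A: "A \<in> ind_complex E W" "card A = d - i"
  shows "koszul_extend V E i d W' z (koszul_elt (\<lambda>v. of_bool (v \<in> W)) A) = (if W = W' then z A else 0)"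
proof -
  have "(\<lambda>v. of_bool (v \<in> W) :: nat) = (\<lambda>v. of_bool (v \<in> W')) \<longleftrightarrow> W = W'"
    by (metis supp_indicator)
  then show ?thesis
    using koszul_extend_elt[OF V indicator_admissible[OF V i W], of A E W' z] A W(2)
    by (simp add: supp_indicator koszul_block_indicator)
qed

text \<open>Being a boundary is tested in each multidegree separately, and there a combination
  restricts to the representatives of a single \<open>W\<close>. So the bases for all
  \<open>W\<close> together form a basis of the cycles modulo the boundaries.\<close>

theorem hochster:
  fixes K :: "'k::field itself" and z :: "nat set \<Rightarrow> 'i \<Rightarrow> nat set \<Rightarrow> 'k"
  assumes V: "finite V" and i: "i \<le> d"
    and I: "\<And>W. W \<subseteq> V \<Longrightarrow> card W = d \<Longrightarrow> finite (I W)"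
    and z: "\<And>W. W \<subseteq> V \<Longrightarrow> card W = d \<Longrightarrow> cohom_basis (ind_complex E W) (koszul_sign W) (d - i) (I W) (z W)"
  shows "betti K V E i d = (\<Sum>W | W \<subseteq> V \<and> card W = d. card (I W))"
proof -
  let ?WW = "{W. W \<subseteq> V \<and> card W = d}"
  let ?J = "Sigma ?WW I"
  let ?B = "koszul_boundaries K V E i d" and ?Z = "koszul_cycles K V E i d"
  let ?z = "\<lambda>(W, k). koszul_extend V E i d W (z W k)"
  have fW: "finite ?WW" using V by simp
  have fJ: "finite ?J" using fW I by blast
  obtain S where S: "finite S" "koszul_chains K V E i d \<subseteq> fun_space.span S"
    by (rule koszul_chains_finite_span[OF V])
  have comb: "(\<Sum>p\<in>?J. (\<lambda>x. a p * ?z p x)) (koszul_elt (\<lambda>v. of_bool (v \<in> W)) A) = (\<Sum>k\<in>I W. a (W, k) * z W k A)"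
    if W: "W \<subseteq> V" "card W = d" and A: "A \<in> ind_complex E W" "card A = d - i" for a W A
  proof -
    let ?e = "koszul_elt (\<lambda>v. of_bool (v \<in> W)) A"
    have "(\<Sum>p\<in>?J. (\<lambda>x. a p * ?z p x)) ?e = (\<Sum>p\<in>?J. a p * ?z p ?e)" by (rule sum_fun_apply)
    also have "\<dots> = (\<Sum>p\<in>?J. if fst p = W then a p * z W (snd p) A else 0)"
    proof (intro sum.cong refl)
      fix p
      show "a p * ?z p ?e = (if fst p = W then a p * z W (snd p) A else 0)"
        by (cases p) (simp add: koszul_extend_elt_indicator[OF V i W A])
    qed
    also have "\<dots> = (\<Sum>p\<in>{p \<in> ?J. fst p = W}. a p * z W (snd p) A)"
      by (rule sum.inter_filter[OF fJ, symmetric])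
    also have "{p \<in> ?J. fst p = W} = Pair W ` I W"
    proof (rule set_eqI)
      fix p
      show "p \<in> {p \<in> ?J. fst p = W} \<longleftrightarrow> p \<in> Pair W ` I W"
        using W by (cases p) (simp only: mem_Collect_eq mem_Sigma_iff fst_conv image_iff, blast)
    qed
    also have "(\<Sum>p\<in>Pair W ` I W. a p * z W (snd p) A) = (\<Sum>k\<in>I W. a (W, k) * z W k A)"
      by (subst sum.reindex) (auto simp: inj_on_def)
    finally show ?thesis .
  qed
  have comb0: "(\<Sum>p\<in>?J. (\<lambda>x. a p * ?z p x)) (koszul_elt \<alpha> A) = 0"
    if "admissible V i d \<alpha>" "A \<in> koszul_block E \<alpha>" "card A = card (supp \<alpha>) - i" "2 \<le> \<alpha> v" for a \<alpha> A v
  proof -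
    have "\<alpha> \<noteq> (\<lambda>v. of_bool (v \<in> W))" for W
    proof
      assume "\<alpha> = (\<lambda>v. of_bool (v \<in> W))"
      then have "\<alpha> v \<le> 1" by simp
      then show False using that(4) by simp
    qed
    then show ?thesis
      unfolding sum_fun_apply
      by (intro sum.neutral ballI) (simp add: split_def koszul_extend_elt[OF V that(1-3)])
  qed
  have "fun_space.dim ?Z = fun_space.dim ?B + card ?J"
  proof (rule fun_space.dim_eq_plus_card_quotient_basis[OF subspace_koszul_boundaries S(1) _
        subspace_koszul_cycles koszul_boundaries_subset_cycles[OF V] fJ, where z = ?z])
    show "?B \<subseteq> fun_space.span S"
      using koszul_boundaries_subset_cycles[OF V] koszul_cycles_subset_chains S(2) by blast
    fix p assume p: "p \<in> ?J"
    then obtain W k where Wk: "p = (W, k)" "W \<subseteq> V" "card W = d" "k \<in> I W" by auto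
    have "cocycle (ind_complex E W) (koszul_sign W) (d - i) (z W k)"
      using z[OF Wk(2,3)] Wk(4) by (auto simp only: cohom_basis_def)
    from koszul_extend_cycle[OF V i Wk(2,3) this] show "?z p \<in> ?Z" unfolding Wk(1) prod.case .
  next
    fix a assume a: "(\<Sum>p\<in>?J. (\<lambda>x. a p * ?z p x)) \<in> ?B"
    show "\<forall>p\<in>?J. a p = 0"
    proof
      fix p assume p: "p \<in> ?J"
      then obtain W k where Wk: "p = (W, k)" "W \<subseteq> V" "card W = d" "k \<in> I W" by auto
      have "coboundary (ind_complex E W) (koszul_sign W) (d - i)
          (\<lambda>A. (\<Sum>p\<in>?J. (\<lambda>x. a p * ?z p x)) (koszul_elt (\<lambda>v. of_bool (v \<in> W)) A))"
        by (rule koszul_boundary_restrict[OF V i Wk(2,3) a])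
      moreover have "coboundary (ind_complex E W) (koszul_sign W) (d - i)
          (\<lambda>A. (\<Sum>p\<in>?J. (\<lambda>x. a p * ?z p x)) (koszul_elt (\<lambda>v. of_bool (v \<in> W)) A))
        \<longleftrightarrow> coboundary (ind_complex E W) (koszul_sign W) (d - i) (\<lambda>A. \<Sum>k\<in>I W. a (W, k) * z W k A)"
        by (rule coboundary_cong) (rule comb[OF Wk(2,3)])
      ultimately have cb: "coboundary (ind_complex E W) (koszul_sign W) (d - i) (\<lambda>A. \<Sum>k\<in>I W. a (W, k) * z W k A)"
        by blast
      have "a (W, k) = 0"
        by (rule cohom_basis_independent[OF z[OF Wk(2,3)] cb Wk(4)])
      then show "a p = 0" unfolding Wk(1) .
    qed
  next
    fix y assume y: "y \<in> ?Z"
    have "\<forall>W. \<exists>a. W \<subseteq> V \<and> card W = d \<longrightarrow> coboundary (ind_complex E W) (koszul_sign W) (d - i)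
        (\<lambda>A. y (koszul_elt (\<lambda>v. of_bool (v \<in> W)) A) - (\<Sum>k\<in>I W. a k * z W k A))"
    proof
      fix W
      show "\<exists>a. W \<subseteq> V \<and> card W = d \<longrightarrow> coboundary (ind_complex E W) (koszul_sign W) (d - i)
        (\<lambda>A. y (koszul_elt (\<lambda>v. of_bool (v \<in> W)) A) - (\<Sum>k\<in>I W. a k * z W k A))"
      proof (cases "W \<subseteq> V \<and> card W = d")
        case True
        then show ?thesis
          using z[of W] koszul_cycle_restrict[OF V i _ _ y, of W] unfolding cohom_basis_def by blast
      qed blast
    qed
    from choice[OF this] obtain a where a0: "\<forall>W. W \<subseteq> V \<and> card W = d \<longrightarrow> coboundary (ind_complex E W) (koszul_sign W) (d - i)
        (\<lambda>A. y (koszul_elt (\<lambda>v. of_bool (v \<in> W)) A) - (\<Sum>k\<in>I W. a W k * z W k A))" ..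
    have a: "coboundary (ind_complex E W) (koszul_sign W) (d - i)
        (\<lambda>A. y (koszul_elt (\<lambda>v. of_bool (v \<in> W)) A) - (\<Sum>k\<in>I W. a W k * z W k A))"
      if "W \<subseteq> V" "card W = d" for W
      using a0[rule_format, of W] that by blast
    let ?a = "\<lambda>p. a (fst p) (snd p)"
    let ?s = "(\<Sum>p\<in>?J. (\<lambda>x. ?a p * ?z p x))"
    have sZ: "?s \<in> koszul_chains K V E i d"
    proof (rule fun_space.subspace_sum[OF subspace_koszul_chains])
      fix p show "(\<lambda>x. ?a p * ?z p x) \<in> koszul_chains K V E i d"
        by (cases p) (auto intro!: fun_space.subspace_scale[OF subspace_koszul_chains] koszul_extend_chain)
    qed
    have "y - ?s \<in> ?B"
      unfolding koszul_boundary_iff[OF V]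
    proof (intro conjI allI impI)
      show "y - ?s \<in> koszul_chains K V E i d"
        using y koszul_cycles_subset_chains[of K V E i d]
        by (intro fun_space.subspace_diff[OF subspace_koszul_chains] sZ) blast
      fix \<alpha> assume al: "admissible V i d \<alpha>"
      have fs: "finite (supp \<alpha>)" using al V by (auto simp: admissible_def intro: finite_subset)
      show "coboundary (koszul_block E \<alpha>) (koszul_sign (supp \<alpha>)) (card (supp \<alpha>) - i) (\<lambda>A. (y - ?s) (koszul_elt \<alpha> A))"
      proof (cases "\<forall>v. \<alpha> v \<le> 1")
        case True
        define W where "W = supp \<alpha>"
        have W: "W \<subseteq> V" "card W = d" unfolding W_def using admissible_indicator[OF V i al] True by auto
        have aW: "\<alpha> = (\<lambda>v. of_bool (v \<in> W))" unfolding W_def using squarefree_eq_indicator True by blast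
        have "coboundary (ind_complex E W) (koszul_sign W) (d - i) (\<lambda>A. (y - ?s) (koszul_elt \<alpha> A))
            \<longleftrightarrow> coboundary (ind_complex E W) (koszul_sign W) (d - i)
              (\<lambda>A. y (koszul_elt (\<lambda>v. of_bool (v \<in> W)) A) - (\<Sum>k\<in>I W. a W k * z W k A))"
        proof (rule coboundary_cong)
          fix A assume A: "A \<in> ind_complex E W" "card A = d - i"
          show "(y - ?s) (koszul_elt \<alpha> A) = y (koszul_elt (\<lambda>v. of_bool (v \<in> W)) A) - (\<Sum>k\<in>I W. a W k * z W k A)"
            unfolding aW fun_diff_def using comb[OF W A, of ?a] by simp
        qed
        then show ?thesis using a[OF W] W(2) unfolding aW by (simp add: supp_indicator koszul_block_indicator)
      next
        \<comment> \<open>All representatives vanish in this multidegree and its block is acyclic,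
          so \<open>y\<close> alone is a coboundary on it.\<close>
        case False
        then obtain v where v: "2 \<le> \<alpha> v" by (auto simp: not_le Suc_le_eq numeral_2_eq_2)
        have "y \<in> koszul_chains K V E i d" using y koszul_cycles_subset_chains by blast
        then have "cocycle (koszul_block E \<alpha>) (koszul_sign (supp \<alpha>)) (card (supp \<alpha>) - i) (\<lambda>A. y (koszul_elt \<alpha> A))"
          using y al koszul_cycle_iff[OF V] by blast
        then have "coboundary (koszul_block E \<alpha>) (koszul_sign (supp \<alpha>)) (card (supp \<alpha>) - i) (\<lambda>A. y (koszul_elt \<alpha> A))"
          using acyclic_not_squarefree[OF fs v] by (auto simp: acyclic_at_def)
        moreover have "coboundary (koszul_block E \<alpha>) (koszul_sign (supp \<alpha>)) (card (supp \<alpha>) - i) (\<lambda>A. (y - ?s) (koszul_elt \<alpha> A))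
           \<longleftrightarrow> coboundary (koszul_block E \<alpha>) (koszul_sign (supp \<alpha>)) (card (supp \<alpha>) - i) (\<lambda>A. y (koszul_elt \<alpha> A))"
        proof (rule coboundary_cong)
          fix A assume A: "A \<in> koszul_block E \<alpha>" "card A = card (supp \<alpha>) - i"
          show "(y - ?s) (koszul_elt \<alpha> A) = y (koszul_elt \<alpha> A)"
            unfolding fun_diff_def using comb0[OF al A v, of ?a] by simp
        qed
        ultimately show ?thesis by blast
      qed
    qed
    then show "\<exists>a. y - (\<Sum>p\<in>?J. (\<lambda>x. a p * ?z p x)) \<in> ?B"
      by (rule exI[of _ ?a])
  qed
  moreover have "card ?J = (\<Sum>W\<in>?WW. card (I W))"
    using fW I by (intro card_SigmaI) auto
  ultimately show ?thesis by (simp add: betti_def kdim_eq)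
qed

text \<open>One cocycle that does not bound makes the inclusion of the boundaries in the cycles
  strict. This serves the top degree \<open>(m + 1) div 3\<close>, for which no family of bases over
  all \<open>W\<close> is built.\<close>

lemma betti_nonzero:
  fixes K :: "'k::field itself"
  assumes V: "finite V" and i: "i \<le> d" and W: "W \<subseteq> V" "card W = d"
    and n: "\<not> acyclic_at (ind_complex E W) (koszul_sign W :: _ \<Rightarrow> _ \<Rightarrow> 'k) (d - i)"
  shows "betti K V E i d \<noteq> 0"
proof -
  let ?B = "koszul_boundaries K V E i d" and ?Z = "koszul_cycles K V E i d"
  obtain y :: "nat set \<Rightarrow> 'k" where y: "cocycle (ind_complex E W) (koszul_sign W) (d - i) y"
      "\<not> coboundary (ind_complex E W) (koszul_sign W) (d - i) y"
    using n unfolding acyclic_at_def by blast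
  let ?y = "koszul_extend V E i d W y"
  have "?y \<in> ?Z" by (rule koszul_extend_cycle[OF V i W y(1)])
  moreover have "?y \<notin> ?B"
  proof
    assume "?y \<in> ?B"
    from koszul_boundary_restrict[OF V i W this] y(2) 
      coboundary_cong[of "ind_complex E W" "d - i" "\<lambda>A. ?y (koszul_elt (\<lambda>v. of_bool (v \<in> W)) A)" y "koszul_sign W"]
    show False by (simp add: koszul_extend_elt_indicator[OF V i W])
  qed
  ultimately have "?B \<subset> ?Z" using koszul_boundaries_subset_cycles[OF V, of K E i d] by blast
  moreover obtain S where "finite S" "koszul_chains K V E i d \<subseteq> fun_space.span S"
    by (rule koszul_chains_finite_span[OF V])
  ultimately have "fun_space.dim ?B < fun_space.dim ?Z"
    using koszul_cycles_subset_chains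
    by (intro fun_space.dim_strict_mono[OF subspace_koszul_boundaries]) blast+
  then show ?thesis by (simp add: betti_def kdim_eq)
qed

subsection \<open>Paths\<close>

lemma link_ind_complex:
  assumes "b \<in> W" "\<And>u v. E u v \<Longrightarrow> E v u"
  shows "link (ind_complex E W) b = ind_complex E {u \<in> W. u \<noteq> b \<and> \<not> E u b}"
  using assms unfolding link_def ind_complex_def by auto

lemma del_ind_complex: "del (ind_complex E W) b = ind_complex E (W - {b})"
  unfolding del_def ind_complex_def by auto

lemma acyclic_at_isolated:
  assumes "finite W" "sign_fun W s" "a \<in> W" "\<And>u. u \<in> W \<Longrightarrow> u \<noteq> a \<Longrightarrow> \<not> E u a \<and> \<not> E a u"
  shows "acyclic_at (ind_complex E W) s r"
proof (rule acyclic_at_cone[OF complex_on_ind_complex[OF assms(1)] assms(2,3)])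
  fix A assume "A \<in> ind_complex E W"
  then show "insert a A \<in> ind_complex E W"
    using assms(3,4) unfolding ind_complex_def by blast
qed

lemma acyclic_at_0_ind_complex:
  assumes "finite W" "sign_fun W s" "a \<in> W"
  shows "acyclic_at (ind_complex E W) s 0"
  using assms by (intro acyclic_at_0[OF assms(2,3)] complex_on_ind_complex) (auto simp: ind_complex_def)

text \<open>Deleting b isolates a, so only the link of b contributes.\<close>

lemma cohom_dim_leaf:
  fixes s :: "'a set \<Rightarrow> 'a \<Rightarrow> 'k::field"
  assumes W: "finite W" and s: "sign_fun W s" and sym: "\<And>u v. E u v \<Longrightarrow> E v u"
    and ab: "a \<in> W" "b \<in> W" "a \<noteq> b" and leaf: "\<And>u. u \<in> W \<Longrightarrow> u \<noteq> a \<Longrightarrow> u \<noteq> b \<Longrightarrow> \<not> E u a"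
    and n: "cohom_dim (ind_complex E {u \<in> W. u \<noteq> b \<and> \<not> E u b}) (\<lambda>A. s (insert b A)) r n"
  shows "cohom_dim (ind_complex E W) s (Suc r) n"
proof (rule cohom_dim_link[OF complex_on_ind_complex[OF W] s])
  fix r
  show "acyclic_at (del (ind_complex E W) b) s r"
    unfolding del_ind_complex
    by (rule acyclic_at_isolated[of _ _ a]) (use assms sign_fun_subset[OF s] in auto)
qed (use n link_ind_complex[OF ab(2) sym] in simp)

definition path_edge :: "nat \<Rightarrow> nat \<Rightarrow> bool" where
  "path_edge a b \<longleftrightarrow> Suc a = b \<or> Suc b = a"

text \<open>The unique degree in which the part of U below n has cohomology, None if there is no such
  degree. In the last equation n + 1 is a leaf with neighbour n; the truncated n - 1 drops the
  other neighbour of n, if there is one.\<close>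

fun path_type :: "nat \<Rightarrow> nat set \<Rightarrow> nat option" where
  "path_type 0 U = Some 0"
| "path_type (Suc 0) U = (if 0 \<in> U then None else Some 0)"
| "path_type (Suc (Suc n)) U = (if Suc n \<notin> U then path_type (Suc n) U
     else if n \<notin> U then None else map_option Suc (path_type (n - 1) U))"

text \<open>The empty face is the only face and carries a class in degree 0; this is where the
  recursion along a path ends, and what \<open>Some 0\<close> stands for.\<close>

lemma cohom_dim_ind_complex_empty:
  "cohom_dim (ind_complex E {}) s r (if r = 0 then 1 else 0)"
proof (cases "r = 0")
  case True
  have i: "ind_complex E {} = {{}}" by (auto simp: ind_complex_def)
  have "cohom_basis {{}} s 0 {..<1} (\<lambda>_::nat. \<lambda>_. 1)"
    unfolding cohom_basis_def
  proof (intro conjI allI impI ballI)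
    fix y assume "cocycle {{}} s 0 y"
    show "\<exists>c. coboundary {{}} s 0 (\<lambda>A. y A - (\<Sum>i<1::nat. c i * 1))"
      by (rule exI[of _ "\<lambda>_. y {}"]) (simp add: coboundary_def cob_def)
  qed (auto simp: cocycle_def coboundary_def cob_def)
  then show ?thesis using True i by (auto simp: cohom_dim_def)
next
  case False
  then show ?thesis
    by (auto simp: cohom_dim_0 acyclic_at_def coboundary_def ind_complex_def)
qed

lemma cohom_dim_path:
  fixes s :: "nat set \<Rightarrow> nat \<Rightarrow> 'k::field"
  assumes "sign_fun (U \<inter> {..<n}) s"
  shows "cohom_dim (ind_complex path_edge (U \<inter> {..<n})) s r (if path_type n U = Some r then 1 else 0)"
  using assms
proof (induction n U arbitrary: s r rule: path_type.induct)
  case (1 U)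
  have "U \<inter> {..<0} = {}" by auto
  then show ?case using cohom_dim_ind_complex_empty[of path_edge s r] by (cases "r = 0") simp_all
next
  case (2 U)
  show ?case
  proof (cases "0 \<in> U")
    case True
    have "acyclic_at (ind_complex path_edge (U \<inter> {..<Suc 0})) s r"
      by (rule acyclic_at_isolated[OF _ 2, of 0]) (use True in auto)
    then show ?thesis using True by (simp add: cohom_dim_0)
  next
    case False
    then have "U \<inter> {..<Suc 0} = {}" by auto
    then show ?thesis using cohom_dim_ind_complex_empty[of path_edge s r] False by (cases "r = 0") simp_all
  qed
next
  case (3 n U)
  let ?W = "U \<inter> {..<Suc (Suc n)}"
  consider "Suc n \<notin> U" | "Suc n \<in> U" "n \<notin> U" | "Suc n \<in> U" "n \<in> U" by blast
  then show ?case
  proof cases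
    case 1
    then have "?W = U \<inter> {..<Suc n}" by (auto simp: less_Suc_eq)
    then show ?thesis using 3(1)[OF 1, of s r] 3(3) 1 by simp
  next
    case 2
    have "acyclic_at (ind_complex path_edge ?W) s r"
      by (rule acyclic_at_isolated[OF _ 3(3), of "Suc n"]) (use 2 in \<open>auto simp: path_edge_def\<close>)
    then show ?thesis using 2 by (simp add: cohom_dim_0)
  next
    case 3
    show ?thesis
    proof (cases r)
      \<comment> \<open>The leaf argument only reaches degrees that are successors; degree 0 is
        killed by any vertex, here \<open>n\<close>.\<close>
      case 0
      have "acyclic_at (ind_complex path_edge ?W) s 0"
        by (rule acyclic_at_0_ind_complex[OF _ "3.prems", of n]) (use 3 in auto)
      then show ?thesis using 3 0 by (simp add: cohom_dim_0)
    next
      case (Suc q)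
      \<comment> \<open>The lower neighbour of \<open>n\<close> drops out whether or not it belongs
        to \<open>U\<close>; this freedom becomes a binomial factor in the count.\<close>
      have e: "{u \<in> ?W. u \<noteq> n \<and> \<not> path_edge u n} = U \<inter> {..<n - 1}"
        by (auto simp: path_edge_def)
      have sg: "sign_fun (U \<inter> {..<n - 1}) (\<lambda>A. s (insert n A))"
        by (rule sign_fun_link[OF "3.prems"]) (use 3 in auto)
      have "cohom_dim (ind_complex path_edge ?W) s (Suc q) (if path_type (n - 1) U = Some q then 1 else 0)"
      proof (rule cohom_dim_leaf[OF _ "3.prems", where a = "Suc n" and b = n])
        show "cohom_dim (ind_complex path_edge {u \<in> ?W. u \<noteq> n \<and> \<not> path_edge u n}) (\<lambda>A. s (insert n A)) q
            (if path_type (n - 1) U = Some q then 1 else 0)"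
          unfolding e by (rule "3.IH"(2)) (use 3 sg in auto)
      qed (use 3 in \<open>auto simp: path_edge_def\<close>)
      then show ?thesis using 3 Suc by simp
    qed
  qed
qed

lemma path_type_cong: "U \<inter> {..<n} = U' \<inter> {..<n} \<Longrightarrow> path_type n U = path_type n U'"
proof (induction n U rule: path_type.induct)
  case (2 U) then show ?case by (auto simp: set_eq_iff)
next
  case (3 n U)
  have a: "k \<in> U \<longleftrightarrow> k \<in> U'" if "k < Suc (Suc n)" for k using 3(3) that by (auto simp: set_eq_iff)
  have "U \<inter> {..<Suc n} = U' \<inter> {..<Suc n}" "U \<inter> {..<n - 1} = U' \<inter> {..<n - 1}" using a by auto
  then show ?case using 3(1,2) a[of n] a[of "Suc n"] by auto
qed simp

text \<open>Three vertices disappear per step, so the residue of \<open>n\<close> decides how the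
  recursion ends. This is the known fact that the independence complex of a path is contractible or
  a sphere, of dimension \<open>(n + 1) div 3 - 1\<close>.\<close>

lemma path_type_full: "{..<n} \<subseteq> U \<Longrightarrow> path_type n U = (if n mod 3 = 1 then None else Some ((n + 1) div 3))"
proof (induction n U rule: path_type.induct)
  case (3 n U)
  show ?case
  proof (cases n)
    case 0 then show ?thesis using 3 by auto
  next
    case (Suc k)
    have "{..<n - 1} \<subseteq> U" using 3(3) by auto
    then have "path_type (n - 1) U = (if (n - 1) mod 3 = 1 then None else Some ((n - 1 + 1) div 3))"
      using 3 by (intro 3(2)) auto
    moreover have "Suc n \<in> U" "n \<in> U" using 3(3) by auto
    ultimately show ?thesis using Suc by (auto simp: mod_Suc)
  qed
qed auto

text \<open>Each unit of the type uses up three positions, except that the one at the bottom of the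
  path may use two.\<close>

lemma path_type_bound: "path_type n U = Some r \<Longrightarrow> 3 * r \<le> n + 1"
proof (induction n U arbitrary: r rule: path_type.induct)
  case (3 n U)
  show ?case
  proof (cases "Suc n \<in> U \<and> n \<in> U")
    case True
    then obtain q where "path_type (n - 1) U = Some q" "r = Suc q" using 3 by (auto split: if_splits)
    then show ?thesis using 3(2)[of q] True by (cases n) auto
  next
    case False
    then show ?thesis using 3 by (auto split: if_splits)
  qed
qed (auto split: if_splits)

section \<open>Counting the subsets of a path by type and size\<close>

definition path_count :: "nat \<Rightarrow> nat \<Rightarrow> nat \<Rightarrow> nat" where
  "path_count n r k = card {U. U \<subseteq> {..<n} \<and> path_type n U = Some r \<and> card U = k}"

lemma path_count_0: "path_count 0 r k = of_bool (r = 0 \<and> k = 0)"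
proof -
  have "{U. U \<subseteq> {..<0} \<and> path_type 0 U = Some r \<and> card U = k} = (if r = 0 \<and> k = 0 then {{}} else {})"
    by auto
  then show ?thesis by (simp add: path_count_def)
qed

lemma path_count_1: "path_count (Suc 0) r k = of_bool (r = 0 \<and> k = 0)"
proof -
  have "{U. U \<subseteq> {..<Suc 0} \<and> path_type (Suc 0) U = Some r \<and> card U = k} = (if r = 0 \<and> k = 0 then {{}} else {})"
    by (auto simp: lessThan_Suc subset_singleton_iff)
  then show ?thesis by (simp add: path_count_def)
qed

lemma card_subsets_split:
  assumes "finite A" "x \<notin> A"
  shows "card {U. U \<subseteq> insert x A \<and> P U} = card {U. U \<subseteq> A \<and> P U} + card {U. U \<subseteq> A \<and> P (insert x U)}"
proof -
  have "{U. U \<subseteq> insert x A \<and> P U} = {U. U \<subseteq> A \<and> P U} \<union> insert x ` {U. U \<subseteq> A \<and> P (insert x U)}"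
  proof (rule set_eqI)
    fix U
    show "U \<in> {U. U \<subseteq> insert x A \<and> P U} \<longleftrightarrow> U \<in> {U. U \<subseteq> A \<and> P U} \<union> insert x ` {U. U \<subseteq> A \<and> P (insert x U)}"
    proof (cases "x \<in> U")
      case True
      then have "insert x (U - {x}) = U" by auto
      then show ?thesis using True assms(2)
        by (auto simp: image_iff subset_insert_iff intro!: exI[of _ "U - {x}"])
    next
      case False
      then show ?thesis by (auto simp: subset_insert)
    qed
  qed
  moreover have "inj_on (insert x) {U. U \<subseteq> A \<and> P (insert x U)}"
    using assms(2) by (intro inj_onI) (metis (no_types, lifting) insert_ident mem_Collect_eq subsetD)
  moreover have "{U. U \<subseteq> A \<and> P U} \<inter> insert x ` {U. U \<subseteq> A \<and> P (insert x U)} = {}"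
    using assms(2) by auto
  ultimately show ?thesis using assms(1) by (simp add: card_Un_disjoint card_image)
qed

lemma path_type_insert_ge: "n \<le> x \<Longrightarrow> path_type n (insert x U) = path_type n U"
  by (rule path_type_cong) auto

lemma path_type_eq_Suc_iff: "map_option Suc z = Some r \<longleftrightarrow> 0 < r \<and> z = Some (r - 1)"
  by (cases z) auto

text \<open>Either the top position is absent, or the two top positions are present and the third is
  free because the type ignores it; the free position accounts for the sizes \<open>k - 2\<close>
  and \<open>k - 3\<close>.\<close>

lemma path_count_rec:
  "path_count (n + 3) r k = path_count (n + 2) r k
     + (if 0 < r then (if 2 \<le> k then path_count n (r - 1) (k - 2) else 0) + (if 3 \<le> k then path_count n (r - 1) (k - 3) else 0) else 0)"
proof -
  have sets: "{..<n + 3} = insert (n + 2) {..<n + 2}" "{..<n + 2} = insert (n + 1) {..<n + 1}" "{..<n + 1} = insert n {..<n}"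
    by auto
  have t3: "path_type (n + 3) U = (if n + 2 \<notin> U then path_type (n + 2) U
     else if n + 1 \<notin> U then None else map_option Suc (path_type n U))" for U
    by (simp add: numeral_3_eq_3 numeral_2_eq_2)
  let ?P = "\<lambda>U. path_type (n + 3) U = Some r \<and> card U = k"
  have ni: "x \<notin> U" if "U \<subseteq> {..<m}" "m \<le> x" for x m :: nat and U using that by auto
  have fin: "finite U" if "U \<subseteq> {..<m}" for U and m :: nat using that finite_subset by blast
  have p3: "path_type (n + 3) (insert (n + 2) (insert (n + 1) U)) = map_option Suc (path_type n U)" for U
    by (simp add: t3 path_type_insert_ge)
  have p4: "path_type (n + 3) (insert (n + 2) (insert (n + 1) (insert n U))) = map_option Suc (path_type n U)" for U
    unfolding p3 by (simp add: path_type_insert_ge)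
  have c2: "card (insert (n + 2) (insert (n + 1) U)) = card U + 2" if "U \<subseteq> {..<n}" for U
    using fin[OF that] ni[OF that] by simp
  have c3: "card (insert (n + 2) (insert (n + 1) (insert n U))) = card U + 3" if "U \<subseteq> {..<n}" for U
    using fin[OF that] ni[OF that] by simp
  have "path_count (n + 3) r k = card {U. U \<subseteq> {..<n + 2} \<and> ?P U} + card {U. U \<subseteq> {..<n + 2} \<and> ?P (insert (n + 2) U)}"
    unfolding path_count_def sets(1) by (rule card_subsets_split) auto
  also have "{U. U \<subseteq> {..<n + 2} \<and> ?P U} = {U. U \<subseteq> {..<n + 2} \<and> path_type (n + 2) U = Some r \<and> card U = k}"
    by (intro Collect_cong conj_cong refl) (auto simp: t3 ni)
  also have "card \<dots> = path_count (n + 2) r k" by (simp add: path_count_def)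
  also have "card {U. U \<subseteq> {..<n + 2} \<and> ?P (insert (n + 2) U)}
      = card {U. U \<subseteq> {..<n + 1} \<and> ?P (insert (n + 2) U)} + card {U. U \<subseteq> {..<n + 1} \<and> ?P (insert (n + 2) (insert (n + 1) U))}"
    unfolding sets(2) by (rule card_subsets_split) auto
  also have "{U. U \<subseteq> {..<n + 1} \<and> ?P (insert (n + 2) U)} = {}"
    by (auto simp: t3 ni)
  also have "card {U. U \<subseteq> {..<n + 1} \<and> ?P (insert (n + 2) (insert (n + 1) U))}
      = card {U. U \<subseteq> {..<n} \<and> ?P (insert (n + 2) (insert (n + 1) U))} + card {U. U \<subseteq> {..<n} \<and> ?P (insert (n + 2) (insert (n + 1) (insert n U)))}"
    unfolding sets(3) by (rule card_subsets_split) auto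
  also have "{U. U \<subseteq> {..<n} \<and> ?P (insert (n + 2) (insert (n + 1) U))}
      = {U. U \<subseteq> {..<n} \<and> 0 < r \<and> path_type n U = Some (r - 1) \<and> 2 \<le> k \<and> card U = k - 2}"
    unfolding p3 path_type_eq_Suc_iff by (rule Collect_cong, rule conj_cong[OF refl], simp only: c2) auto
  also have "{U. U \<subseteq> {..<n} \<and> ?P (insert (n + 2) (insert (n + 1) (insert n U)))}
      = {U. U \<subseteq> {..<n} \<and> 0 < r \<and> path_type n U = Some (r - 1) \<and> 3 \<le> k \<and> card U = k - 3}"
    unfolding p4 path_type_eq_Suc_iff by (rule Collect_cong, rule conj_cong[OF refl], simp only: c3) auto
  finally show ?thesis by (simp add: path_count_def)
qed

lemma path_count_2: "path_count 2 r k = of_bool (r = 0 \<and> k = 0) + of_bool (r = 1 \<and> k = 2)"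
proof -
  have s: "{..<2::nat} = insert 1 {0}" by auto
  have e: "card {U. U \<subseteq> {} \<and> P U} = of_bool (P {})" for P :: "nat set \<Rightarrow> bool"
  proof -
    have "{U. U \<subseteq> {} \<and> P U} = (if P {} then {{}} else {})" by auto
    then show ?thesis by simp
  qed
  have c: "card {U. U \<subseteq> {..<2} \<and> P U} = of_bool (P {}) + of_bool (P {0}) + (of_bool (P {1}) + of_bool (P {1, 0}))"
    for P :: "nat set \<Rightarrow> bool"
    using card_subsets_split[of "{0}" 1 P] card_subsets_split[of "{}" 0 P]
      card_subsets_split[of "{}" 0 "\<lambda>U. P (insert 1 U)"]
    unfolding s e by simp
  have t: "path_type 2 U = (if 1 \<notin> U then path_type (Suc 0) U
     else if 0 \<notin> U then None else Some 1)" for U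
    by (simp add: numeral_2_eq_2)
  show ?thesis unfolding path_count_def c by (auto simp: t)
qed

text \<open>A set of type \<open>r\<close> consists of \<open>r\<close> disjoint blocks of three
  consecutive positions, with the two upper ones in the set and the lowest one free, and nothing
  outside the blocks; a block at the bottom of the path may lack its free position. The first
  summand counts the sets without such a short block, choosing the places of the blocks and the free
  positions used; the second counts the sets with one. The guards keep truncated subtraction from
  producing spurious terms.\<close>

lemma path_count_closed:
  "path_count n r k = (if 3 * r \<le> n + 1 \<and> 2 * r \<le> k then
      ((n - 2 * r) choose r) * (r choose (k - 2 * r)) + 
        (if r = 0 then 0 else ((n - 2 * r) choose (r - 1)) * ((r - 1) choose (k - 2 * r))) else 0)"
proof (induction n arbitrary: r k rule: less_induct)
  case (less n)
  consider "n = 0" | "n = 1" | "n = 2" | n' where "n = n' + 3"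
    by (metis One_nat_def Suc_1 add.commute add_2_eq_Suc add_Suc_right less_2_cases_iff numeral_3_eq_3 le_Suc_ex not_less_eq not_le less_SucE)
  then show ?case
  proof cases
    case 1 then show ?thesis by (cases r) (auto simp: path_count_0)
  next
    case 2 then show ?thesis by (cases r) (auto simp: path_count_1)
  next
    case 3 
    have "r = 0 \<or> r = 1 \<or> 2 \<le> r" by linarith
    then show ?thesis using 3 by (auto simp: path_count_2)
  next
    case (4 n')
    show ?thesis
    proof (cases r)
      case 0
      then show ?thesis using less[of "n' + 2" 0 k] 4 path_count_rec[of n' 0 k] by simp
    next
      case (Suc q)
      have IH1: "path_count (n' + 2) r k = (if 3 * q \<le> n' \<and> 2 * q + 2 \<le> k then
         ((n' - 2 * q) choose Suc q) * (Suc q choose (k - 2 * q - 2)) + ((n' - 2 * q) choose q) * (q choose (k - 2 * q - 2)) else 0)"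
        using less[of "n' + 2" r k] 4 Suc by auto
      have IH2: "path_count n' q j = (if 3 * q \<le> n' + 1 \<and> 2 * q \<le> j then
         ((n' - 2 * q) choose q) * (q choose (j - 2 * q)) + 
           (if q = 0 then 0 else ((n' - 2 * q) choose (q - 1)) * ((q - 1) choose (j - 2 * q))) else 0)" for j
        using less[of n' q j] 4 by simp
      show ?thesis
      proof (cases "2 * q + 2 \<le> k \<and> 3 * q \<le> n' + 1")
        case False
        then have "path_count n r k = 0"
          unfolding 4 path_count_rec IH1 using Suc IH2 by auto
        then show ?thesis using False 4 Suc by auto
      next
        case True
        then obtain t where t: "k = 2 * q + 2 + t" using le_Suc_ex by blast
        have "path_count n r k = path_count (n' + 2) r k + (path_count n' q (2 * q + t) + (if 1 \<le> t then path_count n' q (2 * q + t - 1) else 0))"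
        proof -
          have "3 \<le> k \<Longrightarrow> t = 0 \<Longrightarrow> path_count n' q (k - 3) = 0" using t by (auto simp: IH2)
          then show ?thesis unfolding 4 path_count_rec using Suc t
            by (cases t) (auto simp: IH2 numeral_3_eq_3)
        qed
        also have "\<dots> = ((n' + 1 - 2 * q) choose Suc q) * (Suc q choose t) + ((n' + 1 - 2 * q) choose q) * (q choose t)"
        proof (cases "3 * q \<le> n'")
          \<comment> \<open>Pascal's rule in the factors with \<open>A\<close> and, for
            \<open>t > 0\<close>, in the factors with \<open>t\<close>.\<close>
          case le: True
          define A where "A = n' - 2 * q"
          have A: "n' + 1 - 2 * q = Suc A" using le by (simp add: A_def Suc_diff_le)
          have 1: "path_count (n' + 2) r k = (A choose Suc q) * (Suc q choose t) + (A choose q) * (q choose t)"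
            unfolding IH1 A_def using le t by simp
          have 2: "path_count n' q (2 * q + u) = (A choose q) * (q choose u) +
              (if q = 0 then 0 else (A choose (q - 1)) * ((q - 1) choose u))" for u
            unfolding IH2 A_def using le by simp
          show ?thesis
          proof (cases t)
            case 0
            show ?thesis unfolding 1 2 A using 0 2[of 0] by (cases q) (simp_all add: algebra_simps)
          next
            case (Suc u)
            have "2 * q + t - 1 = 2 * q + u" using Suc by simp
            then show ?thesis unfolding 1 2 A using Suc 2[of u] by (cases q) (simp_all add: algebra_simps)
          qed
        next
          \<comment> \<open>Now \<open>n = 3 * r - 1\<close>: the blocks fill the whole path, the
            bottom one being short, so no set of type \<open>r\<close> avoids the top
            position.\<close>
          case False
          then have n': "n' + 1 = 3 * q" using True by linarith
          then obtain p where p: "q = Suc p" by (cases q) auto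
          have A: "n' - 2 * q = p" "n' + 1 - 2 * q = q" using n' p by linarith+
          have 1: "path_count (n' + 2) r k = 0" unfolding IH1 using False by simp
          have 2: "path_count n' q (2 * q + u) = p choose u" for u
            unfolding IH2 A using n' p by simp
          show ?thesis
          proof (cases t)
            case 0
            show ?thesis unfolding 1 2 A using 0 p by simp
          next
            case (Suc u)
            have "2 * q + t - 1 = 2 * q + u" using Suc by simp
            then show ?thesis unfolding 1 2 A using Suc 2[of u] p by simp
          qed
        qed
        finally show ?thesis using True 4 Suc t by simp
      qed
    qed
  qed
qed

subsection \<open>Joins of cycles\<close>

text \<open>The graph of the theorem. The number \<open>a\<close> stands for the vertex
  \<open>a div l\<close> in the copy \<open>a mod l\<close> of the m-cycle;
  \<open>cycle_join_iff\<close> confirms this reading.\<close>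

definition cycle_join :: "nat \<Rightarrow> nat \<Rightarrow> nat \<Rightarrow> nat \<Rightarrow> bool" where
  "cycle_join l m = circulant_edge (l * m) {s \<in> {1..(l * m) div 2}. s = l \<or> \<not> l dvd s}"

lemma cycle_join_sym: "cycle_join l m a b \<Longrightarrow> cycle_join l m b a"
  by (auto simp: cycle_join_def circulant_edge_def Let_def split: if_splits)

text \<open>Since \<open>l\<close> divides \<open>l * m\<close>, a difference and its complement are
  both multiples of \<open>l\<close> or both not. Different residues thus always give an edge, equal
  residues only at circular distance \<open>l\<close>.\<close>

lemma cycle_join_less:
  assumes l: "2 \<le> l" and m: "5 \<le> m" and ab: "a < b" "b < l * m"
  shows "cycle_join l m a b \<longleftrightarrow>
    (a mod l \<noteq> b mod l \<or> Suc (a div l) = b div l \<or> (a div l = 0 \<and> b div l = m - 1))"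
proof -
  let ?k = "b - a"
  have e: "cycle_join l m a b \<longleftrightarrow> min ?k (l * m - ?k) \<in> {1..(l * m) div 2} \<and>
     (min ?k (l * m - ?k) = l \<or> \<not> l dvd min ?k (l * m - ?k))"
    using ab by (auto simp: cycle_join_def circulant_edge_def Let_def)
  have rng: "min ?k (l * m - ?k) \<in> {1..(l * m) div 2}"
    using ab by (auto simp: min_def)
  have dv: "a mod l = b mod l \<longleftrightarrow> l dvd ?k"
    using mod_eq_dvd_iff_nat[of a b l] ab by auto
  show ?thesis
  proof (cases "l dvd ?k")
    case False
    have "\<not> l dvd l * m - ?k"
    proof
      assume d: "l dvd l * m - ?k"
      have "l * m - (l * m - ?k) = ?k" using ab by simp
      moreover have "l dvd l * m - (l * m - ?k)" by (rule dvd_diff_nat[OF dvd_triv_left d])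
      ultimately show False using False by simp
    qed
    then have "\<not> l dvd min ?k (l * m - ?k)" using False by (metis min_def)
    then show ?thesis using e rng dv False by blast
  next
    case True
    define x y where "x = a div l" and "y = b div l"
    have md: "a mod l = b mod l" using True dv by simp
    have k: "?k = l * (y - x)"
    proof -
      have "a = l * x + b mod l" "b = l * y + b mod l"
        unfolding x_def y_def using mult_div_mod_eq[of l a] mult_div_mod_eq[of l b] md by simp_all
      then show ?thesis by (metis diff_add_inverse2 diff_diff_add right_diff_distrib' diff_cancel2)
    qed
    have xy: "x < y" using k ab(1) by (cases "x < y") auto
    have ym: "y < m" using ab(2) unfolding y_def by (simp add: less_mult_imp_div_less mult.commute)
    have mn: "min ?k (l * m - ?k) = l * min (y - x) (m - (y - x))"
      using l by (simp add: k min_def flip: right_diff_distrib')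
    have "l dvd min ?k (l * m - ?k)" unfolding mn by simp
    then have "cycle_join l m a b \<longleftrightarrow> min ?k (l * m - ?k) = l" using e rng by blast
    also have "\<dots> \<longleftrightarrow> min (y - x) (m - (y - x)) = 1" unfolding mn using l by simp
    also have "\<dots> \<longleftrightarrow> Suc x = y \<or> (x = 0 \<and> y = m - 1)"
      using xy ym m by (auto simp: min_def)
    finally show ?thesis using md by (simp add: x_def y_def)
  qed
qed

definition cyclic_edge :: "nat \<Rightarrow> nat \<Rightarrow> nat \<Rightarrow> bool" where
  "cyclic_edge m x y \<longleftrightarrow> Suc x mod m = y \<or> Suc y mod m = x"

lemma cyclic_edge_less:
  assumes "x < y" "y < m"
  shows "cyclic_edge m x y \<longleftrightarrow> Suc x = y \<or> (x = 0 \<and> y = m - 1)"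
proof -
  have 1: "Suc x mod m = Suc x" using assms by simp
  have 2: "Suc y mod m = (if Suc y = m then 0 else Suc y)" using assms by (simp add: mod_Suc)
  show ?thesis unfolding cyclic_edge_def 1 2 using assms by auto
qed

lemma cycle_join_iff:
  assumes l: "2 \<le> l" and m: "5 \<le> m" and ab: "a < l * m" "b < l * m" "a \<noteq> b"
  shows "cycle_join l m a b \<longleftrightarrow> a mod l \<noteq> b mod l \<or> cyclic_edge m (a div l) (b div l)"
proof -
  have lt: "cycle_join l m a b \<longleftrightarrow> a mod l \<noteq> b mod l \<or> cyclic_edge m (a div l) (b div l)"
    if "a < b" "b < l * m" for a b
  proof (cases "a mod l = b mod l")
    case True
    have "a div l \<le> b div l" using that by (simp add: div_le_mono)
    moreover have "a div l \<noteq> b div l" using True that by (metis div_mult_mod_eq less_irrefl)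
    moreover have "b div l < m" using that by (simp add: less_mult_imp_div_less mult.commute)
    ultimately show ?thesis
      using cycle_join_less[OF l m that] cyclic_edge_less[of "a div l" "b div l" m] by simp
  next
    case False
    then show ?thesis using cycle_join_less[OF l m that] by simp
  qed
  show ?thesis
  proof (cases "a < b")
    case True
    then show ?thesis using lt ab by simp
  next
    case False
    then have "b < a" using ab by simp
    then show ?thesis using lt[of b a] ab cycle_join_sym[of l m a b] cycle_join_sym[of l m b a]
      by (auto simp: cyclic_edge_def)
  qed
qed

lemma mod_add_right_cancel_nat: "(a + c) mod m = (b + c) mod m \<longleftrightarrow> a mod m = b mod (m::nat)"
  unfolding nat_mod_eq_iff by (simp add: add.assoc add.left_commute[of _ c])

text \<open>The rotation that puts the vertex v of the copy c of the cycle last, so that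
  the remaining vertices form a path in their natural order.\<close>

definition rot :: "nat \<Rightarrow> nat \<Rightarrow> nat \<Rightarrow> nat \<Rightarrow> nat \<Rightarrow> nat" where
  "rot l m c v q = ((q + (v + 1)) mod m) * l + c"

definition cyc_copy :: "nat \<Rightarrow> nat \<Rightarrow> nat \<Rightarrow> nat set" where
  "cyc_copy l m c = {a. a < l * m \<and> a mod l = c}"

text \<open>Cutting the cycle at a missing vertex \<open>v\<close> turns \<open>U\<close> into a
  subset of a path; by \<open>cyc_type_iff\<close> every missing \<open>v\<close> gives the same
  answer. The full cycle has no type.\<close>

definition cyc_type :: "nat \<Rightarrow> nat \<Rightarrow> nat \<Rightarrow> nat set \<Rightarrow> nat \<Rightarrow> bool" where
  "cyc_type l m c U r \<longleftrightarrow> (\<exists>v<m. v * l + c \<notin> U \<and> path_type (m - 1) (rot l m c v -` U) = Some r)"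

lemma ind_complex_image:
  assumes f: "inj_on f X" and E: "\<And>x y. x \<in> X \<Longrightarrow> y \<in> X \<Longrightarrow> x \<noteq> y \<Longrightarrow> E (f x) (f y) \<longleftrightarrow> E' x y"
  shows "ind_complex E (f ` X) = (`) f ` ind_complex E' X"
proof (intro set_eqI iffI)
  fix A assume A: "A \<in> ind_complex E (f ` X)"
  then obtain B where B: "B \<subseteq> X" "A = f ` B" by (auto simp: ind_complex_def subset_image_iff)
  have "\<not> E' x y" if xy: "x \<in> B" "y \<in> B" "x \<noteq> y" for x y
  proof -
    have "f x \<noteq> f y" using f B xy by (auto simp: inj_on_def)
    then have "\<not> E (f x) (f y)" using A B xy by (auto simp: ind_complex_def)
    then show ?thesis using E B xy by blast
  qed
  then have "B \<in> ind_complex E' X" using B by (auto simp: ind_complex_def)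
  then show "A \<in> (`) f ` ind_complex E' X" using B by blast
next
  fix A assume "A \<in> (`) f ` ind_complex E' X"
  then obtain B where B: "B \<in> ind_complex E' X" "A = f ` B" by blast
  have BX: "B \<subseteq> X" using B by (auto simp: ind_complex_def)
  have "\<not> E (f x) (f y)" if "x \<in> B" "y \<in> B" "f x \<noteq> f y" for x y
  proof -
    have "x \<noteq> y" using that by auto
    then have "\<not> E' x y" using B that by (auto simp: ind_complex_def)
    moreover have "x \<in> X" "y \<in> X" using BX that by auto
    ultimately show ?thesis using E \<open>x \<noteq> y\<close> by blast
  qed
  then show "A \<in> ind_complex E (f ` X)" using B BX by (auto simp: ind_complex_def)
qed

text \<open>Deleting a vertex of the cycle leaves a path with \<open>m - 1\<close> vertices, taking
  its link a path with \<open>m - 3\<close>. Unless acyclic, they contribute in degrees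
  \<open>m div 3\<close> and, after the shift by one, \<open>Suc ((m - 2) div 3)\<close>; whatever
  remains equals \<open>(m + 1) div 3\<close>.\<close>

lemma div3_cases:
  assumes "2 \<le> m"
  shows "m mod 3 = 0 \<and> (m - 1) mod 3 = 2 \<and> (m + 1) div 3 = m div 3 \<and> (m + 1) div 3 = Suc ((m - 2) div 3)
    \<or> m mod 3 = 1 \<and> (m - 1) mod 3 = 0 \<and> (m + 1) div 3 = m div 3
    \<or> m mod 3 = 2 \<and> (m - 1) mod 3 = 1 \<and> (m + 1) div 3 = Suc ((m - 2) div 3)"
proof -
  define k where "k = m div 3"
  have "m mod 3 < 3" by simp
  then consider "m = 3 * k" | "m = 3 * k + 1" | "m = 3 * k + 2"
    using div_mult_mod_eq[of m 3] unfolding k_def by linarith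
  then show ?thesis
  proof cases
    case 1
    then obtain j where "k = Suc j" using assms by (cases k) auto
    then have "m = 3 * j + 3" "m - 1 = 3 * j + 2" "m - 2 = 3 * j + 1" using 1 by auto
    moreover have "(3 * j + 2) mod 3 = 2" "(3 * j + 1) div 3 = j" "(3 * j + 3) div 3 = Suc j" "(3 * j + 4) div 3 = Suc j"
      by presburger+
    ultimately show ?thesis by simp
  next
    case 2
    then have "m - 1 = 3 * k" by simp
    moreover have "(3 * k + 2) div 3 = k" by presburger
    ultimately show ?thesis using 2 by simp
  next
    case 3
    then have "m - 1 = 3 * k + 1" "m - 2 = 3 * k" by simp_all
    moreover have "(3 * k + 2) mod 3 = 2" by presburger
    ultimately show ?thesis using 3 by simp
  qed
qed

context
  fixes l m :: nat
  assumes l2: "2 \<le> l" and m5: "5 \<le> m"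
begin

lemma rot_less: "c < l \<Longrightarrow> rot l m c v q < l * m"
proof -
  assume c: "c < l"
  have "(q + (v + 1)) mod m < m" using m5 by simp
  then have "((q + (v + 1)) mod m + 1) * l \<le> m * l" by (intro mult_right_mono) auto
  then show "rot l m c v q < l * m" using c by (simp add: rot_def algebra_simps)
qed

lemma rot_mod: "c < l \<Longrightarrow> rot l m c v q mod l = c"
  by (simp add: rot_def)

lemma rot_div: "c < l \<Longrightarrow> rot l m c v q div l = (q + (v + 1)) mod m"
  by (simp add: rot_def)

lemma rot_inj: "c < l \<Longrightarrow> inj_on (rot l m c v) {..<m}"
proof (rule inj_onI)
  fix x y assume c: "c < l" and xy: "x \<in> {..<m}" "y \<in> {..<m}" "rot l m c v x = rot l m c v y"
  have "(x + (v + 1)) mod m = (y + (v + 1)) mod m" using xy(3) rot_div[OF c] by metis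
  then have "x mod m = y mod m" by (simp only: mod_add_right_cancel_nat)
  then show "x = y" using xy by simp
qed

lemma rot_last: "v < m \<Longrightarrow> rot l m c v (m - 1) = v * l + c"
  using m5 by (simp add: rot_def)

lemma finite_cyc_copy: "finite (cyc_copy l m c)"
  unfolding cyc_copy_def by simp

lemma cyc_copy_eq: "c < l \<Longrightarrow> cyc_copy l m c = (\<lambda>v. v * l + c) ` {..<m}"
proof (intro set_eqI iffI)
  fix a assume c: "c < l" and "a \<in> cyc_copy l m c"
  then have a: "a < l * m" "a mod l = c" by (auto simp: cyc_copy_def)
  have "a div l < m" using a by (simp add: less_mult_imp_div_less mult.commute)
  moreover have "a = (a div l) * l + c" using a by (metis div_mult_mod_eq)
  ultimately show "a \<in> (\<lambda>v. v * l + c) ` {..<m}" by blast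
next
  fix a assume c: "c < l" and "a \<in> (\<lambda>v. v * l + c) ` {..<m}"
  then obtain v where v: "v < m" "a = v * l + c" by auto
  have "(v + 1) * l \<le> m * l" using v by (intro mult_right_mono) auto
  then have "a < l * m" using v c by (simp add: algebra_simps)
  then show "a \<in> cyc_copy l m c" using v c by (simp add: cyc_copy_def)
qed

lemma inj_cyc_copy: "inj_on (\<lambda>v. v * l + c) X"
  using l2 by (auto simp: inj_on_def)

lemma card_cyc_copy: "c < l \<Longrightarrow> card (cyc_copy l m c) = m"
  by (simp add: cyc_copy_eq card_image inj_cyc_copy)

lemma rot_image: 
  assumes "c < l"
  shows "rot l m c v ` {..<m} = cyc_copy l m c"
proof (rule card_subset_eq[OF finite_cyc_copy])
  show "rot l m c v ` {..<m} \<subseteq> cyc_copy l m c"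
    using rot_less rot_mod assms by (auto simp: cyc_copy_def)
  show "card (rot l m c v ` {..<m}) = card (cyc_copy l m c)"
    by (simp add: card_image[OF rot_inj] card_cyc_copy assms)
qed

lemma rot_edge:
  assumes c: "c < l" and xy: "x < m" "y < m" "x \<noteq> y"
  shows "cycle_join l m (rot l m c v x) (rot l m c v y) \<longleftrightarrow> cyclic_edge m x y"
proof -
  have ne: "rot l m c v x \<noteq> rot l m c v y"
    using rot_inj[OF c] xy by (auto simp: inj_on_def)
  have s: "Suc ((x + (v + 1)) mod m) mod m = (y + (v + 1)) mod m \<longleftrightarrow> Suc x mod m = y" if "y < m" for x y
  proof -
    have "Suc ((x + (v + 1)) mod m) mod m = (Suc x + (v + 1)) mod m" by (simp add: mod_Suc_eq)
    then show ?thesis using mod_add_right_cancel_nat[of "Suc x" "v + 1" m y] that by simp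
  qed
  show ?thesis
    unfolding cycle_join_iff[OF l2 m5 rot_less[OF c] rot_less[OF c] ne]
    using s[OF xy(1)] s[OF xy(2)] by (simp add: rot_mod[OF c] rot_div[OF c] cyclic_edge_def)
qed

lemma rot_path_edge:
  assumes "c < l" and "x < m - 1" "y < m - 1" "x \<noteq> y"
  shows "cycle_join l m (rot l m c v x) (rot l m c v y) \<longleftrightarrow> path_edge x y"
  using rot_edge[OF assms(1), of x y v] assms by (simp add: cyclic_edge_def path_edge_def)

lemma cohom_dim_rot:
  fixes s :: "nat set \<Rightarrow> nat \<Rightarrow> 'k::field"
  assumes c: "c < l" and n: "n \<le> m - 1" and s: "sign_fun (rot l m c v ` (X \<inter> {..<n})) s"
  shows "cohom_dim (ind_complex (cycle_join l m) (rot l m c v ` (X \<inter> {..<n}))) s r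
     (if path_type n X = Some r then 1 else 0)"
proof -
  have sub: "X \<inter> {..<n} \<subseteq> {..<m}" using n by auto
  have inj: "inj_on (rot l m c v) (X \<inter> {..<n})" by (rule inj_on_subset[OF rot_inj[OF c] sub])
  have "ind_complex (cycle_join l m) (rot l m c v ` (X \<inter> {..<n}))
      = (`) (rot l m c v) ` ind_complex path_edge (X \<inter> {..<n})"
    by (rule ind_complex_image[OF inj], rule rot_path_edge[OF c]) (use n in auto)
  moreover have "cohom_dim (ind_complex path_edge (X \<inter> {..<n})) (\<lambda>A j. s (rot l m c v ` A) (rot l m c v j)) r
      (if path_type n X = Some r then 1 else 0)"
    by (rule cohom_dim_path[OF sign_fun_image[OF s inj]])
  then have "cohom_dim ((`) (rot l m c v) ` ind_complex path_edge (X \<inter> {..<n})) s r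
      (if path_type n X = Some r then 1 else 0)"
    by (rule cohom_dim_image[OF complex_on_ind_complex inj, rotated]) simp
  ultimately show ?thesis by simp
qed

lemma proper_subset_rot:
  assumes c: "c < l" and v: "v < m" and U: "U \<subseteq> cyc_copy l m c" "v * l + c \<notin> U"
  shows "U = rot l m c v ` ((rot l m c v -` U) \<inter> {..<m - 1})"
proof
  show "U \<subseteq> rot l m c v ` ((rot l m c v -` U) \<inter> {..<m - 1})"
  proof
    fix u assume u: "u \<in> U"
    then obtain q where q: "q < m" "u = rot l m c v q" using U(1) rot_image[OF c, of v] by blast
    then have "q \<noteq> m - 1" using u U(2) rot_last[OF v, of c] by auto
    then show "u \<in> rot l m c v ` ((rot l m c v -` U) \<inter> {..<m - 1})" using q u by auto
  qed
qed auto

lemma cohom_dim_proper: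
  fixes s :: "nat set \<Rightarrow> nat \<Rightarrow> 'k::field"
  assumes c: "c < l" and v: "v < m" and U: "U \<subseteq> cyc_copy l m c" "v * l + c \<notin> U" and s: "sign_fun U s"
  shows "cohom_dim (ind_complex (cycle_join l m) U) s r
     (if path_type (m - 1) (rot l m c v -` U) = Some r then 1 else 0)"
  using cohom_dim_rot[OF c order_refl, of v "rot l m c v -` U" s r] s
  unfolding proper_subset_rot[OF c v U, symmetric] by blast

text \<open>The type is the degree in which the independence complex of \<open>U\<close> has
  cohomology, and this degree knows nothing of the cut. The field \<open>rat\<close> only serves to
  run the argument.\<close>

lemma cyc_type_iff:
  assumes c: "c < l" and v: "v < m" and U: "U \<subseteq> cyc_copy l m c" "v * l + c \<notin> U"
  shows "cyc_type l m c U r \<longleftrightarrow> path_type (m - 1) (rot l m c v -` U) = Some r"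
proof -
  have "finite U" using U(1) finite_cyc_copy finite_subset by blast
  then have s: "sign_fun U (koszul_sign U :: _ \<Rightarrow> _ \<Rightarrow> rat)" by (rule sign_fun_koszul_sign)
  have "path_type (m - 1) (rot l m c v -` U) = Some r"
    if w: "w < m" "w * l + c \<notin> U" "path_type (m - 1) (rot l m c w -` U) = Some r" for w
  proof (rule ccontr)
    assume "path_type (m - 1) (rot l m c v -` U) \<noteq> Some r"
    then have "acyclic_at (ind_complex (cycle_join l m) U) (koszul_sign U :: _ \<Rightarrow> _ \<Rightarrow> rat) r"
      using cohom_dim_proper[OF c v U s, of r] by (simp add: cohom_dim_0)
    then show False
      using cohom_dim_proper[OF c w(1) U(1) w(2) s, of r] w(3) cohom_dim_1_not_acyclic by auto
  qed
  then show ?thesis using v U by (auto simp: cyc_type_def)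
qed

lemma cyc_type_bound: "cyc_type l m c U r \<Longrightarrow> 3 * r \<le> m"
  using path_type_bound[of "m - 1" _ r] m5 by (fastforce simp: cyc_type_def)

lemma not_cyc_type_full: "c < l \<Longrightarrow> \<not> cyc_type l m c (cyc_copy l m c) r"
  by (auto simp: cyc_type_def cyc_copy_eq)

lemma path_type_del:
  assumes c: "c < l" and v: "v < m"
  shows "path_type (m - 1) (rot l m c v -` (cyc_copy l m c - {v * l + c})) =
    (if (m - 1) mod 3 = 1 then None else Some (m div 3))"
proof -
  have "rot l m c v q \<noteq> v * l + c" if "q < m - 1" for q
  proof
    assume "rot l m c v q = v * l + c"
    then have "rot l m c v q = rot l m c v (m - 1)" using rot_last[OF v] by simp
    then have "q = m - 1" using that rot_inj[OF c, of v] by (auto simp: inj_on_def)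
    then show False using that by simp
  qed
  moreover have "rot l m c v q \<in> cyc_copy l m c" if "q < m - 1" for q
    using that rot_image[OF c, of v] by auto
  ultimately have "{..<m - 1} \<subseteq> rot l m c v -` (cyc_copy l m c - {v * l + c})" by auto
  from path_type_full[OF this] show ?thesis using m5 by simp
qed

lemma cohom_dim_del:
  fixes s :: "nat set \<Rightarrow> nat \<Rightarrow> 'k::field"
  assumes c: "c < l" and v: "v < m" and s: "sign_fun (cyc_copy l m c - {v * l + c}) s"
  shows "cohom_dim (ind_complex (cycle_join l m) (cyc_copy l m c - {v * l + c})) s r
     (if (m - 1) mod 3 \<noteq> 1 \<and> r = m div 3 then 1 else 0)"
proof -
  have "path_type (m - 1) (rot l m c v -` (cyc_copy l m c - {v * l + c})) = Some r
      \<longleftrightarrow> (m - 1) mod 3 \<noteq> 1 \<and> r = m div 3"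
    unfolding path_type_del[OF c v] by auto
  then show ?thesis using cohom_dim_proper[OF c v _ _ s, of r] by simp
qed

lemma cohom_dim_cycle_link:
  fixes s :: "nat set \<Rightarrow> nat \<Rightarrow> 'k::field"
  assumes c: "c < l" and s: "sign_fun (cyc_copy l m c) s"
  shows "cohom_dim (link (ind_complex (cycle_join l m) (cyc_copy l m c)) (rot l m c 0 (m - 2)))
     (\<lambda>A. s (insert (rot l m c 0 (m - 2)) A)) r (if m mod 3 \<noteq> 1 \<and> r = (m - 2) div 3 then 1 else 0)"
proof -
  \<comment> \<open>Position \<open>m - 2\<close> has the neighbours \<open>m - 3\<close> and
    \<open>m - 1\<close>, so its non-neighbours form an initial segment of the rotated
    order.\<close>
  let ?f = "rot l m c 0" let ?b = "?f (m - 2)"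
  have b: "?b \<in> cyc_copy l m c" using rot_image[OF c, of 0] m5 by auto
  have L: "{u \<in> cyc_copy l m c. u \<noteq> ?b \<and> \<not> cycle_join l m u ?b} = ?f ` (UNIV \<inter> {..<m - 3})"
  proof -
    have key: "?f q \<noteq> ?b \<and> \<not> cycle_join l m (?f q) ?b \<longleftrightarrow> q < m - 3" if q: "q < m" for q
    proof (cases "q = m - 2")
      case False
      have "?f q \<noteq> ?b" using rot_inj[OF c, of 0] False q m5 by (auto simp: inj_on_def)
      moreover have "cyclic_edge m q (m - 2) \<longleftrightarrow> q = m - 3 \<or> q = m - 1"
      proof (cases "q < m - 2")
        case True
        then have "cyclic_edge m q (m - 2) \<longleftrightarrow> Suc q = m - 2 \<or> (q = 0 \<and> m - 2 = m - 1)"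
          using m5 by (intro cyclic_edge_less) auto
        then show ?thesis using True m5 by presburger
      next
        case F: False
        then have "q = m - 1" using False q by auto
        then show ?thesis using m5 by (auto simp: cyclic_edge_def)
      qed
      ultimately show ?thesis using rot_edge[OF c q _ False, of 0] q False m5 by auto
    qed (use m5 in auto)
    have "{u \<in> cyc_copy l m c. u \<noteq> ?b \<and> \<not> cycle_join l m u ?b}
        = ?f ` {q \<in> {..<m}. ?f q \<noteq> ?b \<and> \<not> cycle_join l m (?f q) ?b}"
      unfolding rot_image[OF c, of 0, symmetric] by (rule Compr_image_eq)
    also have "{q \<in> {..<m}. ?f q \<noteq> ?b \<and> \<not> cycle_join l m (?f q) ?b} = UNIV \<inter> {..<m - 3}"
    proof (rule set_eqI)
      fix q
      show "q \<in> {q \<in> {..<m}. ?f q \<noteq> ?b \<and> \<not> cycle_join l m (?f q) ?b} \<longleftrightarrow> q \<in> UNIV \<inter> {..<m - 3}"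
        using key[of q] by (cases "q < m") simp_all
    qed
    finally show ?thesis .
  qed
  have "sign_fun (?f ` (UNIV \<inter> {..<m - 3})) (\<lambda>A. s (insert ?b A))"
    unfolding L[symmetric] by (rule sign_fun_link[OF s b]) auto
  from cohom_dim_rot[OF c _ this, of r]
  have "cohom_dim (ind_complex (cycle_join l m) (?f ` (UNIV \<inter> {..<m - 3}))) (\<lambda>A. s (insert ?b A)) r
      (if path_type (m - 3) UNIV = Some r then 1 else 0)" by simp
  moreover have "path_type (m - 3) UNIV = (if m mod 3 = 1 then None else Some ((m - 2) div 3))"
  proof -
    have "(m - 3) mod 3 = m mod 3" "m - 3 + 1 = m - 2" using m5 by (auto simp: le_mod_geq)
    then show ?thesis using path_type_full[of "m - 3" UNIV] by simp
  qed
  then have "path_type (m - 3) UNIV = Some r \<longleftrightarrow> m mod 3 \<noteq> 1 \<and> r = (m - 2) div 3" by auto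
  moreover have "link (ind_complex (cycle_join l m) (cyc_copy l m c)) ?b
      = ind_complex (cycle_join l m) {u \<in> cyc_copy l m c. u \<noteq> ?b \<and> \<not> cycle_join l m u ?b}"
    by (rule link_ind_complex[OF b]) (rule cycle_join_sym)
  ultimately show ?thesis unfolding L by simp
qed

lemma rot_vertex: 
  assumes "c < l" "q < m" 
  obtains v where "v < m" "rot l m c 0 q = v * l + c"
proof -
  have "rot l m c 0 q \<in> cyc_copy l m c" using rot_image[OF assms(1), of 0] assms(2) by auto
  then show thesis using that by (auto simp: cyc_copy_eq[OF assms(1)])
qed

text \<open>Outside the critical degree both the deletion and, one degree lower, the link of a
  vertex are acyclic.\<close>

lemma acyclic_at_cycle:
  fixes s :: "nat set \<Rightarrow> nat \<Rightarrow> 'k::field"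
  assumes c: "c < l" and s: "sign_fun (cyc_copy l m c) s" and r: "r \<noteq> (m + 1) div 3"
  shows "acyclic_at (ind_complex (cycle_join l m) (cyc_copy l m c)) s r"
proof -
  obtain v where v: "v < m" "rot l m c 0 (m - 2) = v * l + c" using rot_vertex[OF c, of "m - 2"] m5 by auto
  have vc: "v * l + c \<in> cyc_copy l m c" using v(1) c by (auto simp: cyc_copy_eq)
  show ?thesis
  proof (cases r)
    case 0
    then show ?thesis using acyclic_at_0_ind_complex[OF finite_cyc_copy s vc] by simp
  next
    case (Suc q)
    have d: "\<not> ((m - 1) mod 3 \<noteq> 1 \<and> Suc q = m div 3)" 
      and e: "\<not> (m mod 3 \<noteq> 1 \<and> q = (m - 2) div 3)"
      using r Suc m5 div3_cases[of m] by auto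
    have "acyclic_at (del (ind_complex (cycle_join l m) (cyc_copy l m c)) (v * l + c)) s (Suc q)"
      unfolding del_ind_complex cohom_dim_0[symmetric]
      using cohom_dim_del[OF c v(1) sign_fun_subset[OF s], of "Suc q"] unfolding if_not_P[OF d] by blast
    moreover have "acyclic_at (link (ind_complex (cycle_join l m) (cyc_copy l m c)) (v * l + c)) (\<lambda>A. s (insert (v * l + c) A)) q"
      using cohom_dim_cycle_link[OF c s, of q] unfolding v(2) cohom_dim_0[symmetric] if_not_P[OF e] .
    ultimately show ?thesis unfolding Suc
      by (rule acyclic_at_link_del[OF complex_on_ind_complex[OF finite_cyc_copy] s])
  qed
qed

text \<open>For this residue the deletion is acyclic in all degrees, so the class of the link
  survives. The full cycle is needed for the top degree here, since by \<open>cyc_type_bound\<close>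
  no proper subset reaches it.\<close>

lemma cohom_dim_cycle_2:
  fixes s :: "nat set \<Rightarrow> nat \<Rightarrow> 'k::field"
  assumes c: "c < l" and s: "sign_fun (cyc_copy l m c) s" and m: "m mod 3 = 2"
  shows "cohom_dim (ind_complex (cycle_join l m) (cyc_copy l m c)) s ((m + 1) div 3) 1"
proof -
  obtain v where v: "v < m" "rot l m c 0 (m - 2) = v * l + c" using rot_vertex[OF c, of "m - 2"] m5 by auto
  have d: "(m - 1) mod 3 = 1" "(m + 1) div 3 = Suc ((m - 2) div 3)"
    using m m5 div3_cases[of m] by auto
  have "acyclic_at (del (ind_complex (cycle_join l m) (cyc_copy l m c)) (v * l + c)) s r" for r
    unfolding del_ind_complex cohom_dim_0[symmetric]
    using cohom_dim_del[OF c v(1) sign_fun_subset[OF s], of r] d by auto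
  moreover have "cohom_dim (link (ind_complex (cycle_join l m) (cyc_copy l m c)) (v * l + c)) (\<lambda>A. s (insert (v * l + c) A)) ((m - 2) div 3) 1"
    using cohom_dim_cycle_link[OF c s, of "(m - 2) div 3"] m unfolding v(2) by simp
  ultimately show ?thesis unfolding d(2)
    by (rule cohom_dim_link[OF complex_on_ind_complex[OF finite_cyc_copy] s])
qed

text \<open>The critical degree is left out because the full cycle has cohomology there without
  having a \<open>cyc_type\<close>; its dimension is even 2 when 3 divides \<open>m\<close>.\<close>

lemma cohom_dim_copy_subset:
  fixes s :: "nat set \<Rightarrow> nat \<Rightarrow> 'k::field"
  assumes c: "c < l" and U: "U \<subseteq> cyc_copy l m c" and s: "sign_fun U s" and r: "r \<noteq> (m + 1) div 3"
  shows "cohom_dim (ind_complex (cycle_join l m) U) s r (if cyc_type l m c U r then 1 else 0)"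
proof (cases "U = cyc_copy l m c")
  case True
  then show ?thesis using acyclic_at_cycle[OF c _ r, of s] s not_cyc_type_full[OF c]
    by (simp add: cohom_dim_0)
next
  case False
  then obtain v where v: "v < m" "v * l + c \<notin> U" using U by (auto simp: cyc_copy_eq[OF c])
  show ?thesis unfolding cyc_type_iff[OF c v(1) U v(2)] by (rule cohom_dim_proper[OF c v(1) U v(2) s])
qed

text \<open>Vertices of different copies are adjacent, so an independent set lies in one copy, and
  the independence complex of \<open>W\<close> is the union of those of its traces, glued at the
  empty face.\<close>

lemma betti_cycle_join:
  fixes K :: "'k::field itself"
  assumes r: "2 \<le> r" "r \<noteq> (m + 1) div 3"
  shows "betti K {..<l * m} (cycle_join l m) i (i + r)
    = (\<Sum>W | W \<subseteq> {..<l * m} \<and> card W = i + r. card {c \<in> {..<l}. cyc_type l m c (W \<inter> cyc_copy l m c) r})"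
proof -
  let ?E = "cycle_join l m"
  let ?n = "\<lambda>W c. if cyc_type l m c (W \<inter> cyc_copy l m c) r then 1 else 0 :: nat"
  have ex: "\<exists>z :: nat \<Rightarrow> nat set \<Rightarrow> 'k. cohom_basis (ind_complex ?E (W \<inter> cyc_copy l m c)) (koszul_sign W) r {..<?n W c} z"
    if W: "W \<subseteq> {..<l * m}" and c: "c < l" for W c
  proof -
    have "finite W" using W finite_subset by blast
    \<comment> \<open>The signs stay those of the whole set \<open>W\<close>, as Hochster's formula
      demands, even on a trace.\<close>
    then have s: "sign_fun (W \<inter> cyc_copy l m c) (koszul_sign W :: _ \<Rightarrow> _ \<Rightarrow> 'k)"
      by (intro sign_fun_subset[OF sign_fun_koszul_sign]) auto
    show ?thesis using cohom_dim_copy_subset[OF c _ s r(2)] unfolding cohom_dim_def by blast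
  qed
  define z' :: "nat set \<Rightarrow> nat \<Rightarrow> nat \<Rightarrow> nat set \<Rightarrow> 'k" where
    "z' W c = (SOME z. cohom_basis (ind_complex ?E (W \<inter> cyc_copy l m c)) (koszul_sign W) r {..<?n W c} z)" for W c
  have z: "cohom_basis (ind_complex ?E (W \<inter> cyc_copy l m c)) (koszul_sign W) r {..<?n W c} (z' W c)"
    if "W \<subseteq> {..<l * m}" "c < l" for W c
    unfolding z'_def by (rule someI_ex[OF ex[OF that]])
  let ?I = "\<lambda>W. SIGMA c:{..<l}. {..<?n W c}"
  have "betti K {..<l * m} ?E i (i + r) = (\<Sum>W | W \<subseteq> {..<l * m} \<and> card W = i + r. card (?I W))"
  proof (rule hochster[where z = "\<lambda>W (c, k) A. if A \<in> ind_complex ?E (W \<inter> cyc_copy l m c) then z' W c k A else 0"])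
    fix W assume W: "W \<subseteq> {..<l * m}" "card W = i + r"
    have fW: "finite W" using W(1) finite_subset by blast
    show "cohom_basis (ind_complex ?E W) (koszul_sign W) (i + r - i) (?I W)
       (\<lambda>(c, k) A. if A \<in> ind_complex ?E (W \<inter> cyc_copy l m c) then z' W c k A else 0)"
      unfolding add_diff_cancel_left'
    proof (rule cohom_basis_disjoint_union[where W = W])
      fix c
      show "complex_on W (ind_complex ?E (W \<inter> cyc_copy l m c))"
        using complex_on_ind_complex[of "W \<inter> cyc_copy l m c" ?E] fW unfolding complex_on_def by auto
      show "ind_complex ?E (W \<inter> cyc_copy l m c) \<subseteq> ind_complex ?E W" by (auto simp: ind_complex_def)
      show "cohom_basis (ind_complex ?E (W \<inter> cyc_copy l m c)) (koszul_sign W) r {..<?n W c} (z' W c)"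
        if "c \<in> {..<l}" using z[OF W(1), of c] that by simp
    next
      fix A assume A: "A \<in> ind_complex ?E W" "A \<noteq> {}"
      then obtain a where a: "a \<in> A" by blast
      have AW: "A \<subseteq> W" using A by (auto simp: ind_complex_def)
      have "b mod l = a mod l" if b: "b \<in> A" for b
      proof (rule ccontr)
        assume n: "b mod l \<noteq> a mod l"
        then have "b \<noteq> a" by auto
        moreover have "b < l * m" "a < l * m" using AW W(1) a b by auto
        ultimately have "?E b a" using cycle_join_iff[OF l2 m5, of b a] n by blast
        then show False using A(1) a b \<open>b \<noteq> a\<close> by (auto simp: ind_complex_def)
      qed
      then have "A \<subseteq> cyc_copy l m (a mod l)" using AW W(1) by (auto simp: cyc_copy_def)
      then have "A \<in> ind_complex ?E (W \<inter> cyc_copy l m (a mod l))"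
        using A by (auto simp: ind_complex_def)
      moreover have "a mod l < l" using l2 by simp
      ultimately show "\<exists>c\<in>{..<l}. A \<in> ind_complex ?E (W \<inter> cyc_copy l m c)" by blast
    next
      fix A c c' assume "A \<in> ind_complex ?E (W \<inter> cyc_copy l m c)" "A \<in> ind_complex ?E (W \<inter> cyc_copy l m c')" "A \<noteq> {}"
      then show "c = c'" by (auto simp: ind_complex_def cyc_copy_def)
    qed (use r in auto)
  qed auto
  also have "\<dots> = (\<Sum>W | W \<subseteq> {..<l * m} \<and> card W = i + r. card {c \<in> {..<l}. cyc_type l m c (W \<inter> cyc_copy l m c) r})"
  proof (rule sum.cong[OF refl])
    fix W
    have "card (?I W) = (\<Sum>c<l. ?n W c)" by (subst card_SigmaI) auto
    also have "\<dots> = card {c \<in> {..<l}. cyc_type l m c (W \<inter> cyc_copy l m c) r}"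
      by (simp add: sum.If_cases Int_def)
    finally show "card (?I W) = card {c \<in> {..<l}. cyc_type l m c (W \<inter> cyc_copy l m c) r}" .
  qed
  finally show ?thesis .
qed


section \<open>Counting the subsets of a cycle by type and size\<close>

definition cyc_count :: "nat \<Rightarrow> nat \<Rightarrow> nat \<Rightarrow> nat" where
  "cyc_count c r k = card {U. U \<subseteq> cyc_copy l m c \<and> cyc_type l m c U r \<and> card U = k}"

text \<open>The rotation for \<open>v\<close> carries the subsets of the path to the subsets of the
  copy that avoid \<open>v\<close>, and the type may be read off at this very
  \<open>v\<close>.\<close>

lemma cyc_type_avoiding_count:
  assumes c: "c < l" and v: "v < m"
  shows "card {U. U \<subseteq> cyc_copy l m c \<and> v * l + c \<notin> U \<and> cyc_type l m c U r \<and> card U = k} = path_count (m - 1) r k"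
proof -
  let ?f = "rot l m c v"
  let ?X = "{X. X \<subseteq> {..<m - 1} \<and> path_type (m - 1) X = Some r \<and> card X = k}"
  have inj: "inj_on ?f {..<m - 1}" by (rule inj_on_subset[OF rot_inj[OF c]]) auto
  have last: "v * l + c \<notin> ?f ` X" if X: "X \<subseteq> {..<m - 1}" for X
  proof
    assume "v * l + c \<in> ?f ` X"
    then obtain q where q: "q \<in> X" "?f q = ?f (m - 1)" using rot_last[OF v, of c] by auto
    then have "q < m - 1" using X by auto
    moreover from this have "q < m" by linarith
    ultimately show False using inj_onD[OF rot_inj[OF c] q(2)] m5 by auto
  qed
  have pre: "?f -` (?f ` X) \<inter> {..<m - 1} = X" if X: "X \<subseteq> {..<m - 1}" for X
    using X inj by (auto simp: inj_on_def)
  have sub: "?f ` X \<subseteq> cyc_copy l m c" if "X \<subseteq> {..<m - 1}" for X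
    using that rot_image[OF c, of v] by fastforce
  have ty: "cyc_type l m c (?f ` X) r \<longleftrightarrow> path_type (m - 1) X = Some r" if X: "X \<subseteq> {..<m - 1}" for X
  proof -
    have "path_type (m - 1) (?f -` (?f ` X)) = path_type (m - 1) X"
      using pre[OF X] X by (intro path_type_cong) auto
    then show ?thesis using cyc_type_iff[OF c v sub[OF X] last[OF X]] by simp
  qed
  have cd: "card (?f ` X) = card X" if X: "X \<subseteq> {..<m - 1}" for X
    by (rule card_image[OF inj_on_subset[OF inj X]])
  have "{U. U \<subseteq> cyc_copy l m c \<and> v * l + c \<notin> U \<and> cyc_type l m c U r \<and> card U = k} = (`) ?f ` ?X"
  proof (intro set_eqI iffI)
    fix U assume U: "U \<in> {U. U \<subseteq> cyc_copy l m c \<and> v * l + c \<notin> U \<and> cyc_type l m c U r \<and> card U = k}"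
    let ?Y = "?f -` U \<inter> {..<m - 1}"
    have Y: "?Y \<subseteq> {..<m - 1}" by auto
    have "U = ?f ` ?Y" using U by (intro proper_subset_rot[OF c v]) auto
    then have UY: "?f ` ?Y = U" by (rule sym)
    have "path_type (m - 1) ?Y = Some r" "card ?Y = k" using ty[OF Y] cd[OF Y] U unfolding UY by auto
    then have "?Y \<in> ?X" using Y by blast
    then show "U \<in> (`) ?f ` ?X" by (rule rev_image_eqI) (rule UY[symmetric])
  next
    fix U assume "U \<in> (`) ?f ` ?X"
    then obtain X where X: "U = ?f ` X" "X \<subseteq> {..<m - 1}" "path_type (m - 1) X = Some r" "card X = k" by blast
    show "U \<in> {U. U \<subseteq> cyc_copy l m c \<and> v * l + c \<notin> U \<and> cyc_type l m c U r \<and> card U = k}"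
      using X(3,4) sub[OF X(2)] last[OF X(2)] ty[OF X(2)] cd[OF X(2)] unfolding X(1) by blast
  qed
  moreover have "inj_on ((`) ?f) ?X"
    by (rule inj_on_subset[OF inj_on_image_Pow[OF inj]]) auto
  ultimately show ?thesis by (simp add: path_count_def card_image)
qed

text \<open>Both sides count the pairs of such a set U and a vertex outside it.\<close>

lemma cyc_count_path_count:
  assumes c: "c < l"
  shows "(m - k) * cyc_count c r k = m * path_count (m - 1) r k"
proof -
  let ?A = "{U. U \<subseteq> cyc_copy l m c \<and> cyc_type l m c U r \<and> card U = k}"
  have fA: "finite ?A" using finite_cyc_copy by (auto intro: finite_subset[of _ "Pow (cyc_copy l m c)"])
  have compl: "(\<Sum>v<m. of_bool (v * l + c \<notin> U)) = m - k" if U: "U \<in> ?A" for U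
  proof -
    have "(\<Sum>v<m. of_bool (v * l + c \<notin> U)) = card {v \<in> {..<m}. v * l + c \<notin> U}"
      by (simp add: Int_def)
    also have "\<dots> = card ((\<lambda>v. v * l + c) ` {v \<in> {..<m}. v * l + c \<notin> U})"
      by (rule card_image[OF inj_cyc_copy, symmetric])
    also have "(\<lambda>v. v * l + c) ` {v \<in> {..<m}. v * l + c \<notin> U} = cyc_copy l m c - U"
      unfolding cyc_copy_eq[OF c] by auto
    also have "card \<dots> = m - k"
      using U card_cyc_copy[OF c] finite_cyc_copy by (subst card_Diff_subset) (auto intro: finite_subset)
    finally show ?thesis .
  qed
  have av: "(\<Sum>U\<in>?A. of_bool (v * l + c \<notin> U)) = path_count (m - 1) r k" if v: "v < m" for v
  proof -
    have "(\<Sum>U\<in>?A. of_bool (v * l + c \<notin> U)) = card {U \<in> ?A. v * l + c \<notin> U}"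
      using fA by (simp add: Int_def)
    also have "{U \<in> ?A. v * l + c \<notin> U} = {U. U \<subseteq> cyc_copy l m c \<and> v * l + c \<notin> U \<and> cyc_type l m c U r \<and> card U = k}"
      by blast
    finally show ?thesis using cyc_type_avoiding_count[OF c v] by simp
  qed
  have "(m - k) * cyc_count c r k = (\<Sum>U\<in>?A. m - k)" by (simp add: cyc_count_def)
  also have "\<dots> = (\<Sum>U\<in>?A. \<Sum>v<m. of_bool (v * l + c \<notin> U))"
    by (rule sum.cong[OF refl]) (simp only: compl)
  also have "\<dots> = (\<Sum>v<m. \<Sum>U\<in>?A. of_bool (v * l + c \<notin> U))" by (rule sum.swap)
  also have "\<dots> = m * path_count (m - 1) r k" using av by simp
  finally show ?thesis .
qed

text \<open>On the cycle the cut vertex completes the short bottom block of a path, so the blocks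
  become \<open>r\<close> disjoint arcs of three vertices, and \<open>k - 2 * r\<close> of their
  \<open>r\<close> free vertices are chosen. The proof reaches this count from the pairs by
  absorption identities.\<close>

lemma cyc_count_closed:
  assumes c: "c < l" and r: "1 \<le> r" "r < (m + 1) div 3"
  shows "real (cyc_count c r k) = real m / real (m - 2 * r) * real ((m - 2 * r) choose r)
     * (if 2 * r \<le> k then real (r choose (k - 2 * r)) else 0)"
proof (cases "k < m")
  \<comment> \<open>At \<open>k = m\<close> the count of pairs reads 0 = 0 on its left factor, so
    this case rests on the full copy having no type; on the right, \<open>k - 2 * r\<close> exceeds
    \<open>r\<close>.\<close>
  case False
  have "U = cyc_copy l m c" if "U \<subseteq> cyc_copy l m c" "card U = k" for U
    using that False card_cyc_copy[OF c] card_mono[OF finite_cyc_copy that(1)]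
    by (intro card_subset_eq[OF finite_cyc_copy]) auto
  then have "{U. U \<subseteq> cyc_copy l m c \<and> cyc_type l m c U r \<and> card U = k} = {}"
    using not_cyc_type_full[OF c] by blast
  then have "cyc_count c r k = 0" unfolding cyc_count_def by (simp only: card.empty)
  moreover have "r choose (k - 2 * r) = 0" using False r by (intro binomial_eq_0) linarith
  ultimately show ?thesis by simp
next
  case True
  have r3: "3 * r + 2 \<le> m" using r by linarith
  define A where "A = m - 2 * r"
  have A: "r < A" "real A = real m - 2 * real r" using r3 by (auto simp: A_def of_nat_diff)
  obtain a where a: "A = Suc a" using A(1) by (cases A) auto
  obtain q where q: "r = Suc q" using r by (cases r) auto
  have N: "real (m - k) * real (cyc_count c r k) = real m * real (path_count (m - 1) r k)"
    using cyc_count_path_count[OF c, of k r] by (metis of_nat_mult)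
  have mk: "real (m - k) > 0" using True by simp
  show ?thesis
  proof (cases "2 * r \<le> k")
    case False
    then have "path_count (m - 1) r k = 0" by (simp add: path_count_closed)
    then show ?thesis using N mk False by simp
  next
    case k: True
    then obtain t where t: "k = 2 * r + t" using le_Suc_ex by blast
    have P: "path_count (m - 1) r k = (a choose r) * (r choose t) + (a choose q) * (q choose t)"
    proof -
      have "m - 1 - 2 * r = a" using a A_def by simp
      then show ?thesis using r3 k t q by (simp add: path_count_closed)
    qed
    \<comment> \<open>Three absorption identities replace \<open>a\<close> by \<open>A\<close> and
      \<open>q\<close> by \<open>r\<close>. The factors \<open>A - r\<close> and
      \<open>r - t\<close> that they leave add up to \<open>A - t = m - k\<close>, which
      cancels.\<close>
    have b1: "real A * real (a choose q) = real r * real (A choose r)"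
      unfolding a q using Suc_times_binomial_eq[of a q] by (metis of_nat_mult mult.commute)
    have b2: "real A * real (a choose r) = (real A - real r) * real (A choose r)"
    proof -
      have "real (A choose r) = real (a choose q) + real (a choose r)" unfolding a q by simp
      then show ?thesis using b1 by (simp add: algebra_simps)
    qed
    have b3: "real r * real (q choose t) = (real r - real t) * real (r choose t)"
    proof (cases t)
      case 0 then show ?thesis by simp
    next
      case (Suc u)
      have "real (Suc q) * real (q choose u) = real (Suc q choose Suc u) * real (Suc u)"
        using Suc_times_binomial_eq[of q u] by (metis of_nat_mult)
      then show ?thesis unfolding q Suc by (simp add: algebra_simps)
    qed
    have "real A * (real (m - k) * real (cyc_count c r k))
        = real m * ((real A * real (a choose r)) * real (r choose t) + (real A * real (a choose q)) * real (q choose t))"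
      unfolding N P by (simp add: algebra_simps)
    also have "\<dots> = real m * ((real A - real r) * real (A choose r) * real (r choose t) + real (A choose r) * (real r * real (q choose t)))"
      unfolding b1 b2 by (simp add: algebra_simps)
    also have "\<dots> = real m * real (A choose r) * real (r choose t) * (real A - real t)"
      unfolding b3 by (simp add: algebra_simps)
    also have "real A - real t = real (m - k)" using A(2) t True by (simp add: of_nat_diff)
    finally have "real (m - k) * (real A * real (cyc_count c r k)) = real (m - k) * (real m * real (A choose r) * real (r choose t))"
      by (simp add: algebra_simps)
    then have "real A * real (cyc_count c r k) = real m * real (A choose r) * real (r choose t)"
      using mk by simp
    then show ?thesis using k t A(1) unfolding A_def[symmetric] by (simp add: field_simps)
  qed
qed

section \<open>Summation over the copies, and the regularity\<close>

lemma card_subsets_by_trace: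
  assumes V: "finite V" and A: "A \<subseteq> V"
  shows "card {W. W \<subseteq> V \<and> card W = d \<and> P (W \<inter> A)}
    = (\<Sum>k\<le>d. card {U. U \<subseteq> A \<and> P U \<and> card U = k} * (card (V - A) choose (d - k)))"
proof -
  have fA: "finite A" using V A finite_subset by blast
  let ?S = "\<lambda>k. {U. U \<subseteq> A \<and> P U \<and> card U = k} \<times> {Y. Y \<subseteq> V - A \<and> card Y = d - k}"
  have fin: "finite X" if "X \<subseteq> V" for X using that V finite_subset by blast
  have fS: "finite (?S k)" for k
    using fA V by (intro finite_cartesian_product) auto
  have "bij_betw (\<lambda>W. (W \<inter> A, W - A)) {W. W \<subseteq> V \<and> card W = d \<and> P (W \<inter> A)} (\<Union>k\<le>d. ?S k)"
  proof (rule bij_betw_byWitness[where f' = "\<lambda>(U, Y). U \<union> Y"])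
    show "(\<lambda>W. (W \<inter> A, W - A)) ` {W. W \<subseteq> V \<and> card W = d \<and> P (W \<inter> A)} \<subseteq> (\<Union>k\<le>d. ?S k)"
    proof
      fix p assume "p \<in> (\<lambda>W. (W \<inter> A, W - A)) ` {W. W \<subseteq> V \<and> card W = d \<and> P (W \<inter> A)}"
      then obtain W where W: "p = (W \<inter> A, W - A)" "W \<subseteq> V" "card W = d" "P (W \<inter> A)" by blast
      have "card W = card (W \<inter> A) + card (W - A)" 
        using fin[OF W(2)] by (metis card_Int_Diff)
      then have "card (W \<inter> A) \<le> d" "card (W - A) = d - card (W \<inter> A)" using W(3) by auto
      then have "p \<in> ?S (card (W \<inter> A))" using W by auto
      then show "p \<in> (\<Union>k\<le>d. ?S k)" using \<open>card (W \<inter> A) \<le> d\<close> by blast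
    qed
    show "(\<lambda>(U, Y). U \<union> Y) ` (\<Union>k\<le>d. ?S k) \<subseteq> {W. W \<subseteq> V \<and> card W = d \<and> P (W \<inter> A)}"
    proof
      fix W assume "W \<in> (\<lambda>(U, Y). U \<union> Y) ` (\<Union>k\<le>d. ?S k)"
      then obtain U Y k where h: "W = U \<union> Y" "k \<le> d" "U \<subseteq> A" "P U" "card U = k" "Y \<subseteq> V - A" "card Y = d - k"
        by auto
      have "finite U" "finite Y" "U \<inter> Y = {}" using fin[of U] fin[of Y] h A by auto
      then have "card W = d" using h by (simp add: card_Un_disjoint)
      moreover have "W \<inter> A = U" using h by auto
      ultimately show "W \<in> {W. W \<subseteq> V \<and> card W = d \<and> P (W \<inter> A)}" using h A by auto
    qed
  qed auto
  then have "card {W. W \<subseteq> V \<and> card W = d \<and> P (W \<inter> A)} = card (\<Union>k\<le>d. ?S k)"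
    by (rule bij_betw_same_card)
  also have "\<dots> = (\<Sum>k\<le>d. card (?S k))"
    using fS by (intro card_UN_disjoint) auto
  also have "\<dots> = (\<Sum>k\<le>d. card {U. U \<subseteq> A \<and> P U \<and> card U = k} * (card (V - A) choose (d - k)))"
    using V by (simp add: card_cartesian_product n_subsets)
  finally show ?thesis .
qed

text \<open>With \<open>s = k - 2 * r\<close> this is Vandermonde's identity. For
  \<open>i < r\<close> every index stays below \<open>2 * r\<close>, in line with the convention for
  a negative lower entry.\<close>

lemma vandermonde_shifted:
  "(\<Sum>k\<le>i + r. (if 2 * r \<le> k then real (r choose (k - 2 * r)) else 0) * real (M choose (i + r - k)))
    = (if r \<le> i then real ((M + r) choose (i - r)) else 0)"
proof (cases "r \<le> i")
  case False
  then show ?thesis by (auto intro!: sum.neutral)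
next
  case True
  have "(\<Sum>k\<le>i + r. (if 2 * r \<le> k then real (r choose (k - 2 * r)) else 0) * real (M choose (i + r - k)))
    = (\<Sum>k\<in>{2 * r..i + r}. real (r choose (k - 2 * r)) * real (M choose (i + r - k)))"
    by (intro sum.mono_neutral_cong_right) auto
  also have "\<dots> = (\<Sum>s\<le>i - r. real (r choose s) * real (M choose (i - r - s)))"
    using True
    by (intro sum.reindex_bij_witness[where i = "\<lambda>s. s + 2 * r" and j = "\<lambda>k. k - 2 * r"]) 
      (auto simp: algebra_simps)
  also have "\<dots> = real ((r + M) choose (i - r))"
    unfolding vandermonde[symmetric] by simp
  finally show ?thesis using True by (simp add: add.commute)
qed

text \<open>Pairs of a set \<open>W\<close> and a copy in which its trace has type \<open>r\<close>
  are counted: the rest of \<open>W\<close> is an arbitrary subset of the other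
  \<open>(l - 1) * m\<close> vertices, and the \<open>l\<close> copies count alike, whence the
  factor \<open>l * m\<close>.\<close>

lemma betti_cycle_join_closed:
  fixes K :: "'k::field itself"
  assumes r: "2 \<le> r" "r < (m + 1) div 3"
  shows "real (betti K {..<l * m} (cycle_join l m) i (i + r))
    = real (l * m) / real (m - 2 * r) * real ((m - 2 * r) choose r)
             * (if r \<le> i then real (((l - 1) * m + r) choose (i - r)) else 0)"
proof -
  let ?V = "{..<l * m}" and ?d = "i + r"
  have V: "finite {W. W \<subseteq> ?V \<and> card W = ?d}" by simp
  have "betti K ?V (cycle_join l m) i ?d
    = (\<Sum>W | W \<subseteq> ?V \<and> card W = ?d. \<Sum>c<l. of_bool (cyc_type l m c (W \<inter> cyc_copy l m c) r))"
    using betti_cycle_join[of r K i] r by (simp add: Int_def)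
  also have "\<dots> = (\<Sum>c<l. \<Sum>W | W \<subseteq> ?V \<and> card W = ?d. of_bool (cyc_type l m c (W \<inter> cyc_copy l m c) r))"
    by (rule sum.swap)
  also have "\<dots> = (\<Sum>c<l. card {W. W \<subseteq> ?V \<and> card W = ?d \<and> cyc_type l m c (W \<inter> cyc_copy l m c) r})"
    using V by (intro sum.cong refl) (simp add: Int_def conj_assoc)
  also have "\<dots> = (\<Sum>c<l. \<Sum>k\<le>?d. cyc_count c r k * (((l - 1) * m) choose (?d - k)))"
  proof (rule sum.cong[OF refl])
    fix c assume "c \<in> {..<l}"
    then have c: "c < l" by simp
    have sub: "cyc_copy l m c \<subseteq> ?V" by (auto simp: cyc_copy_def)
    have "card (?V - cyc_copy l m c) = (l - 1) * m"
      using card_Diff_subset[OF finite_cyc_copy sub] card_cyc_copy[OF c] by (simp add: diff_mult_distrib)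
    then show "card {W. W \<subseteq> ?V \<and> card W = ?d \<and> cyc_type l m c (W \<inter> cyc_copy l m c) r}
        = (\<Sum>k\<le>?d. cyc_count c r k * (((l - 1) * m) choose (?d - k)))"
      using card_subsets_by_trace[OF _ sub, of ?d "\<lambda>U. cyc_type l m c U r"]
      by (simp add: cyc_count_def)
  qed
  finally have "real (betti K ?V (cycle_join l m) i ?d)
      = (\<Sum>c<l. \<Sum>k\<le>?d. real (cyc_count c r k) * real (((l - 1) * m) choose (?d - k)))" by simp
  also have "\<dots> = (\<Sum>c<l. \<Sum>k\<le>?d. real m / real (m - 2 * r) * real ((m - 2 * r) choose r) *
      ((if 2 * r \<le> k then real (r choose (k - 2 * r)) else 0) * real (((l - 1) * m) choose (?d - k))))"
  proof (intro sum.cong refl)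
    fix c k assume "c \<in> {..<l}"
    then have c: "c < l" by simp
    show "real (cyc_count c r k) * real (((l - 1) * m) choose (?d - k)) = real m / real (m - 2 * r) * real ((m - 2 * r) choose r) *
      ((if 2 * r \<le> k then real (r choose (k - 2 * r)) else 0) * real (((l - 1) * m) choose (?d - k)))"
      using cyc_count_closed[OF c _ r(2), of k] r(1) by (simp add: mult.assoc)
  qed
  also have "\<dots> = real l * (real m / real (m - 2 * r) * real ((m - 2 * r) choose r) *
     (if r \<le> i then real (((l - 1) * m + r) choose (i - r)) else 0))"
    unfolding sum_distrib_left[symmetric] vandermonde_shifted by simp
  finally show ?thesis by simp
qed

text \<open>A type \<open>r\<close> requires \<open>3 * r \<le> m\<close>, which fails here, and
  \<open>m \<ge> 5\<close> puts these degrees in the range \<open>r \<ge> 2\<close>.\<close>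

lemma betti_cycle_join_vanish:
  fixes K :: "'k::field itself"
  assumes r: "(m + 1) div 3 < r"
  shows "betti K {..<l * m} (cycle_join l m) i (i + r) = 0"
proof -
  have "\<not> cyc_type l m c U r" for c U using cyc_type_bound[of c U r] r by linarith
  then show ?thesis using betti_cycle_join[of r K i] r m5 by simp
qed

lemma betti_cycle_join_nonzero:
  fixes K :: "'k::field itself"
  shows "\<exists>i. betti K {..<l * m} (cycle_join l m) i (i + (m + 1) div 3) \<noteq> 0"
proof -
  let ?R = "(m + 1) div 3"
  have c: "0 < l" using l2 by simp
  have sub: "cyc_copy l m 0 \<subseteq> {..<l * m}" by (auto simp: cyc_copy_def)
  have sg: "sign_fun W (koszul_sign W :: _ \<Rightarrow> _ \<Rightarrow> 'k)" if "W \<subseteq> cyc_copy l m 0" for W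
    using that finite_cyc_copy finite_subset by (intro sign_fun_koszul_sign) blast
  have "\<exists>W. W \<subseteq> cyc_copy l m 0 \<and> ?R \<le> card W \<and> cohom_dim (ind_complex (cycle_join l m) W) (koszul_sign W :: _ \<Rightarrow> _ \<Rightarrow> 'k) ?R 1"
  proof (cases "m mod 3 = 2")
    case True
    then show ?thesis
      using cohom_dim_cycle_2[OF c sg[OF order_refl] True] card_cyc_copy[OF c] m5
      by (intro exI[of _ "cyc_copy l m 0"]) auto
  next
    case False
    \<comment> \<open>For the other residues the cycle without the vertex 0, a path with
      \<open>m - 1\<close> vertices, already reaches the top degree. The form
      \<open>0 * l + 0\<close> matches the general vertex \<open>v * l + c\<close>.\<close>
    have v: "0 * l + 0 \<in> cyc_copy l m 0" using c m5 by (auto simp: cyc_copy_def)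
    let ?W = "cyc_copy l m 0 - {0 * l + 0}"
    have "(m - 1) mod 3 \<noteq> 1 \<and> ?R = m div 3" using div3_cases[of m] m5 False by auto
    then have "cohom_dim (ind_complex (cycle_join l m) ?W) (koszul_sign ?W :: _ \<Rightarrow> _ \<Rightarrow> 'k) ?R 1"
      using cohom_dim_del[OF c _ sg, of 0 ?R] m5 by auto
    moreover have "card ?W = m - 1" using v card_cyc_copy[OF c] finite_cyc_copy by simp
    ultimately show ?thesis using m5 by (intro exI[of _ ?W]) auto
  qed
  then obtain W where W: "W \<subseteq> cyc_copy l m 0" "?R \<le> card W"
    "cohom_dim (ind_complex (cycle_join l m) W) (koszul_sign W :: _ \<Rightarrow> _ \<Rightarrow> 'k) ?R 1" by blast
  have "betti K {..<l * m} (cycle_join l m) (card W - ?R) (card W) \<noteq> 0"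
  proof (rule betti_nonzero)
    show "\<not> acyclic_at (ind_complex (cycle_join l m) W) (koszul_sign W :: _ \<Rightarrow> _ \<Rightarrow> 'k) (card W - (card W - ?R))"
      using cohom_dim_1_not_acyclic[OF W(3)] W(2) by simp
  qed (use W sub in auto)
  then show ?thesis using W(2) by (intro exI[of _ "card W - ?R"]) simp
qed

text \<open>Degrees 0 and 1 are never computed: \<open>m \<ge> 5\<close> gives
  \<open>(m + 1) div 3 \<ge> 2\<close>, so they cannot exceed the maximum.\<close>

lemma reg_cycle_join:
  fixes K :: "'k::field itself"
  shows "reg K {..<l * m} (cycle_join l m) = int ((m + 1) div 3)"
proof -
  let ?R = "(m + 1) div 3" and ?b = "betti K {..<l * m} (cycle_join l m)"
  let ?S = "{int d - int i | i d. ?b i d \<noteq> 0}"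
  \<comment> \<open>Bounds on both sides also give finiteness, which \<open>Max\<close>
    requires.\<close>
  have bd: "x \<in> int ` {..?R}" if xS: "x \<in> ?S" for x
  proof -
    obtain i d where x: "x = int d - int i" "?b i d \<noteq> 0" using xS by blast
    have "i \<le> d" using x(2) betti_degree_less[of "{..<l * m}" d i K] by (meson finite_lessThan not_le)
    then obtain r where d: "d = i + r" using le_Suc_ex by blast
    have "r \<le> ?R" using x(2) betti_cycle_join_vanish[of r K i] unfolding d by (meson not_le)
    then show ?thesis using x(1) d by auto
  qed
  then have fin: "finite ?S" by (meson finite_imageI finite_atMost finite_subset subsetI)
  obtain i where i: "?b i (i + ?R) \<noteq> 0" using betti_cycle_join_nonzero by blast
  have "int ?R \<in> ?S" using i by (intro CollectI exI[of _ i] exI[of _ "i + ?R"]) simp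
  moreover have "x \<le> int ?R" if "x \<in> ?S" for x using bd[OF that] by auto
  ultimately show ?thesis unfolding reg_def using fin by (intro Max_eqI) auto
qed

end

theorem theorem4p4:
  fixes K :: "'k::field itself" and m l :: nat
  assumes "m \<ge> 5" and "l \<ge> 2"
  shows "reg K {..<l * m}
           (circulant_edge (l * m) {s \<in> {1..(l * m) div 2}. s = l \<or> \<not> l dvd s})
           = int ((m + 1) div 3)
       \<and> (\<forall>r i. 2 \<le> r \<and> r < (m + 1) div 3 \<longrightarrow>
           real (betti K {..<l * m}
                   (circulant_edge (l * m) {s \<in> {1..(l * m) div 2}. s = l \<or> \<not> l dvd s}) i (i + r))
           = real (l * m) / real (m - 2 * r) * real ((m - 2 * r) choose r)
             * (if r \<le> i then real (((l - 1) * m + r) choose (i - r)) else 0))"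
  using reg_cycle_join[OF assms(2,1), of K] betti_cycle_join_closed[OF assms(2,1), of _ K]
  unfolding cycle_join_def by blast

end
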